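(* Let $d\in\mathbb{N}$ be fixed and let $(Z_n)_n$ be one of the families $(A_{n-1})_n$, $(B_n)_n$, $(D_n)_n$. For large enough $n$ the isotypic decompositions of the $Z_n$-module $H_{n,d}$ and of the $Z_{n+1}$-module $H_{n+1,d}$ remain stable, in the sense that for every (bi-)partition $\Lambda=(\lambda,\mu)\vdash n$ the irreducible $Z_n$-module $S^{(\lambda,\mu)}$ occurs in $H_{n,d}$ with the same multiplicity as the irreducible $Z_{n+1}$-module $S^{(\lambda+1,\mu)}$ occurs in $H_{n+1,d}$, where $\lambda+1:=(\lambda_1+1,\lambda_2,\ldots,\lambda_l)$ for $\lambda=(\lambda_1,\ldots,\lambda_l)$. This stabilization occurs at least for all $n\geq 2d$ in the case $Z_n=A_{n-1}$, for all $n\geq d$ in the case $Z_n=B_n$, and for all $n>2d$ in the case $Z_n=D_n$.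
   Context: $H_{n,d}$ is the space of real forms of degree $d$ in $X_1,\ldots,X_n$. Type $A_{n-1}$ means the symmetric group $\mathfrak{S}_n$ acting on $\mathbb{R}^n$ by permuting coordinates; $B_n$ is the hyperoctahedral group of all coordinate permutations and sign changes; $D_n\subset B_n$ is the index-2 subgroup of permutations combined with an even number of sign changes. A bipartition $(\lambda,\mu)\vdash n$ is a pair of (possibly empty) partitions with $|\lambda|+|\mu|=n$; for $A_{n-1}$ only partitions $\lambda\vdash n$ are used (identify $\lambda$ with $(\lambda,\emptyset)$). If $\lambda=\emptyset$, then $\lambda+1=(1)$. The irreducible modules are labelled as usual: for $A_{n-1}$, $S^\lambda$ is the Specht module of shape $\lambda$. For $B_n$, $S^{(\lambda,\mu)}$ is the module induced from $B_{|\lambda|}\times B_{|\mu|}$ of the tensor product of the Specht module of $\lambda$ (sign changes acting trivially) and the Specht module of $\mu$ (each single-coordinate sign change acting by $-1$). For $D_n$, $S^{(\lambda,\mu)}$ is the restriction of the $B_n$-module; here $S^{(\lambda,\mu)}$ and $S^{(\mu,\lambda)}$ are $D_n$-isomorphic, so one labels by bipartitions with $|\lambda|\geq|\mu|$, and for $\lambda\neq\mu$ the restriction is irreducible, while for $\lambda=\mu$ it splits into two non-isomorphic irreducible $D_n$-modules (and the multiplicity statement is then understood for each of these two constituents). *)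

theory Defs
  imports Complex_Main "HOL-Algebra.Group" "HOL-Library.Poly_Mapping"
    "HOL-Combinatorics.Permutations"
begin

section \<open>Vector spaces of formal linear combinations\<close>

instantiation poly_mapping :: (type, real_vector) real_vector
begin

lift_definition scaleR_poly_mapping :: "real \<Rightarrow> ('a \<Rightarrow>\<^sub>0 'b) \<Rightarrow> ('a \<Rightarrow>\<^sub>0 'b)"
  is "\<lambda>c f x. c *\<^sub>R f x"
proof -
  fix c :: real and f :: "'a \<Rightarrow> 'b"
  assume "finite {x. f x \<noteq> 0}"
  moreover have "{x. c *\<^sub>R f x \<noteq> 0} \<subseteq> {x. f x \<noteq> 0}" by auto
  ultimately show "finite {x. c *\<^sub>R f x \<noteq> 0}" by (rule rev_finite_subset)
qed

instance
  by standard
    (transfer; simp add: fun_eq_iff scaleR_add_right scaleR_add_left)+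

end

definition linear_extension :: "('k \<Rightarrow> 'v::real_vector) \<Rightarrow> ('k \<Rightarrow>\<^sub>0 real) \<Rightarrow> 'v" where
  "linear_extension \<phi> p = (\<Sum>k\<in>Poly_Mapping.keys p. Poly_Mapping.lookup p k *\<^sub>R \<phi> k)"


section \<open>Representations, submodules, multiplicities\<close>

text \<open>
  A real representation is a subspace of an ambient real vector space together with an action
  of group elements. The group is a separate argument of the notions below, so that
  passing to a subgroup restricts the representation.
\<close>

record ('g, 'v) rep =
  rep_space :: "'v set"
  rep_act :: "'g \<Rightarrow> 'v \<Rightarrow> 'v"

definition submodule :: "'g set \<Rightarrow> ('g, 'v::real_vector) rep \<Rightarrow> 'v set \<Rightarrow> bool" where
  "submodule G R W \<longleftrightarrow> subspace W \<and> W \<subseteq> rep_space R \<and>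
     (\<forall>g\<in>G. \<forall>w\<in>W. rep_act R g w \<in> W)"

definition subrep :: "('g, 'v) rep \<Rightarrow> 'v set \<Rightarrow> ('g, 'v) rep" where
  "subrep R W = R\<lparr>rep_space := W\<rparr>"

definition irreducible_rep :: "'g set \<Rightarrow> ('g, 'v::real_vector) rep \<Rightarrow> bool" where
  "irreducible_rep G R \<longleftrightarrow> rep_space R \<noteq> {0} \<and>
     (\<forall>W. submodule G R W \<longrightarrow> W = {0} \<or> W = rep_space R)"

definition irreducible_submodule :: "'g set \<Rightarrow> ('g, 'v::real_vector) rep \<Rightarrow> 'v set \<Rightarrow> bool" where
  "irreducible_submodule G R W \<longleftrightarrow> submodule G R W \<and> irreducible_rep G (subrep R W)"

text \<open>
  Asking for a linear map on the ambient space is no restriction, since a linear map on a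
  subspace always extends.
\<close>

definition isomorphic_reps ::
    "'g set \<Rightarrow> ('g, 'v::real_vector) rep \<Rightarrow> ('g, 'w::real_vector) rep \<Rightarrow> bool" where
  "isomorphic_reps G R S \<longleftrightarrow> (\<exists>f. linear f \<and> bij_betw f (rep_space R) (rep_space S) \<and>
     (\<forall>g\<in>G. \<forall>v\<in>rep_space R. f (rep_act R g v) = rep_act S g (f v)))"

definition irreducible_decomposition ::
    "'g set \<Rightarrow> ('g, 'v::real_vector) rep \<Rightarrow> 'v set set \<Rightarrow> bool" where
  "irreducible_decomposition G R \<W> \<longleftrightarrow> finite \<W> \<and>
     (\<forall>W\<in>\<W>. irreducible_submodule G R W) \<and>
     (\<forall>v\<in>rep_space R. \<exists>!f. (\<forall>W\<in>\<W>. f W \<in> W) \<and> (\<forall>W. W \<notin> \<W> \<longrightarrow> f W = 0) \<and> v = (\<Sum>W\<in>\<W>. f W))"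

text \<open>
  The multiplicity is a relation rather than a description operator: it holds for
  \<open>m\<close> only if the module is a finite direct sum of irreducible submodules, and every such
  decomposition has exactly \<open>m\<close> summands isomorphic to \<open>S\<close>. Hence there is at most one
  such \<open>m\<close>, and no default value.
\<close>

definition has_multiplicity ::
    "'g set \<Rightarrow> ('g, 'v::real_vector) rep \<Rightarrow> ('g, 'w::real_vector) rep \<Rightarrow> nat \<Rightarrow> bool" where
  "has_multiplicity G R S m \<longleftrightarrow>
     (\<exists>\<W>. irreducible_decomposition G R \<W>) \<and>
     (\<forall>\<W>. irreducible_decomposition G R \<W> \<longrightarrow>
        card {W \<in> \<W>. isomorphic_reps G (subrep R W) S} = m)"

text \<open>
  The induced module, as the space of those functions \<open>f : G \<rightarrow> V\<close> with
  \<open>f (h g) = h f(g)\<close> for \<open>h \<in> H\<close>, on which \<open>G\<close> acts by right translation of the argument.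
  For a finite group this agrees with the tensor product construction.
\<close>

definition induced_rep ::
    "('g, 'm) monoid_scheme \<Rightarrow> 'g set \<Rightarrow> ('g, 'v::real_vector) rep \<Rightarrow> ('g, 'g \<Rightarrow>\<^sub>0 'v) rep" where
  "induced_rep G H R = \<lparr>
     rep_space = {f. Poly_Mapping.keys f \<subseteq> carrier G \<and>
       (\<forall>g\<in>carrier G. Poly_Mapping.lookup f g \<in> rep_space R) \<and>
       (\<forall>h\<in>H. \<forall>g\<in>carrier G.
          Poly_Mapping.lookup f (h \<otimes>\<^bsub>G\<^esub> g) = rep_act R h (Poly_Mapping.lookup f g))},
     rep_act = (\<lambda>g f. \<Sum>x\<in>carrier G. Poly_Mapping.single x (Poly_Mapping.lookup f (x \<otimes>\<^bsub>G\<^esub> g)))\<rparr>"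


section \<open>The three families of groups\<close>

text \<open>
  The pair \<open>(\<sigma>, \<epsilon>)\<close> is the linear map sending the \<open>i\<close>-th unit vector to
  \<open>\<epsilon> i\<close> times the \<open>\<sigma> i\<close>-th one. Coordinates are numbered from \<open>0\<close>.
\<close>

type_synonym signed_perm = "(nat \<Rightarrow> nat) \<times> (nat \<Rightarrow> real)"

definition hyperoctahedral_group :: "nat \<Rightarrow> signed_perm monoid" where
  "hyperoctahedral_group n = \<lparr>
     carrier = {(\<sigma>, \<epsilon>). \<sigma> permutes {..<n} \<and> (\<forall>i<n. \<epsilon> i = 1 \<or> \<epsilon> i = -1) \<and> (\<forall>i\<ge>n. \<epsilon> i = 1)},
     monoid.mult = (\<lambda>(\<sigma>, \<epsilon>) (\<tau>, \<delta>). (\<sigma> \<circ> \<tau>, \<lambda>i. \<epsilon> (\<tau> i) * \<delta> i)),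
     monoid.one = (id, \<lambda>_. 1)\<rparr>"

lemma mem_hyperoctahedral:
  "(\<sigma>, \<epsilon>) \<in> carrier (hyperoctahedral_group n) \<longleftrightarrow>
     \<sigma> permutes {..<n} \<and> (\<forall>i<n. \<epsilon> i = 1 \<or> \<epsilon> i = -1) \<and> (\<forall>i\<ge>n. \<epsilon> i = 1)"
  by (simp add: hyperoctahedral_group_def)

lemma mult_hyperoctahedral:
  "(\<sigma>, \<epsilon>) \<otimes>\<^bsub>hyperoctahedral_group n\<^esub> (\<tau>, \<delta>) = (\<sigma> \<circ> \<tau>, \<lambda>i. \<epsilon> (\<tau> i) * \<delta> i)"
  by (simp add: hyperoctahedral_group_def)

lemma one_hyperoctahedral: "\<one>\<^bsub>hyperoctahedral_group n\<^esub> = (id, \<lambda>_. 1)"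
  by (simp add: hyperoctahedral_group_def)

lemma group_hyperoctahedral: "group (hyperoctahedral_group n)"
proof (rule groupI)
  fix x y
  assume a: "x \<in> carrier (hyperoctahedral_group n)" "y \<in> carrier (hyperoctahedral_group n)"
  obtain \<sigma> \<epsilon> \<tau> \<delta> where xy: "x = (\<sigma>, \<epsilon>)" "y = (\<tau>, \<delta>)"
    by (metis prod.exhaust)
  have s: "\<sigma> permutes {..<n}" "\<forall>i<n. \<epsilon> i = 1 \<or> \<epsilon> i = -1" "\<forall>i\<ge>n. \<epsilon> i = 1"
    and t: "\<tau> permutes {..<n}" "\<forall>i<n. \<delta> i = 1 \<or> \<delta> i = -1" "\<forall>i\<ge>n. \<delta> i = 1"
    using a unfolding xy mem_hyperoctahedral by blast+
  have "\<epsilon> (\<tau> i) * \<delta> i = 1 \<or> \<epsilon> (\<tau> i) * \<delta> i = -1" if "i < n" for i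
  proof -
    have "\<tau> i < n" using permutes_in_image[OF t(1), of i] that by simp
    then have "\<epsilon> (\<tau> i) = 1 \<or> \<epsilon> (\<tau> i) = -1" "\<delta> i = 1 \<or> \<delta> i = -1"
      using s(2) t(2) that by blast+
    then show ?thesis by (elim disjE) simp_all
  qed
  moreover have "\<epsilon> (\<tau> i) * \<delta> i = 1" if "i \<ge> n" for i
  proof -
    have "\<tau> i = i" using permutes_not_in[OF t(1), of i] that by simp
    then show ?thesis using s(3) t(3) that by simp
  qed
  ultimately show "x \<otimes>\<^bsub>hyperoctahedral_group n\<^esub> y \<in> carrier (hyperoctahedral_group n)"
    unfolding xy mult_hyperoctahedral mem_hyperoctahedral
    using permutes_compose[OF t(1) s(1)] by blast
next
  show "\<one>\<^bsub>hyperoctahedral_group n\<^esub> \<in> carrier (hyperoctahedral_group n)"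
    unfolding one_hyperoctahedral mem_hyperoctahedral using permutes_id by blast
next
  fix x y z
  show "x \<otimes>\<^bsub>hyperoctahedral_group n\<^esub> y \<otimes>\<^bsub>hyperoctahedral_group n\<^esub> z =
    x \<otimes>\<^bsub>hyperoctahedral_group n\<^esub> (y \<otimes>\<^bsub>hyperoctahedral_group n\<^esub> z)"
    by (cases x; cases y; cases z) (simp add: mult_hyperoctahedral comp_assoc mult.assoc)
next
  fix x
  show "\<one>\<^bsub>hyperoctahedral_group n\<^esub> \<otimes>\<^bsub>hyperoctahedral_group n\<^esub> x = x"
    by (cases x) (simp add: mult_hyperoctahedral one_hyperoctahedral)
next
  fix x
  assume a: "x \<in> carrier (hyperoctahedral_group n)"
  obtain \<sigma> \<epsilon> where x: "x = (\<sigma>, \<epsilon>)" by (cases x)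
  have s: "\<sigma> permutes {..<n}" "\<forall>i<n. \<epsilon> i = 1 \<or> \<epsilon> i = -1" "\<forall>i\<ge>n. \<epsilon> i = 1"
    using a unfolding x mem_hyperoctahedral by blast+
  define \<rho> where "\<rho> = inv_into UNIV \<sigma>"
  have p: "\<rho> permutes {..<n}" unfolding \<rho>_def by (rule permutes_inv[OF s(1)])
  have inv: "\<rho> (\<sigma> i) = i" for i unfolding \<rho>_def by (rule permutes_inverses(2)[OF s(1)])
  have sq: "\<epsilon> i * \<epsilon> i = 1" for i
  proof -
    have "\<epsilon> i = 1 \<or> \<epsilon> i = -1" using s(2,3) not_less by blast
    then show ?thesis by (elim disjE) simp_all
  qed
  have "\<epsilon> (\<rho> i) = 1 \<or> \<epsilon> (\<rho> i) = -1" if "i < n" for i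
    using s(2) permutes_in_image[OF p, of i] that by simp
  moreover have "\<epsilon> (\<rho> i) = 1" if "i \<ge> n" for i
    using s(3) permutes_not_in[OF p, of i] that by simp
  ultimately have "(\<rho>, \<lambda>i. \<epsilon> (\<rho> i)) \<in> carrier (hyperoctahedral_group n)"
    unfolding mem_hyperoctahedral using p by blast
  moreover have "(\<rho>, \<lambda>i. \<epsilon> (\<rho> i)) \<otimes>\<^bsub>hyperoctahedral_group n\<^esub> x = \<one>\<^bsub>hyperoctahedral_group n\<^esub>"
    by (simp add: x mult_hyperoctahedral one_hyperoctahedral inv sq fun_eq_iff)
  ultimately show "\<exists>y\<in>carrier (hyperoctahedral_group n).
      y \<otimes>\<^bsub>hyperoctahedral_group n\<^esub> x = \<one>\<^bsub>hyperoctahedral_group n\<^esub>" by blast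
qed

datatype family = Type_A | Type_B | Type_D

text \<open>\<open>family_group Type_A n\<close> is the symmetric group on \<open>n\<close> letters, i.e. of type \<open>A\<close> and rank \<open>n - 1\<close>.\<close>

fun family_group :: "family \<Rightarrow> nat \<Rightarrow> signed_perm set" where
  "family_group Type_A n = {(\<sigma>, \<epsilon>). \<sigma> permutes {..<n} \<and> \<epsilon> = (\<lambda>_. 1)}"
| "family_group Type_B n = carrier (hyperoctahedral_group n)"
| "family_group Type_D n =
     {(\<sigma>, \<epsilon>) \<in> carrier (hyperoctahedral_group n). even (card {i. i < n \<and> \<epsilon> i = -1})}"

text \<open>The subgroup \<open>B\<^sub>k \<times> B\<^sub>n\<^sub>-\<^sub>k\<close>, whose factors act on the first \<open>k\<close> and the last \<open>n - k\<close> coordinates.\<close>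

definition block_subgroup :: "nat \<Rightarrow> nat \<Rightarrow> signed_perm set" where
  "block_subgroup k n = {(\<sigma>, \<epsilon>) \<in> carrier (hyperoctahedral_group n). \<sigma> ` {..<k} = {..<k}}"


section \<open>Forms\<close>

type_synonym real_mpoly = "(nat \<Rightarrow>\<^sub>0 nat) \<Rightarrow>\<^sub>0 real"

definition Var :: "nat \<Rightarrow> real_mpoly" where
  "Var i = Poly_Mapping.single (Poly_Mapping.single i 1) 1"

definition substitute :: "(nat \<Rightarrow> real_mpoly) \<Rightarrow> real_mpoly \<Rightarrow> real_mpoly" where
  "substitute h =
     linear_extension (\<lambda>m. \<Prod>i\<in>Poly_Mapping.keys m. h i ^ Poly_Mapping.lookup m i)"

text \<open>
  The action \<open>(g p)(x) = p (g\<^sup>-\<^sup>1 x)\<close>; as \<open>g\<close> is orthogonal, it replaces \<open>X\<^sub>i\<close> by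
  \<open>\<epsilon> i X\<^sub>\<sigma>\<^sub>(\<^sub>i\<^sub>)\<close>.
\<close>

definition forms :: "nat \<Rightarrow> nat \<Rightarrow> (signed_perm, real_mpoly) rep" where
  "forms n d = \<lparr>
     rep_space = {p. \<forall>m\<in>Poly_Mapping.keys p. Poly_Mapping.keys m \<subseteq> {..<n} \<and>
       (\<Sum>i\<in>Poly_Mapping.keys m. Poly_Mapping.lookup m i) = d},
     rep_act = (\<lambda>(\<sigma>, \<epsilon>). substitute (\<lambda>i. \<epsilon> i *\<^sub>R Var (\<sigma> i)))\<rparr>"


section \<open>Partitions and Specht modules\<close>

definition partitions :: "nat \<Rightarrow> nat list set" where
  "partitions n = {\<alpha>. sorted_wrt (\<ge>) \<alpha> \<and> 0 \<notin> set \<alpha> \<and> sum_list \<alpha> = n}"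

fun add_to_first_part :: "nat list \<Rightarrow> nat list" where
  "add_to_first_part [] = [1]"
| "add_to_first_part (a # \<alpha>) = (a + 1) # \<alpha>"

definition diagram :: "nat list \<Rightarrow> (nat \<times> nat) set" where
  "diagram \<alpha> = {(i, j). i < length \<alpha> \<and> j < \<alpha> ! i}"

definition tableau :: "nat set \<Rightarrow> nat list \<Rightarrow> (nat \<times> nat \<Rightarrow> nat) \<Rightarrow> bool" where
  "tableau A \<alpha> t \<longleftrightarrow> bij_betw t (diagram \<alpha>) A"

text \<open>A tabloid, i.e. a tableau up to reordering of its rows, is given by the sets of entries of its rows.\<close>

type_synonym tabloid = "nat \<Rightarrow> nat set"

definition tabloid_of :: "nat list \<Rightarrow> (nat \<times> nat \<Rightarrow> nat) \<Rightarrow> tabloid" where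
  "tabloid_of \<alpha> t = (\<lambda>i. t ` {c \<in> diagram \<alpha>. fst c = i})"

definition permute_tabloid :: "(nat \<Rightarrow> nat) \<Rightarrow> tabloid \<Rightarrow> tabloid" where
  "permute_tabloid \<sigma> T = (\<lambda>i. \<sigma> ` T i)"

definition column_stabilizer :: "nat set \<Rightarrow> nat list \<Rightarrow> (nat \<times> nat \<Rightarrow> nat) \<Rightarrow> (nat \<Rightarrow> nat) set" where
  "column_stabilizer A \<alpha> t = {\<pi>. \<pi> permutes A \<and>
     (\<forall>j. \<pi> ` t ` {c \<in> diagram \<alpha>. snd c = j} = t ` {c \<in> diagram \<alpha>. snd c = j})}"

definition polytabloid :: "nat set \<Rightarrow> nat list \<Rightarrow> (nat \<times> nat \<Rightarrow> nat) \<Rightarrow> tabloid \<Rightarrow>\<^sub>0 real" where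
  "polytabloid A \<alpha> t = (\<Sum>\<pi>\<in>column_stabilizer A \<alpha> t.
     Poly_Mapping.single (permute_tabloid \<pi> (tabloid_of \<alpha> t)) (of_int (sign \<pi>)))"

definition specht_space :: "nat set \<Rightarrow> nat list \<Rightarrow> (tabloid \<Rightarrow>\<^sub>0 real) set" where
  "specht_space A \<alpha> = span {polytabloid A \<alpha> t | t. tableau A \<alpha> t}"

definition specht_A :: "nat list \<Rightarrow> (signed_perm, tabloid \<Rightarrow>\<^sub>0 real) rep" where
  "specht_A \<alpha> = \<lparr>
     rep_space = specht_space {..<sum_list \<alpha>} \<alpha>,
     rep_act = (\<lambda>(\<sigma>, _). linear_extension (\<lambda>T. Poly_Mapping.single (permute_tabloid \<sigma> T) 1))\<rparr>"

definition tensor :: "('a \<Rightarrow>\<^sub>0 real) \<Rightarrow> ('b \<Rightarrow>\<^sub>0 real) \<Rightarrow> ('a \<times> 'b) \<Rightarrow>\<^sub>0 real" where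
  "tensor u v = linear_extension (\<lambda>a. linear_extension (\<lambda>b. Poly_Mapping.single (a, b) 1) v) u"

text \<open>
  The tensor product of the Specht modules of \<open>\<alpha>\<close> (letters \<open>0, \<dots>, k - 1\<close>) and \<open>\<beta>\<close>
  (letters \<open>k, \<dots>, n - 1\<close>), where \<open>k = |\<alpha>|\<close> and \<open>n = |\<alpha>| + |\<beta>|\<close>, inside the space with
  basis the pairs of tabloids. A sign change of a coordinate in the second block acts by \<open>-1\<close>.
\<close>

definition block_rep ::
    "nat list \<Rightarrow> nat list \<Rightarrow> (signed_perm, (tabloid \<times> tabloid) \<Rightarrow>\<^sub>0 real) rep" where
  "block_rep \<alpha> \<beta> = (let k = sum_list \<alpha>; n = sum_list \<alpha> + sum_list \<beta> in \<lparr>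
     rep_space = span {tensor u v | u v.
       u \<in> specht_space {..<k} \<alpha> \<and> v \<in> specht_space {k..<n} \<beta>},
     rep_act = (\<lambda>(\<sigma>, \<epsilon>). linear_extension (\<lambda>(S, T).
       Poly_Mapping.single (permute_tabloid \<sigma> S, permute_tabloid \<sigma> T) (\<Prod>i\<in>{k..<n}. \<epsilon> i)))\<rparr>)"

definition specht_B ::
    "nat list \<Rightarrow> nat list \<Rightarrow> (signed_perm, signed_perm \<Rightarrow>\<^sub>0 ((tabloid \<times> tabloid) \<Rightarrow>\<^sub>0 real)) rep" where
  "specht_B \<alpha> \<beta> = (let n = sum_list \<alpha> + sum_list \<beta> in
     induced_rep (hyperoctahedral_group n) (block_subgroup (sum_list \<alpha>) n) (block_rep \<alpha> \<beta>))"


section \<open>Stability\<close>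

fun labels :: "family \<Rightarrow> nat \<Rightarrow> (nat list \<times> nat list) set" where
  "labels Type_A n = {(\<alpha>, \<beta>). \<alpha> \<in> partitions n \<and> \<beta> = []}"
| "labels Type_B n = {(\<alpha>, \<beta>). \<exists>k\<le>n. \<alpha> \<in> partitions k \<and> \<beta> \<in> partitions (n - k)}"
| "labels Type_D n =
     {(\<alpha>, \<beta>). \<exists>k\<le>n. \<alpha> \<in> partitions k \<and> \<beta> \<in> partitions (n - k) \<and> n - k \<le> k}"

text \<open>
  \<open>occurs Z n d (\<alpha>, \<beta>) m\<close>: the irreducible module with label \<open>(\<alpha>, \<beta>)\<close> has multiplicity
  \<open>m\<close> in the forms of degree \<open>d\<close> in \<open>n\<close> variables. In type D with \<open>\<alpha> = \<beta>\<close> the restricted module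
  splits into two non-isomorphic irreducible modules, hence these are its only irreducible
  submodules, and \<open>m\<close> is required to be the multiplicity of each of them.
\<close>

fun occurs :: "family \<Rightarrow> nat \<Rightarrow> nat \<Rightarrow> nat list \<times> nat list \<Rightarrow> nat \<Rightarrow> bool" where
  "occurs Type_A n d (\<alpha>, \<beta>) m \<longleftrightarrow>
     has_multiplicity (family_group Type_A n) (forms n d) (specht_A \<alpha>) m"
| "occurs Type_B n d (\<alpha>, \<beta>) m \<longleftrightarrow>
     has_multiplicity (family_group Type_B n) (forms n d) (specht_B \<alpha> \<beta>) m"
| "occurs Type_D n d (\<alpha>, \<beta>) m \<longleftrightarrow>
     (if \<alpha> = \<beta>
      then \<forall>W. irreducible_submodule (family_group Type_D n) (specht_B \<alpha> \<beta>) W \<longrightarrow>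
        has_multiplicity (family_group Type_D n) (forms n d) (subrep (specht_B \<alpha> \<beta>) W) m
      else has_multiplicity (family_group Type_D n) (forms n d) (specht_B \<alpha> \<beta>) m)"

definition stable_at :: "family \<Rightarrow> nat \<Rightarrow> nat \<Rightarrow> bool" where
  "stable_at Z d n \<longleftrightarrow> (\<forall>(\<alpha>, \<beta>)\<in>labels Z n.
     \<exists>m. occurs Z n d (\<alpha>, \<beta>) m \<and> occurs Z (n + 1) d (add_to_first_part \<alpha>, \<beta>) m)"

end

theory Submission
  imports Defs
begin

text \<open>
  Let \<open>\<kappa>\<close> be the signed sum over the column stabilizer of a pair of tableaux of shape \<open>(\<lambda>, \<mu>)\<close> and
  \<open>\<rho>\<close> the sum over its row stabilizer, both twisted by the sign changes, which act by \<open>-1\<close> on the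
  letters of the second tableau. On the irreducible module with label \<open>(\<lambda>, \<mu>)\<close> the operator \<open>\<rho> \<kappa>\<close> has
  rank one, and it kills every other irreducible submodule of the forms; so the multiplicity is the rank of
  \<open>\<rho> \<kappa>\<close> on the forms. The sign changes project onto the monomials whose odd exponents are those of the
  letters of the second tableau (no condition in type A). Add a letter in a new column of the first tableau.
  Applying the larger \<open>\<rho>\<close> to the old image of \<open>\<rho> \<kappa>\<close> is injective, and it is onto the new image because
  a monomial that survives the new \<open>\<kappa>\<close> has exponent \<open>0\<close> at some letter alone in its column, by
  the bound on \<open>n\<close>, and this letter may be swapped with the new one. In type D the bound on \<open>n\<close> leaves only
  one of the two \<open>B\<^sub>n\<close>-labels of a module, or, for \<open>|\<lambda>| = |\<mu>|\<close>, none.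
\<close>

text \<open>Reading the multiplicity as a rank requires no list of the other irreducible modules and
  no endomorphism rings over the reals. That \<rho> \<kappa> kills the other summands rests on
  positivity: for the inner product with orthonormal monomials \<kappa> and \<rho> are self-adjoint
  and idempotent up to positive factors, so \<rho> \<kappa> w \<noteq> 0 forces \<kappa> \<rho>
  \<kappa> w \<noteq> 0, and the latter is, up to a scalar, the image of a polytabloid under a
  homomorphism. The bounds come from the k + 1 letters of the enlarged first tableau. Without a
  suitable letter of exponent 0, at least half of them have nonzero exponent. In type A, where k =
  n, this needs degree at least (n + 1) / 2. In type B these exponents are even and the remaining n
  - k are odd, which needs degree at least (k + 1) + (n - k) = n + 1. The obstacle in type D is that
  a set of odd exponents and its complement give the same character of the even sign changes. For n
  > 2d the larger block has more than d letters, so the complementary pattern has too large a degree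
  to occur.\<close>

section \<open>Representations of finite groups\<close>

text \<open>\<open>\<Gamma>\<close> supplies the multiplication and \<open>G\<close> the elements
  that act, so restriction to a subgroup leaves \<open>R\<close> unchanged. The action laws are
  asked on \<open>rep_space R\<close> only: the induced action discards values outside the carrier,
  so its unit acts as the identity on the module but not on the ambient space.\<close>

definition group_rep :: "('g, 'm) monoid_scheme \<Rightarrow> 'g set \<Rightarrow> ('g, 'v::real_vector) rep \<Rightarrow> bool" where
  "group_rep \<Gamma> G R \<longleftrightarrow> subspace (rep_space R) \<and> (\<forall>g\<in>G. linear (rep_act R g)) \<and>
     (\<forall>g\<in>G. \<forall>v\<in>rep_space R. rep_act R g v \<in> rep_space R) \<and>
     (\<forall>v\<in>rep_space R. rep_act R \<one>\<^bsub>\<Gamma>\<^esub> v = v) \<and>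
     (\<forall>g\<in>G. \<forall>h\<in>G. \<forall>v\<in>rep_space R. rep_act R (g \<otimes>\<^bsub>\<Gamma>\<^esub> h) v = rep_act R g (rep_act R h v))"

definition equivariant ::
    "'g set \<Rightarrow> ('g, 'v::real_vector) rep \<Rightarrow> ('g, 'w::real_vector) rep \<Rightarrow> ('v \<Rightarrow> 'w) \<Rightarrow> bool" where
  "equivariant G R S f \<longleftrightarrow> linear f \<and> f ` rep_space R \<subseteq> rep_space S \<and>
     (\<forall>g\<in>G. \<forall>v\<in>rep_space R. f (rep_act R g v) = rep_act S g (f v))"

text \<open>The action of the group algebra element with coefficients \<open>c\<close>. If
  \<open>c\<close> is a sign character of the subgroup \<open>A\<close>, it is \<open>card A\<close>
  times the projection onto the vectors on which \<open>A\<close> acts through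
  \<open>c\<close>.\<close>

definition gsum :: "('g, 'v::real_vector) rep \<Rightarrow> 'g set \<Rightarrow> ('g \<Rightarrow> real) \<Rightarrow> 'v \<Rightarrow> 'v" where
  "gsum R A c v = (\<Sum>g\<in>A. c g *\<^sub>R rep_act R g v)"

lemma subrep_simps [simp]:
  "rep_space (subrep R W) = W" "rep_act (subrep R W) = rep_act R"
  by (simp_all add: subrep_def)

lemma subrep_rep_space: "subrep R (rep_space R) = R"
  by (simp add: subrep_def)

lemma gsum_subrep [simp]: "gsum (subrep R W) A c = gsum R A c"
  by (simp add: gsum_def fun_eq_iff)

lemma submodule_subspace: "submodule G R W \<Longrightarrow> subspace W"
  by (simp add: submodule_def)

lemma linear_gsum:
  assumes "\<And>g. g \<in> A \<Longrightarrow> linear (rep_act R g)"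
  shows "linear (gsum R A c)"
  unfolding gsum_def
  by (intro linear_compose_sum ballI linear_compose_scale_right assms)

lemma gsum_in_submodule:
  assumes "submodule G R W" "A \<subseteq> G" "w \<in> W"
  shows "gsum R A c w \<in> W"
  using assms unfolding gsum_def submodule_def
  by (auto intro!: subspace_sum subspace_scale)

lemma gsum_equivariant:
  assumes "equivariant G R S f" "A \<subseteq> G" "v \<in> rep_space R"
  shows "f (gsum R A c v) = gsum S A c (f v)"
proof -
  have lin: "linear f" using assms(1) by (simp add: equivariant_def)
  have "f (gsum R A c v) = (\<Sum>g\<in>A. c g *\<^sub>R f (rep_act R g v))"
    unfolding gsum_def by (simp add: linear_sum[OF lin] linear_cmul[OF lin])
  also have "\<dots> = gsum S A c (f v)"
    unfolding gsum_def using assms by (intro sum.cong) (auto simp: equivariant_def)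
  finally show ?thesis .
qed

text \<open>An isomorphism is a linear map of ambient spaces that is bijective only between the
  modules, so its inverse is taken to be a linear left inverse on \<open>rep_space R\<close>.
  Closure under the action lets the intertwining relation be inverted.\<close>

lemma isomorphic_reps_sym:
  assumes "subspace (rep_space R)" "\<forall>g\<in>G. \<forall>v\<in>rep_space R. rep_act R g v \<in> rep_space R"
    and "isomorphic_reps G R S"
  shows "isomorphic_reps G S R"
proof -
  obtain f where f: "linear f" "bij_betw f (rep_space R) (rep_space S)"
    "\<forall>g\<in>G. \<forall>v\<in>rep_space R. f (rep_act R g v) = rep_act S g (f v)"
    using assms(3) unfolding isomorphic_reps_def by blast
  obtain g where g: "linear g" "\<forall>v\<in>rep_space R. g (f v) = v"
    using linear_exists_left_inverse_on[OF f(1) assms(1)] f(2) unfolding bij_betw_def by blast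
  have img: "f ` rep_space R = rep_space S" using f(2) by (simp add: bij_betw_def)
  have "bij_betw g (rep_space S) (rep_space R)"
    by (rule bij_betw_byWitness[where f' = f]) (use g(2) img in force)+
  moreover have "g (rep_act S a w) = rep_act R a (g w)" if aw: "a \<in> G" "w \<in> rep_space S" for a w
  proof -
    obtain v where v: "v \<in> rep_space R" "w = f v" using aw(2) img by blast
    have "rep_act S a w = f (rep_act R a v)" using f(3) v aw(1) by simp
    then show ?thesis using assms(2) g(2) v aw by simp
  qed
  ultimately show ?thesis unfolding isomorphic_reps_def using g(1) by blast
qed

lemma isomorphic_reps_trans:
  assumes "isomorphic_reps G R S" "isomorphic_reps G S T"
  shows "isomorphic_reps G R T"
proof -
  obtain f where f: "linear f" "bij_betw f (rep_space R) (rep_space S)"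
    "\<forall>g\<in>G. \<forall>v\<in>rep_space R. f (rep_act R g v) = rep_act S g (f v)"
    using assms(1) unfolding isomorphic_reps_def by blast
  obtain h where h: "linear h" "bij_betw h (rep_space S) (rep_space T)"
    "\<forall>g\<in>G. \<forall>v\<in>rep_space S. h (rep_act S g v) = rep_act T g (h v)"
    using assms(2) unfolding isomorphic_reps_def by blast
  have "\<forall>v\<in>rep_space R. f v \<in> rep_space S" using f(2) by (auto simp: bij_betw_def)
  then show ?thesis unfolding isomorphic_reps_def
    using f(3) h(3) linear_compose[OF f(1) h(1)] bij_betw_trans[OF f(2) h(2)]
    by (intro exI[of _ "h \<circ> f"]) simp
qed

lemma has_multiplicity_cong:
  assumes "subspace (rep_space S)" "\<forall>g\<in>G. \<forall>v\<in>rep_space S. rep_act S g v \<in> rep_space S"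
    and "isomorphic_reps G S T" and "has_multiplicity G R T m"
  shows "has_multiplicity G R S m"
proof -
  have "isomorphic_reps G (subrep R W) S \<longleftrightarrow> isomorphic_reps G (subrep R W) T" for W
    using isomorphic_reps_trans[of G "subrep R W" S T] isomorphic_reps_trans[of G "subrep R W" T S]
      isomorphic_reps_sym[OF assms(1,2,3)] assms(3) by blast
  then show ?thesis using assms(4) by (simp add: has_multiplicity_def)
qed

text \<open>\<open>dim\<close> is the cardinality of a basis, hence 0 for an infinite-dimensional
  space, so strict monotonicity needs the finite spanning set \<open>B\<close>. It drives the
  descent by which modules are decomposed.\<close>

lemma dim_less_of_psubset:
  fixes V V' :: "'v::real_vector set"
  assumes "subspace V" "V \<subset> V'" "finite B" "V' \<subseteq> span B"
  shows "dim V < dim V'"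
proof -
  obtain b where b: "b \<subseteq> V" "independent b" "V \<subseteq> span b"
    using maximal_independent_subset by metis
  have "b \<subseteq> V'" using b(1) assms(2) by blast
  then obtain b' where b': "b \<subseteq> b'" "b' \<subseteq> V'" "independent b'" "V' \<subseteq> span b'"
    using maximal_independent_subset_extend[OF _ b(2)] by metis
  have fin: "finite b'"
    using independent_span_bound[OF assms(3) b'(3)] b'(2) assms(4) by blast
  have "b \<noteq> b'"
    using assms(1,2) b b' span_minimal[of b V] by auto
  then have "card b < card b'" using b'(1) fin by (simp add: psubset_card_mono psubset_eq)
  moreover have "dim V = card b" using b by (metis basis_card_eq_dim)
  moreover have "dim V' = card b'" using b' by (metis basis_card_eq_dim)
  ultimately show ?thesis by simp
qed

lemma dim_image_inj:
  fixes f :: "'v::real_vector \<Rightarrow> 'w::real_vector"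
  assumes "linear f" "subspace V" "inj_on f V"
  shows "dim (f ` V) = dim V"
proof -
  obtain b where b: "b \<subseteq> V" "independent b" "V \<subseteq> span b"
    using maximal_independent_subset by metis
  have V: "V = span b" using b assms(2) span_minimal by blast
  have "independent (f ` b)"
    using linear_independent_injective_image[OF assms(1) b(2)] assms(3) V by simp
  moreover have "f ` V = span (f ` b)" unfolding V by (rule linear_span_image[OF assms(1), symmetric])
  moreover have "card (f ` b) = card b" using assms(3) b(1) by (meson card_image inj_on_subset)
  ultimately show ?thesis using b V by (metis dim_span_eq_card_independent)
qed

section \<open>Averaging over a finite group: complements, decompositions, Schur's lemma,
  ranks\<close>

locale finite_subgroup = group \<Gamma> + subgroup G \<Gamma> for \<Gamma> (structure) and G +
  assumes finite_G: "finite G"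
begin

lemma bij_mult_left: "h \<in> G \<Longrightarrow> bij_betw (\<lambda>g. h \<otimes> g) G G"
  by (rule bij_betw_byWitness[where f' = "\<lambda>g. inv h \<otimes> g"])
    (auto simp: m_assoc[symmetric])

lemma bij_mult_right: "h \<in> G \<Longrightarrow> bij_betw (\<lambda>g. g \<otimes> h) G G"
  by (rule bij_betw_byWitness[where f' = "\<lambda>g. g \<otimes> inv h"])
    (auto simp: m_assoc)

lemma bij_inv: "bij_betw (\<lambda>g. inv g) G G"
  by (rule bij_betw_byWitness[where f' = "\<lambda>g. inv g"]) auto

lemma sum_mult_left: "h \<in> G \<Longrightarrow> (\<Sum>g\<in>G. f (h \<otimes> g)) = (\<Sum>g\<in>G. f g)"
  by (rule sum.reindex_bij_betw[OF bij_mult_left])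

lemma sum_mult_right: "h \<in> G \<Longrightarrow> (\<Sum>g\<in>G. f (g \<otimes> h)) = (\<Sum>g\<in>G. f g)"
  by (rule sum.reindex_bij_betw[OF bij_mult_right])

lemma sum_inv: "(\<Sum>g\<in>G. f (inv g)) = (\<Sum>g\<in>G. f g)"
  by (rule sum.reindex_bij_betw[OF bij_inv])

lemma group_rep_subrep:
  assumes "group_rep \<Gamma> G R" "submodule G R W"
  shows "group_rep \<Gamma> G (subrep R W)"
  using assms unfolding group_rep_def submodule_def by auto

text \<open>Maschke's theorem: averaging the conjugates of a linear projection onto \<open>U\<close>
  gives an equivariant projection, and its kernel is the complement.\<close>

lemma submodule_complement:
  assumes R: "group_rep \<Gamma> G R" and U: "submodule G R U"
  obtains U' where "submodule G R U'" "U \<inter> U' = {0}" "\<And>v. v \<in> rep_space R \<Longrightarrow> \<exists>u\<in>U. \<exists>u'\<in>U'. v = u + u'"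
proof -
  have sU: "subspace U" and UR: "U \<subseteq> rep_space R" and Uinv: "\<And>g u. g \<in> G \<Longrightarrow> u \<in> U \<Longrightarrow> rep_act R g u \<in> U"
    using U unfolding submodule_def by auto
  have sR: "subspace (rep_space R)" and lin: "\<And>g. g \<in> G \<Longrightarrow> linear (rep_act R g)"
    and clR: "\<And>g v. g \<in> G \<Longrightarrow> v \<in> rep_space R \<Longrightarrow> rep_act R g v \<in> rep_space R"
    and oneR: "\<And>v. v \<in> rep_space R \<Longrightarrow> rep_act R \<one> v = v"
    and mulR: "\<And>g h v. g \<in> G \<Longrightarrow> h \<in> G \<Longrightarrow> v \<in> rep_space R \<Longrightarrow> rep_act R (g \<otimes> h) v = rep_act R g (rep_act R h v)"
    using R unfolding group_rep_def by auto
  \<comment> \<open>A left inverse of the identity on \<open>U\<close> is a linear projection onto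
    \<open>U\<close>.\<close>
  obtain p where p: "linear p" "range p \<subseteq> U" "\<forall>u\<in>U. p u = u"
    using linear_exists_left_inverse_on[OF linear_id sU] by auto
  define q where "q v = (\<Sum>g\<in>G. (1 / card G) *\<^sub>R rep_act R g (p (rep_act R (inv g) v)))" for v
  have "linear (\<lambda>v. rep_act R g (p (rep_act R (inv g) v)))" if g: "g \<in> G" for g
    using linear_compose[OF linear_compose[OF lin[OF m_inv_closed[OF g]] p(1)] lin[OF g]] by (simp add: o_def)
  then have lq: "linear q" unfolding q_def
    by (intro linear_compose_sum ballI linear_compose_scale_right) auto
  have qU: "q v \<in> U" for v
    unfolding q_def using p(2) by (intro subspace_sum[OF sU] subspace_scale[OF sU] Uinv) auto
  have cG: "card G > 0" using finite_G subgroup_axioms subgroup.one_closed card_gt_0_iff by fastforce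
  have qid: "q u = u" if u: "u \<in> U" for u
  proof -
    have "rep_act R g (p (rep_act R (inv g) u)) = u" if g: "g \<in> G" for g
    proof -
      have "p (rep_act R (inv g) u) = rep_act R (inv g) u" using p(3) Uinv[OF m_inv_closed[OF g] u] by blast
      then have "rep_act R g (p (rep_act R (inv g) u)) = rep_act R (g \<otimes> inv g) u"
        using mulR[OF g m_inv_closed[OF g]] u UR by auto
      then show ?thesis using oneR u UR g by (auto simp: mem_carrier)
    qed
    then have "q u = (\<Sum>g\<in>G. (1 / card G) *\<^sub>R u)" unfolding q_def by (intro sum.cong) auto
    then show ?thesis using cG by (simp add: sum_constant_scaleR)
  qed
  have qeq: "q (rep_act R h v) = rep_act R h (q v)" if h: "h \<in> G" and v: "v \<in> rep_space R" for h v
  proof -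
    have "rep_act R h (q v) = (\<Sum>g\<in>G. (1 / card G) *\<^sub>R rep_act R h (rep_act R g (p (rep_act R (inv g) v))))"
      unfolding q_def by (simp add: linear_sum[OF lin[OF h]] linear_cmul[OF lin[OF h]])
    also have "\<dots> = (\<Sum>g\<in>G. (1 / card G) *\<^sub>R rep_act R (h \<otimes> g) (p (rep_act R (inv (h \<otimes> g)) (rep_act R h v))))"
    proof (intro sum.cong refl)
      fix g assume g: "g \<in> G"
      have "inv (h \<otimes> g) \<otimes> h = inv g"
        using g h by (simp add: inv_mult_group mem_carrier m_assoc)
      then have "rep_act R (inv (h \<otimes> g)) (rep_act R h v) = rep_act R (inv g) v"
        using mulR[OF m_inv_closed[OF m_closed[OF h g]] h v] by simp
      moreover have "p x \<in> rep_space R" for x using p(2) UR by auto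
      ultimately show "(1 / card G) *\<^sub>R rep_act R h (rep_act R g (p (rep_act R (inv g) v))) =
        (1 / card G) *\<^sub>R rep_act R (h \<otimes> g) (p (rep_act R (inv (h \<otimes> g)) (rep_act R h v)))"
        using mulR[OF h g] by simp
    qed
    also have "\<dots> = q (rep_act R h v)" unfolding q_def
      by (rule sum_mult_left[OF h, of "\<lambda>g. (1 / card G) *\<^sub>R rep_act R g (p (rep_act R (inv g) (rep_act R h v)))"])
    finally show ?thesis by simp
  qed
  define U' where "U' = {v \<in> rep_space R. q v = 0}"
  have "submodule G R U'"
    unfolding submodule_def
  proof (intro conjI ballI)
    show "subspace U'" unfolding U'_def subspace_def
      using sR lq by (auto simp: subspace_0 subspace_add subspace_scale linear_0 linear_add linear_cmul)
    show "rep_act R g w \<in> U'" if "g \<in> G" "w \<in> U'" for g w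
      using that qeq clR linear_0[OF lin] by (auto simp: U'_def)
  qed (auto simp: U'_def)
  moreover have "U \<inter> U' = {0}"
    using qid sU linear_0[OF lq] sR by (auto simp: U'_def subspace_0)
  moreover have "\<exists>u\<in>U. \<exists>u'\<in>U'. v = u + u'" if v: "v \<in> rep_space R" for v
  proof (intro bexI)
    show "v = q v + (v - q v)" by simp
    show "v - q v \<in> U'" using v qU UR sR qid linear_diff[OF lq] by (auto simp: U'_def intro!: subspace_diff)
  qed (rule qU)
  ultimately show ?thesis using that by blast
qed

lemma submodule_subrep_iff:
  assumes "submodule G R V"
  shows "submodule G (subrep R V) W \<longleftrightarrow> submodule G R W \<and> W \<subseteq> V"
  using assms unfolding submodule_def by auto

lemma irreducible_submodule_subrep:
  assumes "submodule G R V" "irreducible_submodule G (subrep R V) W"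
  shows "irreducible_submodule G R W"
  using assms submodule_subrep_iff unfolding irreducible_submodule_def
  by (auto simp: irreducible_rep_def submodule_def)

lemma irreducible_decomposition_insert:
  assumes R: "group_rep \<Gamma> G R" and W: "irreducible_submodule G R W" and U: "submodule G R U"
    and WU: "W \<inter> U = {0}" and sum: "\<And>v. v \<in> rep_space R \<Longrightarrow> \<exists>w\<in>W. \<exists>u\<in>U. v = w + u"
    and \<W>: "irreducible_decomposition G (subrep R U) \<W>"
  shows "irreducible_decomposition G R (insert W \<W>)"
proof -
  have fin: "finite \<W>" using \<W> by (simp add: irreducible_decomposition_def)
  have sW: "subspace W" using W by (simp add: irreducible_submodule_def submodule_def)
  have sU: "subspace U" using U by (simp add: submodule_def)
  have sub: "X \<subseteq> U" "irreducible_submodule G R X" if "X \<in> \<W>" for X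
    using \<W> that irreducible_submodule_subrep[OF U]
    by (auto simp: irreducible_decomposition_def irreducible_submodule_def submodule_def)
  \<comment> \<open>Summands are collected in a set, so \<open>W\<close> must not already be one of
    them; otherwise it would lie in \<open>U\<close> and be zero.\<close>
  have "W \<noteq> {0}" using W by (simp add: irreducible_submodule_def irreducible_rep_def)
  then have WW: "W \<notin> \<W>" using sub(1) WU by blast
  have ex: "\<exists>!f. (\<forall>X\<in>\<W>. f X \<in> X) \<and> (\<forall>X. X \<notin> \<W> \<longrightarrow> f X = 0) \<and> v = (\<Sum>X\<in>\<W>. f X)" if "v \<in> U" for v
    using \<W> that by (simp add: irreducible_decomposition_def)
  have sumU: "(\<Sum>X\<in>\<W>. f X) \<in> U" if "\<forall>X\<in>\<W>. f X \<in> X" for f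
    using that sub(1) by (intro subspace_sum[OF sU]) blast
  show ?thesis unfolding irreducible_decomposition_def
  proof (intro conjI ballI)
    show "finite (insert W \<W>)" using fin by simp
    show "irreducible_submodule G R X" if "X \<in> insert W \<W>" for X using that W sub by auto
  next
    fix v assume "v \<in> rep_space R"
    then obtain w u where v: "v = w + u" "w \<in> W" "u \<in> U" using sum by blast
    from ex[OF v(3)] obtain f where f: "\<forall>X\<in>\<W>. f X \<in> X" "\<forall>X. X \<notin> \<W> \<longrightarrow> f X = 0" "u = (\<Sum>X\<in>\<W>. f X)"
      and uniq: "\<And>g. (\<forall>X\<in>\<W>. g X \<in> X) \<Longrightarrow> (\<forall>X. X \<notin> \<W> \<longrightarrow> g X = 0) \<Longrightarrow> u = (\<Sum>X\<in>\<W>. g X) \<Longrightarrow> g = f"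
      by (elim ex1E) blast
    show "\<exists>!f. (\<forall>X\<in>insert W \<W>. f X \<in> X) \<and> (\<forall>X. X \<notin> insert W \<W> \<longrightarrow> f X = 0) \<and> v = (\<Sum>X\<in>insert W \<W>. f X)"
    proof (rule ex1I[of _ "f(W := w)"])
      have "(\<Sum>X\<in>\<W>. (f(W := w)) X) = (\<Sum>X\<in>\<W>. f X)" using WW by (intro sum.cong) auto
      then show "(\<forall>X\<in>insert W \<W>. (f(W := w)) X \<in> X) \<and> (\<forall>X. X \<notin> insert W \<W> \<longrightarrow> (f(W := w)) X = 0) \<and>
        v = (\<Sum>X\<in>insert W \<W>. (f(W := w)) X)"
        using f v WW fin by (auto simp: sum.insert)
    next
      fix g assume g: "(\<forall>X\<in>insert W \<W>. g X \<in> X) \<and> (\<forall>X. X \<notin> insert W \<W> \<longrightarrow> g X = 0) \<and> v = (\<Sum>X\<in>insert W \<W>. g X)"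
      define s where "s = (\<Sum>X\<in>\<W>. g X)"
      have s: "s \<in> U" unfolding s_def using g by (intro sumU) simp
      have "w + u = g W + s" using g v(1) WW fin by (simp add: s_def)
      then have "w - g W = s - u" by (simp add: algebra_simps)
      moreover have "w - g W \<in> W" using v(2) g by (intro subspace_diff[OF sW]) auto
      moreover have "s - u \<in> U" using v(3) s by (intro subspace_diff[OF sU]) auto
      ultimately have "w - g W = 0 \<and> s - u = 0" using WU by (metis IntI singletonD)
      then have gw: "g W = w" and su: "s = u" by auto
      have "(\<Sum>X\<in>\<W>. (g(W := 0)) X) = s" unfolding s_def using WW by (intro sum.cong) auto
      then have "g(W := 0) = f" using g su WW by (intro uniq) auto
      then have "f X = (if X = W then 0 else g X)" for X by (auto simp: fun_eq_iff)
      then show "g = f(W := w)" using gw by (auto simp: fun_eq_iff)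
    qed
  qed
qed

text \<open>A nonzero submodule of least dimension inside \<open>V\<close> is irreducible; the
  finite set \<open>B\<close> makes the comparison of dimensions meaningful.\<close>

lemma ex_irreducible_submodule:
  assumes "subspace (rep_space R)" "submodule G R V" "V \<noteq> {0}" "finite B" "V \<subseteq> span B"
  shows "\<exists>W \<subseteq> V. irreducible_submodule G R W"
proof -
  define W where "W = arg_min dim (\<lambda>W. submodule G R W \<and> W \<subseteq> V \<and> W \<noteq> {0})"
  have W: "submodule G R W" "W \<subseteq> V" "W \<noteq> {0}"
    and min: "\<And>X. submodule G R X \<Longrightarrow> X \<subseteq> V \<Longrightarrow> X \<noteq> {0} \<Longrightarrow> dim W \<le> dim X"
    using arg_min_nat_lemma[of "\<lambda>W. submodule G R W \<and> W \<subseteq> V \<and> W \<noteq> {0}" V dim] assms(2,3)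
    unfolding W_def by auto
  have "X = {0} \<or> X = W" if "submodule G (subrep R W) X" for X
  proof (rule ccontr)
    assume c: "\<not> (X = {0} \<or> X = W)"
    have X: "submodule G R X" "X \<subset> W" using that c submodule_subrep_iff[OF W(1)] by auto
    have "dim X < dim W"
      using X W assms(5) by (intro dim_less_of_psubset[OF _ X(2) assms(4)]) (auto simp: submodule_def)
    then show False using min[of X] X W(2) c by auto
  qed
  then show ?thesis using W by (auto simp: irreducible_submodule_def irreducible_rep_def)
qed

lemma ex_irreducible_decomposition:
  assumes "group_rep \<Gamma> G R" "finite B" "rep_space R \<subseteq> span B"
  shows "\<exists>\<W>. irreducible_decomposition G R \<W>"
  using assms(1,3)
proof (induction "dim (rep_space R)" arbitrary: R rule: less_induct)
  case less
  have sR: "subspace (rep_space R)" using less.prems by (simp add: group_rep_def)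
  have whole: "submodule G R (rep_space R)" using less.prems by (auto simp: group_rep_def submodule_def)
  show ?case
  proof (cases "rep_space R = {0}")
    case True
    then show ?thesis by (intro exI[of _ "{}"]) (auto simp: irreducible_decomposition_def fun_eq_iff)
  next
    case False
    obtain W where W: "irreducible_submodule G R W"
      using ex_irreducible_submodule[OF sR whole False assms(2) less.prems(2)] by blast
    obtain U where U: "submodule G R U" "W \<inter> U = {0}" "\<And>v. v \<in> rep_space R \<Longrightarrow> \<exists>w\<in>W. \<exists>u\<in>U. v = w + u"
      using submodule_complement[OF less.prems(1)] W unfolding irreducible_submodule_def by blast
    have "W \<noteq> {0}" "W \<subseteq> rep_space R" "U \<subseteq> rep_space R" "0 \<in> W"
      using W U(1) by (auto simp: irreducible_submodule_def irreducible_rep_def submodule_def subspace_0)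
    then have "U \<subset> rep_space R" using U(2) by blast
    then have "dim U < dim (rep_space R)"
      using U(1) less.prems(2) by (intro dim_less_of_psubset[OF _ _ assms(2)]) (auto simp: submodule_def)
    then obtain \<W> where "irreducible_decomposition G (subrep R U) \<W>"
      using less.hyps[of "subrep R U"] group_rep_subrep[OF less.prems(1) U(1)] less.prems(2) \<open>U \<subset> _\<close> by auto
    then show ?thesis using irreducible_decomposition_insert[OF less.prems(1) W U] by blast
  qed
qed

text \<open>Schur's lemma: kernel and image of \<open>f\<close> are submodules, and
  \<open>v0\<close> excludes the degenerate alternative for both.\<close>

lemma schur_isomorphic:
  assumes S: "irreducible_rep G S" "subspace (rep_space S)"
      "\<forall>g\<in>G. \<forall>v\<in>rep_space S. rep_act S g v \<in> rep_space S"
    and W: "irreducible_rep G W" and lin: "\<forall>g\<in>G. linear (rep_act W g)"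
    and f: "equivariant G S W f" and nz: "v0 \<in> rep_space S" "f v0 \<noteq> 0"
  shows "isomorphic_reps G S W"
proof -
  have lf: "linear f" and fW: "f ` rep_space S \<subseteq> rep_space W"
    and eq: "\<And>g v. g \<in> G \<Longrightarrow> v \<in> rep_space S \<Longrightarrow> f (rep_act S g v) = rep_act W g (f v)"
    using f by (auto simp: equivariant_def)
  have "submodule G S {v \<in> rep_space S. f v = 0}"
    unfolding submodule_def subspace_def using S(2,3) lf eq lin
    by (auto simp: linear_0 subspace_0 subspace_add subspace_scale linear_0 linear_add linear_cmul)
  then have ker: "{v \<in> rep_space S. f v = 0} = {0}"
    using S(1) nz unfolding irreducible_rep_def by blast
  have "submodule G W (f ` rep_space S)"
    unfolding submodule_def using fW eq S(3) linear_subspace_image[OF lf S(2)] by (auto simp flip: eq)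
  then have img: "f ` rep_space S = rep_space W"
    using W nz unfolding irreducible_rep_def by blast
  have "inj_on f (rep_space S)"
  proof (rule inj_onI)
    fix x y assume "x \<in> rep_space S" "y \<in> rep_space S" "f x = f y"
    then have "x - y \<in> {v \<in> rep_space S. f v = 0}"
      using S(2) linear_diff[OF lf] by (simp add: subspace_diff)
    then show "x = y" using ker by simp
  qed
  then show ?thesis unfolding isomorphic_reps_def using lf img eq by (auto simp: bij_betw_def)
qed

lemma card_isomorphic_summands:
  assumes \<W>: "irreducible_decomposition G R \<W>" and lE: "linear E"
    and EW: "\<And>W w. submodule G R W \<Longrightarrow> w \<in> W \<Longrightarrow> E w \<in> W"
    and one: "\<And>W. irreducible_submodule G R W \<Longrightarrow> isomorphic_reps G (subrep R W) S \<Longrightarrow> \<exists>b\<noteq>0. E ` W = span {b}"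
    and zero: "\<And>W. irreducible_submodule G R W \<Longrightarrow> \<not> isomorphic_reps G (subrep R W) S \<Longrightarrow> E ` W = {0}"
    and sR: "subspace (rep_space R)"
  shows "card {W \<in> \<W>. isomorphic_reps G (subrep R W) S} = dim (E ` rep_space R)"
proof -
  define I where "I = {W \<in> \<W>. isomorphic_reps G (subrep R W) S}"
  have fin: "finite \<W>" and finI: "finite I" and irr: "\<And>W. W \<in> \<W> \<Longrightarrow> irreducible_submodule G R W"
    using \<W> by (auto simp: irreducible_decomposition_def I_def)
  have sub: "submodule G R W" if "W \<in> \<W>" for W using irr[OF that] by (simp add: irreducible_submodule_def)
  have ex: "\<exists>!f. (\<forall>W\<in>\<W>. f W \<in> W) \<and> (\<forall>W. W \<notin> \<W> \<longrightarrow> f W = 0) \<and> v = (\<Sum>W\<in>\<W>. f W)" if "v \<in> rep_space R" for v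
    using \<W> that by (simp add: irreducible_decomposition_def)
  have "\<forall>W\<in>I. \<exists>b. b \<noteq> 0 \<and> E ` W = span {b}" using one irr by (auto simp: I_def)
  then obtain b where b: "\<And>W. W \<in> I \<Longrightarrow> b W \<noteq> 0" "\<And>W. W \<in> I \<Longrightarrow> E ` W = span {b W}" by metis
  have bW: "b W \<in> W" "b W \<in> E ` W" if "W \<in> I" for W
  proof -
    show "b W \<in> E ` W" using b(2)[OF that] by (simp add: span_base)
    then show "b W \<in> W" using EW[OF sub] that by (auto simp: I_def)
  qed
  have zero_coeff: "c W = 0" if "(\<Sum>W\<in>I. c W *\<^sub>R b W) = 0" "W \<in> I" for c W
  proof -
    \<comment> \<open>Extended by 0, the terms of a vanishing combination form a decomposition of 0;
      by uniqueness it is the zero family.\<close>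
    define f where "f W = (if W \<in> I then c W *\<^sub>R b W else 0)" for W
    have "(\<Sum>W\<in>\<W>. f W) = (\<Sum>W\<in>I. c W *\<^sub>R b W)"
      unfolding f_def by (rule sum.mono_neutral_cong_right[OF fin]) (auto simp: I_def)
    then have "(\<Sum>W\<in>\<W>. f W) = 0" using that by simp
    moreover have "\<forall>W\<in>\<W>. f W \<in> W"
      using bW sub by (auto simp: f_def submodule_def subspace_scale subspace_0)
    moreover have "\<forall>W. W \<notin> \<W> \<longrightarrow> f W = 0" by (auto simp: f_def I_def)
    moreover have "\<forall>W\<in>\<W>. (0::'c) \<in> W" using sub by (auto simp: submodule_def subspace_0)
    ultimately have "f = (\<lambda>_. 0)" using ex[OF subspace_0[OF sR]]
      by (elim ex1E) (metis (mono_tags, lifting) sum.neutral_const)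
    then have "f W = 0" by simp
    then have "c W *\<^sub>R b W = 0" using that(2) by (simp add: f_def)
    then show ?thesis using b(1)[OF that(2)] by simp
  qed
  have inj: "inj_on b I"
  proof (rule inj_onI)
    fix V W assume VW: "V \<in> I" "W \<in> I" "b V = b W"
    show "V = W"
    proof (rule ccontr)
      assume ne: "V \<noteq> W"
      define c where "c X = (if X = V then 1 else if X = W then -1 else (0::real))" for X
      have "(\<Sum>X\<in>I. c X *\<^sub>R b X) = (\<Sum>X\<in>{V, W}. c X *\<^sub>R b X)"
        using VW finI by (intro sum.mono_neutral_right) (auto simp: c_def)
      also have "\<dots> = 0" using ne VW(3) by (simp add: c_def)
      finally have "c V = 0" using zero_coeff VW(1) by blast
      then show False by (simp add: c_def)
    qed
  qed
  have "independent (b ` I)"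
  proof (rule independent_if_scalars_zero)
    fix f x assume f: "(\<Sum>x\<in>b ` I. f x *\<^sub>R x) = 0" and "x \<in> b ` I"
    then obtain W where W: "W \<in> I" "x = b W" by blast
    have "(\<Sum>W\<in>I. f (b W) *\<^sub>R b W) = 0" using f by (simp add: sum.reindex[OF inj])
    then show "f x = 0" using zero_coeff[of "\<lambda>W. f (b W)"] W by simp
  qed (use finI in simp)
  moreover have "E ` rep_space R \<subseteq> span (b ` I)"
  proof
    fix y assume "y \<in> E ` rep_space R"
    then obtain v where v: "v \<in> rep_space R" "y = E v" by blast
    obtain f where f: "\<forall>W\<in>\<W>. f W \<in> W" "v = (\<Sum>W\<in>\<W>. f W)" using ex[OF v(1)] by blast
    have "E (f W) \<in> span (b ` I)" if W: "W \<in> \<W>" for W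
    proof (cases "W \<in> I")
      case True
      then have "E (f W) \<in> span {b W}" using b(2) f(1) W by blast
      then show ?thesis using span_mono[of "{b W}" "b ` I"] True by blast
    next
      case False
      then have "E ` W = {0}" using zero irr W by (auto simp: I_def)
      then have "E (f W) = 0" using f(1) W by blast
      then show ?thesis by (simp add: span_0)
    qed
    then show "y \<in> span (b ` I)" using v(2) f(2) by (auto simp: linear_sum[OF lE] intro!: span_sum)
  qed
  moreover have "b ` I \<subseteq> E ` rep_space R"
    using bW sub by (force simp: I_def submodule_def)
  ultimately have "dim (E ` rep_space R) = card (b ` I)" by (metis basis_card_eq_dim)
  then show ?thesis using card_image[OF inj] by (simp add: I_def)
qed

text \<open>
  The role of \<open>e\<close> is that of a polytabloid. The James submodule theorem gives irreducibility of \<open>S\<close>,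
  and the last hypothesis realises \<open>S\<close> inside every irreducible summand not killed by \<open>\<rho> \<kappa>\<close>.
\<close>

lemma has_multiplicity_dim_symmetrizer:
  fixes R :: "('a, 'v::real_vector) rep" and S :: "('a, 'w::real_vector) rep"
  assumes R: "group_rep \<Gamma> G R" and S: "group_rep \<Gamma> G S"
    and B: "finite B" "rep_space R \<subseteq> span B"
    and CG: "C \<subseteq> G" and DG: "D \<subseteq> G"
    and e: "e \<in> rep_space S" "rep_space S \<subseteq> span {rep_act S g e | g. g \<in> G}"
    and line: "\<And>v. v \<in> rep_space S \<Longrightarrow> gsum S C c v \<in> span {e}"
    and quasi: "gsum S C c e = a *\<^sub>R e" "a \<noteq> 0"
    and rho: "gsum S D \<chi> e \<noteq> 0"
    and pos: "\<And>w. w \<in> rep_space R \<Longrightarrow> gsum R D \<chi> (gsum R C c w) \<noteq> 0 \<Longrightarrow>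
        gsum R C c (gsum R D \<chi> (gsum R C c w)) \<noteq> 0"
    and hom: "\<And>w. w \<in> rep_space R \<Longrightarrow>
        \<exists>f r. equivariant G S R f \<and> r \<noteq> 0 \<and> f e = r *\<^sub>R gsum R C c (gsum R D \<chi> w)"
  shows "has_multiplicity G R S (dim ((\<lambda>v. gsum R D \<chi> (gsum R C c v)) ` rep_space R))"
proof -
  define \<kappa> where "\<kappa> = gsum R C c"
  define \<rho> where "\<rho> = gsum R D \<chi>"
  have linR: "\<And>g. g \<in> G \<Longrightarrow> linear (rep_act R g)" and linS: "\<And>g. g \<in> G \<Longrightarrow> linear (rep_act S g)"
    and sR: "subspace (rep_space R)" and sS: "subspace (rep_space S)"
    and clS: "\<forall>g\<in>G. \<forall>v\<in>rep_space S. rep_act S g v \<in> rep_space S"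
    using R S by (auto simp: group_rep_def)
  have l: "linear \<kappa>" "linear \<rho>" unfolding \<kappa>_def \<rho>_def using linR CG DG by (auto intro!: linear_gsum)
  have lS: "linear (gsum S C c)" "linear (gsum S D \<chi>)" using linS CG DG by (auto intro!: linear_gsum)
  have e0: "e \<noteq> 0" using rho linear_0[OF lS(2)] by auto
  have gen: "U = rep_space S" if U: "submodule G S U" "e \<in> U" for U
  proof -
    have "{rep_act S g e | g. g \<in> G} \<subseteq> U" using U by (auto simp: submodule_def)
    then have "span {rep_act S g e | g. g \<in> G} \<subseteq> U" using U by (auto simp: submodule_def span_minimal)
    then show ?thesis using U e(2) by (auto simp: submodule_def)
  qed
  have irrS: "irreducible_rep G S"
    unfolding irreducible_rep_def
  proof (intro conjI allI impI)
    show "rep_space S \<noteq> {0}" using e0 e(1) by auto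
    fix U assume U: "submodule G S U"
    show "U = {0} \<or> U = rep_space S"
    \<comment> \<open>If the column sum does not vanish on \<open>U\<close>, it produces a multiple
      of \<open>e\<close> in \<open>U\<close>. If it does, only the component of \<open>e\<close> in
      a complement contributes to \<open>a *\<^sub>R e\<close>, so the complement contains
      \<open>e\<close> and is everything.\<close>
    proof (cases "\<exists>u\<in>U. gsum S C c u \<noteq> 0")
      case True
      then obtain u where u: "u \<in> U" "gsum S C c u \<noteq> 0" by blast
      have "u \<in> rep_space S" using U u by (auto simp: submodule_def)
      then obtain r where r: "gsum S C c u = r *\<^sub>R e" using line by (auto simp: span_singleton)
      then have "r \<noteq> 0" using u by auto
      then have "e = (1 / r) *\<^sub>R gsum S C c u" using r by simp
      moreover have "gsum S C c u \<in> U" using gsum_in_submodule[OF U CG u(1)] .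
      ultimately have "e \<in> U" using submodule_subspace[OF U] by (metis subspace_scale)
      then show ?thesis using gen[OF U] by simp
    next
      case False
      obtain U' where U': "submodule G S U'" "U \<inter> U' = {0}" "\<And>v. v \<in> rep_space S \<Longrightarrow> \<exists>u\<in>U. \<exists>u'\<in>U'. v = u + u'"
        using submodule_complement[OF S U] by blast
      obtain u u' where u: "u \<in> U" "u' \<in> U'" "e = u + u'" using U'(3)[OF e(1)] by blast
      have "a *\<^sub>R e = gsum S C c u'" using quasi(1) u False linear_add[OF lS(1)] by auto
      then have "e = (1 / a) *\<^sub>R gsum S C c u'" using quasi(2)
        by (metis divide_inverse_commute left_inverse mult.right_neutral scaleR_one scaleR_scaleR)
      then have "e \<in> U'" using gsum_in_submodule[OF U'(1) CG u(2)] submodule_subspace[OF U'(1)]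
        by (metis subspace_scale)
      then have "U' = rep_space S" using gen[OF U'(1)] by simp
      then show ?thesis using U'(2) U by (auto simp: submodule_def)
    qed
  qed
  have one: "\<exists>b\<noteq>0. (\<lambda>v. \<rho> (\<kappa> v)) ` W = span {b}"
    if W: "irreducible_submodule G R W" and iso: "isomorphic_reps G (subrep R W) S" for W
  proof -
    have sub: "submodule G R W" using W by (simp add: irreducible_submodule_def)
    have WR: "W \<subseteq> rep_space R" using sub by (simp add: submodule_def)
    have "isomorphic_reps G S (subrep R W)"
      using sub by (intro isomorphic_reps_sym[OF _ _ iso]) (auto simp: submodule_def)
    then obtain f where f: "linear f" "bij_betw f (rep_space S) W"
      "\<forall>g\<in>G. \<forall>v\<in>rep_space S. f (rep_act S g v) = rep_act R g (f v)"
      unfolding isomorphic_reps_def by auto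
    have img: "f ` rep_space S = W" and inj: "inj_on f (rep_space S)" using f(2) by (auto simp: bij_betw_def)
    have eqv: "equivariant G S R f" using f img WR by (auto simp: equivariant_def)
    have whole: "submodule G S (rep_space S)" using S by (auto simp: group_rep_def submodule_def)
    have in1: "gsum S C c v \<in> rep_space S" if "v \<in> rep_space S" for v
      using gsum_in_submodule[OF whole CG that] .
    have in2: "gsum S D \<chi> v \<in> rep_space S" if "v \<in> rep_space S" for v
      using gsum_in_submodule[OF whole DG that] .
    have comm: "\<rho> (\<kappa> (f v)) = f (gsum S D \<chi> (gsum S C c v))" if "v \<in> rep_space S" for v
      using gsum_equivariant[OF eqv CG that] gsum_equivariant[OF eqv DG in1[OF that]]
      by (simp add: \<kappa>_def \<rho>_def)
    \<comment> \<open>Transported to \<open>S\<close>, \<kappa> has values in the line of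
      \<open>e\<close>, which it reaches because \<open>a \<noteq> 0\<close>, and \<rho> does not
      kill \<open>e\<close>. So the image of \<open>W\<close> is the line of
      \<open>b\<close>.\<close>
    define b where "b = f (gsum S D \<chi> e)"
    have b: "b \<noteq> 0" unfolding b_def
      using inj_onD[OF inj _ in2[OF e(1)] subspace_0[OF sS]] rho linear_0[OF f(1)] by auto
    have "(\<lambda>v. \<rho> (\<kappa> v)) ` W = span {b}"
    proof (intro equalityI subsetI)
      fix y assume "y \<in> (\<lambda>v. \<rho> (\<kappa> v)) ` W"
      then obtain v where v: "v \<in> rep_space S" "y = \<rho> (\<kappa> (f v))" using img by blast
      then obtain r where "gsum S C c v = r *\<^sub>R e" using line by (auto simp: span_singleton)
      then have "y = r *\<^sub>R b" using v comm lS f(1) by (simp add: b_def linear_cmul)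
      then show "y \<in> span {b}" by (auto simp: span_singleton)
    next
      fix y assume "y \<in> span {b}"
      then obtain r where r: "y = r *\<^sub>R b" by (auto simp: span_singleton)
      have "\<rho> (\<kappa> (f ((r / a) *\<^sub>R e))) = f (gsum S D \<chi> (gsum S C c ((r / a) *\<^sub>R e)))"
        using comm subspace_scale[OF sS e(1)] by blast
      also have "\<dots> = y" using r quasi lS f(1) by (simp add: b_def linear_cmul)
      finally show "y \<in> (\<lambda>v. \<rho> (\<kappa> v)) ` W" using img subspace_scale[OF sS e(1)] by blast
    qed
    then show ?thesis using b by blast
  qed
  have zero: "(\<lambda>v. \<rho> (\<kappa> v)) ` W = {0}"
    if W: "irreducible_submodule G R W" and niso: "\<not> isomorphic_reps G (subrep R W) S" for W
  proof (rule ccontr)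
    assume nz: "(\<lambda>v. \<rho> (\<kappa> v)) ` W \<noteq> {0}"
    have sub: "submodule G R W" using W by (simp add: irreducible_submodule_def)
    then have WR: "W \<subseteq> rep_space R" and sW: "subspace W" by (auto simp: submodule_def)
    have "\<rho> (\<kappa> 0) = 0" using l by (simp add: linear_0)
    then have "\<exists>w\<in>W. \<rho> (\<kappa> w) \<noteq> 0" using nz subspace_0[OF sW] by (force simp: image_iff)
    then obtain w where w: "w \<in> W" "\<rho> (\<kappa> w) \<noteq> 0" by blast
    \<comment> \<open>By positivity \<kappa> \<rho> \<kappa> w is nonzero. Up to a scalar it is the
      value at \<open>e\<close> of an equivariant map out of \<open>S\<close>; as it lies in
      \<open>W\<close> and \<open>e\<close> generates \<open>S\<close>, the whole map goes into
      \<open>W\<close>, and Schur's lemma gives a forbidden isomorphism.\<close>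
    then have nz': "\<kappa> (\<rho> (\<kappa> w)) \<noteq> 0" using pos WR by (auto simp: \<kappa>_def \<rho>_def)
    have kW: "\<kappa> w \<in> W" unfolding \<kappa>_def using gsum_in_submodule[OF sub CG w(1)] .
    then obtain f r where f: "equivariant G S R f" "r \<noteq> 0" "f e = r *\<^sub>R \<kappa> (\<rho> (\<kappa> w))"
      using hom[of "\<kappa> w"] WR by (auto simp: \<kappa>_def \<rho>_def)
    have lf: "linear f" using f(1) by (simp add: equivariant_def)
    have "\<kappa> (\<rho> (\<kappa> w)) \<in> W" unfolding \<kappa>_def \<rho>_def
      using gsum_in_submodule[OF sub] CG DG w(1) by blast
    then have fe: "f e \<in> W" using f(3) sW by (simp add: subspace_scale)
    have "submodule G S {v \<in> rep_space S. f v \<in> W}"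
      unfolding submodule_def subspace_def using sS clS f(1) sub lf
      by (auto simp: subspace_0 subspace_add subspace_scale linear_0 linear_add linear_cmul
          equivariant_def submodule_def)
    then have "f ` rep_space S \<subseteq> W" using gen[of "{v \<in> rep_space S. f v \<in> W}"] fe e(1) by blast
    then have "equivariant G S (subrep R W) f" using f(1) by (simp add: equivariant_def)
    then have "isomorphic_reps G S (subrep R W)"
      using schur_isomorphic[OF irrS sS clS, of "subrep R W" f e] W linR e(1) f nz'
      by (auto simp: irreducible_submodule_def)
    then show False using isomorphic_reps_sym[OF sS clS] niso by blast
  qed
  show ?thesis unfolding has_multiplicity_def
  proof (intro conjI allI impI)
    show "\<exists>\<W>. irreducible_decomposition G R \<W>" using ex_irreducible_decomposition[OF R B] .
    fix \<W> assume "irreducible_decomposition G R \<W>"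
    then have "card {W \<in> \<W>. isomorphic_reps G (subrep R W) S} = dim ((\<lambda>v. \<rho> (\<kappa> v)) ` rep_space R)"
      using one zero sR linear_compose[OF l]
      by (intro card_isomorphic_summands)
        (simp_all add: \<kappa>_def \<rho>_def o_def gsum_in_submodule[OF _ CG] gsum_in_submodule[OF _ DG])
    then show "card {W \<in> \<W>. isomorphic_reps G (subrep R W) S} =
      dim ((\<lambda>v. gsum R D \<chi> (gsum R C c v)) ` rep_space R)" by (simp add: \<kappa>_def \<rho>_def)
  qed
qed

end

lemma (in finite_subgroup) group_rep_mono:
  assumes "group_rep \<Gamma> H R" "G \<subseteq> H"
  shows "group_rep \<Gamma> G R"
  using assms unfolding group_rep_def by blast

lemma group_repD:
  assumes "group_rep \<Gamma> G R"
  shows "subspace (rep_space R)"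
    and "g \<in> G \<Longrightarrow> linear (rep_act R g)"
    and "g \<in> G \<Longrightarrow> v \<in> rep_space R \<Longrightarrow> rep_act R g v \<in> rep_space R"
    and "v \<in> rep_space R \<Longrightarrow> rep_act R \<one>\<^bsub>\<Gamma>\<^esub> v = v"
    and "g \<in> G \<Longrightarrow> h \<in> G \<Longrightarrow> v \<in> rep_space R \<Longrightarrow>
      rep_act R (g \<otimes>\<^bsub>\<Gamma>\<^esub> h) v = rep_act R g (rep_act R h v)"
  using assms by (auto simp only: group_rep_def)

section \<open>Sign characters and their projections\<close>

definition sign_character :: "('g, 'm) monoid_scheme \<Rightarrow> 'g set \<Rightarrow> ('g \<Rightarrow> real) \<Rightarrow> bool" where
  "sign_character \<Gamma> C c \<longleftrightarrow> finite_subgroup \<Gamma> C \<and> (\<forall>g\<in>C. c g = 1 \<or> c g = -1) \<and>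
     (\<forall>g\<in>C. \<forall>h\<in>C. c (g \<otimes>\<^bsub>\<Gamma>\<^esub> h) = c g * c h)"

context
  fixes \<Gamma> (structure) and G C c and R :: "('g, 'v::real_vector) rep"
  assumes R: "group_rep \<Gamma> G R" and C: "sign_character \<Gamma> C c" and CG: "C \<subseteq> G"
begin

interpretation C: finite_subgroup \<Gamma> C using C by (simp add: sign_character_def)

lemma sign_character_square: "g \<in> C \<Longrightarrow> c g * c g = 1"
  using C by (auto simp: sign_character_def)

lemma sign_character_one: "c \<one> = 1"
  using C sign_character_square[OF C.one_closed] C.one_closed
  unfolding sign_character_def by (metis C.l_one C.one_closed C.mem_carrier)

lemma sign_character_inv: "g \<in> C \<Longrightarrow> c (inv g) = c g"
proof -
  assume g: "g \<in> C"
  have "c (inv g) * c g = 1"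
    using C g sign_character_one unfolding sign_character_def
    by (metis C.l_inv C.m_inv_closed C.mem_carrier)
  then have "c (inv g) * (c g * c g) = c g" by (simp add: mult.assoc[symmetric])
  then show ?thesis using sign_character_square[OF g] by simp
qed

lemma gsum_act:
  assumes h: "h \<in> C" and v: "v \<in> rep_space R"
  shows "gsum R C c (rep_act R h v) = c h *\<^sub>R gsum R C c v"
proof -
  have "c h *\<^sub>R gsum R C c v = (\<Sum>g\<in>C. (c h * c g) *\<^sub>R rep_act R g v)"
    by (simp add: gsum_def scaleR_sum_right)
  also have "\<dots> = (\<Sum>g\<in>C. (c h * c (g \<otimes> h)) *\<^sub>R rep_act R (g \<otimes> h) v)"
    by (rule C.sum_mult_right[OF h, symmetric])
  also have "\<dots> = (\<Sum>g\<in>C. c g *\<^sub>R rep_act R g (rep_act R h v))"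
  proof (intro sum.cong refl)
    fix g assume g: "g \<in> C"
    have "c h * c (g \<otimes> h) = c g"
      using C g h sign_character_square[OF h] by (simp add: sign_character_def algebra_simps)
    moreover have "rep_act R (g \<otimes> h) v = rep_act R g (rep_act R h v)"
      using group_repD(5)[OF R] CG g h v by blast
    ultimately show "(c h * c (g \<otimes> h)) *\<^sub>R rep_act R (g \<otimes> h) v = c g *\<^sub>R rep_act R g (rep_act R h v)" by simp
  qed
  finally show ?thesis by (simp add: gsum_def)
qed

lemma act_gsum:
  assumes h: "h \<in> C" and v: "v \<in> rep_space R"
  shows "rep_act R h (gsum R C c v) = c h *\<^sub>R gsum R C c v"
proof -
  have lin: "linear (rep_act R h)" using R CG h by (auto simp: group_rep_def)
  have "c h *\<^sub>R gsum R C c v = (\<Sum>g\<in>C. (c h * c g) *\<^sub>R rep_act R g v)"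
    by (simp add: gsum_def scaleR_sum_right)
  also have "\<dots> = (\<Sum>g\<in>C. (c h * c (h \<otimes> g)) *\<^sub>R rep_act R (h \<otimes> g) v)"
    by (rule C.sum_mult_left[OF h, symmetric])
  also have "\<dots> = (\<Sum>g\<in>C. c g *\<^sub>R rep_act R h (rep_act R g v))"
  proof (intro sum.cong refl)
    fix g assume g: "g \<in> C"
    have "c h * c (h \<otimes> g) = c g"
      using C g h sign_character_square[OF h] by (simp add: sign_character_def algebra_simps)
    moreover have "rep_act R (h \<otimes> g) v = rep_act R h (rep_act R g v)"
      using group_repD(5)[OF R] CG g h v by blast
    ultimately show "(c h * c (h \<otimes> g)) *\<^sub>R rep_act R (h \<otimes> g) v = c g *\<^sub>R rep_act R h (rep_act R g v)" by simp
  qed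
  also have "\<dots> = rep_act R h (gsum R C c v)"
    unfolding gsum_def by (simp add: linear_sum[OF lin] linear_cmul[OF lin])
  finally show ?thesis by simp
qed

lemma gsum_gsum:
  assumes v: "v \<in> rep_space R"
  shows "gsum R C c (gsum R C c v) = real (card C) *\<^sub>R gsum R C c v"
proof -
  have "gsum R C c (gsum R C c v) = (\<Sum>g\<in>C. gsum R C c v)"
    unfolding gsum_def[of R C c "gsum R C c v"]
  proof (intro sum.cong refl)
    fix g assume g: "g \<in> C"
    have "c g *\<^sub>R rep_act R g (gsum R C c v) = (c g * c g) *\<^sub>R gsum R C c v"
      using act_gsum[OF g v] by simp
    then show "c g *\<^sub>R rep_act R g (gsum R C c v) = gsum R C c v"
      using sign_character_square[OF g] by simp
  qed
  then show ?thesis by (simp add: sum_constant_scaleR)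
qed

lemma gsum_in_space: "v \<in> rep_space R \<Longrightarrow> gsum R C c v \<in> rep_space R"
  using R CG by (intro gsum_in_submodule[of G]) (auto simp: group_rep_def submodule_def)

lemma card_sign_character: "card C > 0"
  using C.finite_G C.one_closed card_gt_0_iff by blast

end

section \<open>Formal linear combinations\<close>

abbreviation lookup :: "('a \<Rightarrow>\<^sub>0 'b::zero) \<Rightarrow> 'a \<Rightarrow> 'b" where
  "lookup \<equiv> Poly_Mapping.lookup"

abbreviation keys :: "('a \<Rightarrow>\<^sub>0 'b::zero) \<Rightarrow> 'a set" where
  "keys \<equiv> Poly_Mapping.keys"

abbreviation single :: "'a \<Rightarrow> 'b::zero \<Rightarrow> 'a \<Rightarrow>\<^sub>0 'b" where
  "single \<equiv> Poly_Mapping.single"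

lemma lookup_scaleR [simp]: "lookup (c *\<^sub>R f) x = c *\<^sub>R lookup f x"
  by (simp add: scaleR_poly_mapping.rep_eq)

lemma scaleR_single: "c *\<^sub>R single k x = single k (c *\<^sub>R x)"
  by (rule poly_mapping_eqI) (simp add: lookup_single when_def)

lemma linear_extension_superset:
  assumes "finite A" "keys p \<subseteq> A"
  shows "linear_extension \<phi> p = (\<Sum>k\<in>A. lookup p k *\<^sub>R \<phi> k)"
  unfolding linear_extension_def
  by (rule sum.mono_neutral_left[OF assms]) (auto simp: in_keys_iff)

lemma linear_linear_extension: "linear (linear_extension \<phi>)"
proof (rule linearI)
  fix p q :: "'a \<Rightarrow>\<^sub>0 real"
  let ?A = "keys p \<union> keys q"
  have "keys (p + q) \<subseteq> ?A" by (rule keys_add)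
  then show "linear_extension \<phi> (p + q) = linear_extension \<phi> p + linear_extension \<phi> q"
    by (simp add: linear_extension_superset[of ?A] lookup_add scaleR_add_left sum.distrib)
next
  fix r :: real and p :: "'a \<Rightarrow>\<^sub>0 real"
  have "keys (r *\<^sub>R p) \<subseteq> keys p" by (auto simp: in_keys_iff)
  then show "linear_extension \<phi> (r *\<^sub>R p) = r *\<^sub>R linear_extension \<phi> p"
    by (simp add: linear_extension_superset[of "keys p"] scaleR_sum_right)
qed

lemma linear_extension_single [simp]: "linear_extension \<phi> (single k c) = c *\<^sub>R \<phi> k"
  by (subst linear_extension_superset[of "{k}"]) auto

lemma poly_mapping_sum_singles:
  fixes p :: "'a \<Rightarrow>\<^sub>0 real"
  shows "p = (\<Sum>k\<in>keys p. lookup p k *\<^sub>R single k 1)"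
proof (rule poly_mapping_eqI)
  fix k
  show "lookup p k = lookup (\<Sum>k\<in>keys p. lookup p k *\<^sub>R single k 1) k"
    by (simp add: lookup_sum lookup_single when_def in_keys_iff if_distrib[of "\<lambda>t. _ * t"] cong: if_cong)
qed

text \<open>A map sending basis vectors injectively to multiples of basis vectors can be read off
  coefficient by coefficient. The actions on forms and on pairs of tabloids are both of this
  kind.\<close>

lemma lookup_monomial_map:
  fixes a :: "'a \<Rightarrow> real" and \<phi> :: "'a \<Rightarrow> 'b"
  assumes "inj \<phi>"
  shows "lookup (linear_extension (\<lambda>x. single (\<phi> x) (a x)) p) (\<phi> y) = a y * lookup p y"
proof -
  let ?A = "insert y (keys p)"
  have "lookup (linear_extension (\<lambda>x. single (\<phi> x) (a x)) p) (\<phi> y) =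
      (\<Sum>x\<in>?A. lookup p x * (if x = y then a x else 0))"
    by (subst linear_extension_superset[of ?A])
      (auto simp: lookup_sum lookup_single when_def inj_eq[OF assms] simp del: sum.insert sum.insert_if)
  also have "\<dots> = (\<Sum>x\<in>?A. if x = y then a x * lookup p x else 0)"
    by (intro sum.cong) auto
  also have "\<dots> = a y * lookup p y" by (subst sum.delta) auto
  finally show ?thesis .
qed

definition supported :: "'a set \<Rightarrow> ('a \<Rightarrow>\<^sub>0 real) set" where
  "supported M = {p. keys p \<subseteq> M}"

lemma subspace_supported: "subspace (supported M)"
  unfolding subspace_def supported_def
  by (auto simp: in_keys_iff lookup_add) (metis add.right_neutral in_keys_iff subsetD)

lemma supported_eq_span: "supported M = span ((\<lambda>m. single m 1) ` M)"
proof (intro equalityI subsetI)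
  fix p assume p: "p \<in> supported M"
  have "(\<Sum>k\<in>keys p. lookup p k *\<^sub>R single k 1) \<in> span ((\<lambda>m. single m (1::real)) ` M)"
    using p by (intro span_sum span_scale span_base) (auto simp: supported_def)
  then show "p \<in> span ((\<lambda>m. single m 1) ` M)" using poly_mapping_sum_singles[of p] by simp
next
  fix p assume "p \<in> span ((\<lambda>m. single m (1::real)) ` M)"
  moreover have "(\<lambda>m. single m (1::real)) ` M \<subseteq> supported M"
    by (auto simp: supported_def)
  ultimately show "p \<in> supported M" using span_minimal[OF _ subspace_supported] by blast
qed

section \<open>The action on forms\<close>

text \<open>\<open>map_key\<close> precomposes exponents with its argument, so the inverse
  permutation is what moves the exponent at \<open>i\<close> to \<open>\<sigma> i\<close>.\<close>

definition perm_mono :: "(nat \<Rightarrow> nat) \<Rightarrow> (nat \<Rightarrow>\<^sub>0 nat) \<Rightarrow> (nat \<Rightarrow>\<^sub>0 nat)" where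
  "perm_mono \<sigma> m = Poly_Mapping.map_key (inv_into UNIV \<sigma>) m"

text \<open>The monomial evaluated at the sign vector, which is its eigenvalue under the
  corresponding sign change.\<close>

definition mono_sign :: "(nat \<Rightarrow> real) \<Rightarrow> (nat \<Rightarrow>\<^sub>0 nat) \<Rightarrow> real" where
  "mono_sign \<epsilon> m = (\<Prod>i\<in>keys m. \<epsilon> i ^ lookup m i)"

definition monomials :: "nat \<Rightarrow> nat \<Rightarrow> (nat \<Rightarrow>\<^sub>0 nat) set" where
  "monomials n d = {m. keys m \<subseteq> {..<n} \<and> (\<Sum>i\<in>keys m. lookup m i) = d}"

lemma lookup_perm_mono:
  assumes "bij \<sigma>" shows "lookup (perm_mono \<sigma> m) i = lookup m (inv_into UNIV \<sigma> i)"
  using map_key.rep_eq[of "inv_into UNIV \<sigma>" m] bij_imp_bij_inv[OF assms]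
  by (simp add: perm_mono_def bij_is_inj)

lemma lookup_perm_mono_image [simp]:
  assumes "bij \<sigma>" shows "lookup (perm_mono \<sigma> m) (\<sigma> i) = lookup m i"
  using assms by (simp add: lookup_perm_mono bij_is_inj)

lemma perm_mono_eqI:
  assumes "bij \<sigma>" "\<And>i. lookup m' (\<sigma> i) = lookup m i"
  shows "perm_mono \<sigma> m = m'"
proof (rule poly_mapping_eqI)
  fix j
  show "lookup (perm_mono \<sigma> m) j = lookup m' j"
    using assms by (metis bij_pointE lookup_perm_mono_image)
qed

lemma keys_perm_mono:
  assumes "bij \<sigma>" shows "keys (perm_mono \<sigma> m) = \<sigma> ` keys m"
proof (rule Set.set_eqI)
  fix j obtain i where "j = \<sigma> i" using assms by (metis bij_pointE)
  then show "j \<in> keys (perm_mono \<sigma> m) \<longleftrightarrow> j \<in> \<sigma> ` keys m"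
    using assms by (simp add: in_keys_iff inj_image_mem_iff bij_is_inj)
qed

lemma perm_mono_id [simp]: "perm_mono id m = m" "perm_mono (\<lambda>x. x) m = m"
  by (rule perm_mono_eqI; simp add: bij_def)+

lemma perm_mono_comp:
  assumes "bij \<sigma>" "bij \<tau>" shows "perm_mono \<sigma> (perm_mono \<tau> m) = perm_mono (\<sigma> \<circ> \<tau>) m"
proof -
  have "perm_mono (\<sigma> \<circ> \<tau>) m = perm_mono \<sigma> (perm_mono \<tau> m)"
    by (rule perm_mono_eqI) (simp_all add: assms bij_comp)
  then show ?thesis by simp
qed

lemma perm_mono_inv:
  assumes "bij \<sigma>"
  shows "perm_mono (inv_into UNIV \<sigma>) (perm_mono \<sigma> m) = m" "perm_mono \<sigma> (perm_mono (inv_into UNIV \<sigma>) m) = m"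
  using assms bij_imp_bij_inv[OF assms] bij_is_surj[OF assms, unfolded surj_iff]
  by (simp_all add: perm_mono_comp bij_is_inj)

lemma inj_perm_mono: "bij \<sigma> \<Longrightarrow> inj (perm_mono \<sigma>)"
  using perm_mono_inv(1) by (metis injI)

lemma perm_mono_in_monomials:
  assumes "\<sigma> permutes {..<n}" "m \<in> monomials n d" shows "perm_mono \<sigma> m \<in> monomials n d"
proof -
  have b: "bij \<sigma>" using assms(1) by (rule permutes_bij)
  have "(\<Sum>i\<in>keys (perm_mono \<sigma> m). lookup (perm_mono \<sigma> m) i) =
      (\<Sum>i\<in>keys m. lookup m i)"
    using b by (simp add: keys_perm_mono sum.reindex inj_on_subset[OF bij_is_inj[OF b]])
  then show ?thesis using assms b permutes_in_image[OF assms(1)]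
    by (auto simp: monomials_def keys_perm_mono)
qed

lemma finite_monomials: "finite (monomials n d)"
proof -
  have "finite {f::nat \<Rightarrow> nat. \<forall>x. (x \<in> {..<n} \<longrightarrow> f x \<in> {..d}) \<and> (x \<notin> {..<n} \<longrightarrow> f x = 0)}"
    by (rule finite_set_of_finite_funs) auto
  moreover have "lookup ` monomials n d \<subseteq> {f. \<forall>x. (x \<in> {..<n} \<longrightarrow> f x \<in> {..d}) \<and> (x \<notin> {..<n} \<longrightarrow> f x = 0)}"
  proof clarify
    fix m x assume m: "m \<in> monomials n d"
    have "lookup m x \<le> d"
    proof (cases "x \<in> keys m")
      case True
      then show ?thesis using m member_le_sum[of x "keys m" "lookup m"] by (simp add: monomials_def)
    qed (simp add: in_keys_iff)
    then show "(x \<in> {..<n} \<longrightarrow> lookup m x \<in> {..d}) \<and> (x \<notin> {..<n} \<longrightarrow> lookup m x = 0)"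
      using m by (auto simp: monomials_def in_keys_iff)
  qed
  ultimately have "finite (lookup ` monomials n d)" by (rule finite_subset[rotated])
  then show ?thesis by (rule finite_imageD) (auto intro: inj_onI poly_mapping_eqI)
qed

lemma rep_space_forms: "rep_space (forms n d) = supported (monomials n d)"
  by (auto simp: forms_def supported_def monomials_def)

lemma prod_single:
  assumes "finite A"
  shows "(\<Prod>i\<in>A. single (f i) (c i)) =
    single (\<Sum>i\<in>A. f i) (\<Prod>i\<in>A. c i :: 'c::comm_semiring_1)"
  using assms by (induction A) (auto simp: mult_single)

lemma power_single:
  "single (single j 1) c ^ e =
    (single (single j e) (c ^ e) :: real_mpoly)"
  by (induction e) (auto simp: mult_single simp flip: single_add)

text \<open>Substituting signed variables permutes the monomials up to sign, which makes
  \<open>lookup_monomial_map\<close> applicable to forms.\<close>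

lemma forms_act_eq:
  assumes "bij \<sigma>"
  shows "rep_act (forms n d) (\<sigma>, \<epsilon>) = linear_extension (\<lambda>m. single (perm_mono \<sigma> m) (mono_sign \<epsilon> m))"
proof -
  have "(\<Prod>i\<in>keys m. (\<epsilon> i *\<^sub>R Var (\<sigma> i)) ^ lookup m i) =
      single (perm_mono \<sigma> m) (mono_sign \<epsilon> m)" for m
  proof -
    have "(\<Sum>i\<in>keys m. single (\<sigma> i) (lookup m i)) = perm_mono \<sigma> m"
      by (rule perm_mono_eqI[OF assms, symmetric])
        (simp add: lookup_sum lookup_single when_def inj_eq[OF bij_is_inj[OF assms]] in_keys_iff)
    then show ?thesis
      by (simp add: Var_def scaleR_single power_single[unfolded One_nat_def] prod_single mono_sign_def)
  qed
  then show ?thesis by (simp add: forms_def substitute_def)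
qed

lemma lookup_forms_act:
  assumes "bij \<sigma>"
  shows "lookup (rep_act (forms n d) (\<sigma>, \<epsilon>) p) (perm_mono \<sigma> m) = mono_sign \<epsilon> m * lookup p m"
  unfolding forms_act_eq[OF assms] by (rule lookup_monomial_map[OF inj_perm_mono[OF assms]])

lemma forms_act_eqI:
  assumes "bij \<sigma>" "\<And>m. lookup q (perm_mono \<sigma> m) = mono_sign \<epsilon> m * lookup p m"
  shows "rep_act (forms n d) (\<sigma>, \<epsilon>) p = q"
proof (rule poly_mapping_eqI)
  fix m
  have "m = perm_mono \<sigma> (perm_mono (inv_into UNIV \<sigma>) m)" using perm_mono_inv(2)[OF assms(1)] by simp
  then show "lookup (rep_act (forms n d) (\<sigma>, \<epsilon>) p) m = lookup q m"
    using lookup_forms_act[OF assms(1)] assms(2) by metis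
qed

lemma mono_sign_one [simp]: "mono_sign (\<lambda>_. 1) m = 1"
  by (simp add: mono_sign_def)

lemma mono_sign_mult: "mono_sign (\<lambda>i. \<epsilon> i * \<delta> i) m = mono_sign \<epsilon> m * mono_sign \<delta> m"
  by (simp add: mono_sign_def power_mult_distrib prod.distrib)

lemma mono_sign_perm:
  assumes "bij \<tau>" shows "mono_sign \<epsilon> (perm_mono \<tau> m) = mono_sign (\<lambda>i. \<epsilon> (\<tau> i)) m"
  using assms by (simp add: mono_sign_def keys_perm_mono prod.reindex inj_on_subset[OF bij_is_inj[OF assms]])

lemma mono_sign_cases:
  assumes "\<And>i. \<epsilon> i = 1 \<or> \<epsilon> i = -1" shows "mono_sign \<epsilon> m = 1 \<or> mono_sign \<epsilon> m = -1"
proof -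
  have "(\<epsilon> i ^ k)\<^sup>2 = 1" for i k using assms[of i] by (auto simp: power_mult[symmetric] power2_eq_square simp flip: power_mult_distrib)
  then have "(mono_sign \<epsilon> m)\<^sup>2 = 1" by (simp add: mono_sign_def prod_power_distrib)
  then show ?thesis by (simp add: power2_eq_1_iff)
qed

lemma carrier_hyperoctahedral_bij:
  assumes "(\<sigma>, \<epsilon>) \<in> carrier (hyperoctahedral_group n)"
  shows "\<sigma> permutes {..<n}" "bij \<sigma>" "\<epsilon> i = 1 \<or> \<epsilon> i = -1"
  using assms unfolding mem_hyperoctahedral by (auto intro: permutes_bij) (meson not_less)

lemma group_rep_forms: "group_rep (hyperoctahedral_group n) (carrier (hyperoctahedral_group n)) (forms n d)"
  unfolding group_rep_def
proof (intro conjI ballI)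
  show "subspace (rep_space (forms n d))" by (simp add: rep_space_forms subspace_supported)
next
  fix g assume "g \<in> carrier (hyperoctahedral_group n)"
  then show "linear (rep_act (forms n d) g)"
    by (cases g) (metis carrier_hyperoctahedral_bij(2) forms_act_eq linear_linear_extension)
next
  fix g p assume g: "g \<in> carrier (hyperoctahedral_group n)" and p: "p \<in> rep_space (forms n d)"
  obtain \<sigma> \<epsilon> where ge: "g = (\<sigma>, \<epsilon>)" by (cases g)
  note b = carrier_hyperoctahedral_bij[OF g[unfolded ge]]
  show "rep_act (forms n d) g p \<in> rep_space (forms n d)"
    unfolding rep_space_forms supported_def
  proof clarify
    fix m assume m: "m \<in> keys (rep_act (forms n d) g p)"
    define m' where "m' = perm_mono (inv_into UNIV \<sigma>) m"
    have mm: "m = perm_mono \<sigma> m'" using perm_mono_inv(2)[OF b(2)] by (simp add: m'_def)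
    have "lookup p m' \<noteq> 0" using m lookup_forms_act[OF b(2)] unfolding mm ge in_keys_iff by auto
    then have "m' \<in> monomials n d" using p by (auto simp: rep_space_forms supported_def in_keys_iff)
    then show "m \<in> monomials n d" unfolding mm by (rule perm_mono_in_monomials[OF b(1)])
  qed
next
  fix p
  show "rep_act (forms n d) \<one>\<^bsub>hyperoctahedral_group n\<^esub> p = p"
    unfolding one_hyperoctahedral by (rule forms_act_eqI) simp_all
next
  fix g h p assume g: "g \<in> carrier (hyperoctahedral_group n)" and h: "h \<in> carrier (hyperoctahedral_group n)"
  obtain \<sigma> \<epsilon> \<tau> \<delta> where e: "g = (\<sigma>, \<epsilon>)" "h = (\<tau>, \<delta>)" by (metis prod.exhaust)
  note b = carrier_hyperoctahedral_bij(2)[OF g[unfolded e]] carrier_hyperoctahedral_bij(2)[OF h[unfolded e]]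
  show "rep_act (forms n d) (g \<otimes>\<^bsub>hyperoctahedral_group n\<^esub> h) p = rep_act (forms n d) g (rep_act (forms n d) h p)"
    unfolding e mult_hyperoctahedral
    by (rule forms_act_eqI)
      (simp_all add: b bij_comp mono_sign_mult mono_sign_perm[OF b(2), symmetric]
        lookup_forms_act perm_mono_comp[OF b, symmetric])
qed

text \<open>The inner product with orthonormal monomials. It is invariant because signed
  permutations permute the monomials up to sign.\<close>

definition mono_inner :: "nat \<Rightarrow> nat \<Rightarrow> real_mpoly \<Rightarrow> real_mpoly \<Rightarrow> real" where
  "mono_inner n d p q = (\<Sum>m\<in>monomials n d. lookup p m * lookup q m)"

lemma mono_inner_act:
  assumes g: "g \<in> carrier (hyperoctahedral_group n)"
  shows "mono_inner n d (rep_act (forms n d) g p) (rep_act (forms n d) g q) = mono_inner n d p q"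
proof -
  obtain \<sigma> \<epsilon> where ge: "g = (\<sigma>, \<epsilon>)" by (cases g)
  note b = carrier_hyperoctahedral_bij[OF g[unfolded ge]]
  have "bij_betw (perm_mono \<sigma>) (monomials n d) (monomials n d)"
    by (rule bij_betw_byWitness[where f' = "perm_mono (inv_into UNIV \<sigma>)"])
      (auto simp: perm_mono_inv b intro!: perm_mono_in_monomials permutes_inv)
  then have "mono_inner n d (rep_act (forms n d) g p) (rep_act (forms n d) g q) =
    (\<Sum>m\<in>monomials n d. lookup (rep_act (forms n d) g p) (perm_mono \<sigma> m) * lookup (rep_act (forms n d) g q) (perm_mono \<sigma> m))"
    unfolding mono_inner_def by (rule sum.reindex_bij_betw[symmetric])
  also have "\<dots> = (\<Sum>m\<in>monomials n d. (mono_sign \<epsilon> m * mono_sign \<epsilon> m) * (lookup p m * lookup q m))"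
    unfolding ge lookup_forms_act[OF b(2)] by (simp add: algebra_simps)
  also have "\<dots> = mono_inner n d p q"
  proof -
    have "mono_sign \<epsilon> m * mono_sign \<epsilon> m = 1" for m using mono_sign_cases[of \<epsilon> m] b(3) by auto
    then show ?thesis by (simp add: mono_inner_def)
  qed
  finally show ?thesis .
qed

lemma mono_inner_simps:
  "mono_inner n d p 0 = 0" "mono_inner n d 0 p = 0"
  "mono_inner n d (c *\<^sub>R p) q = c * mono_inner n d p q"
  "mono_inner n d p (c *\<^sub>R q) = c * mono_inner n d p q"
  "mono_inner n d (\<Sum>i\<in>A. f i) q = (\<Sum>i\<in>A. mono_inner n d (f i) q)"
  "mono_inner n d p (\<Sum>i\<in>A. f i) = (\<Sum>i\<in>A. mono_inner n d p (f i))"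
proof -
  show "mono_inner n d (\<Sum>i\<in>A. f i) q = (\<Sum>i\<in>A. mono_inner n d (f i) q)"
    unfolding mono_inner_def by (simp add: lookup_sum sum_distrib_right) (rule sum.swap)
  show "mono_inner n d p (\<Sum>i\<in>A. f i) = (\<Sum>i\<in>A. mono_inner n d p (f i))"
    unfolding mono_inner_def by (simp add: lookup_sum sum_distrib_left) (rule sum.swap)
qed (simp_all add: mono_inner_def sum_distrib_left algebra_simps)

lemma mono_inner_eq_0:
  assumes "p \<in> rep_space (forms n d)" "mono_inner n d p p = 0"
  shows "p = 0"
proof (rule poly_mapping_eqI)
  fix m
  have "\<forall>m\<in>monomials n d. lookup p m * lookup p m = 0"
    using assms(2) unfolding mono_inner_def by (subst (asm) sum_nonneg_eq_0_iff) (auto simp: finite_monomials)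
  then show "lookup p m = lookup 0 m"
    using assms(1) by (cases "m \<in> monomials n d") (auto simp: rep_space_forms supported_def in_keys_iff)
qed

text \<open>Group elements act orthogonally, so the adjoint of each is its inverse, and a sign
  character takes the same value on both.\<close>

lemma mono_inner_gsum:
  assumes C: "sign_character (hyperoctahedral_group n) C c" and CG: "C \<subseteq> carrier (hyperoctahedral_group n)"
    and p: "p \<in> rep_space (forms n d)" and q: "q \<in> rep_space (forms n d)"
  shows "mono_inner n d (gsum (forms n d) C c p) q = mono_inner n d p (gsum (forms n d) C c q)"
proof -
  let ?\<Gamma> = "hyperoctahedral_group n" and ?F = "forms n d"
  interpret C: finite_subgroup ?\<Gamma> C using C by (simp add: sign_character_def)
  have "mono_inner n d (gsum ?F C c p) q = (\<Sum>g\<in>C. c g * mono_inner n d (rep_act ?F g p) q)"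
    by (simp add: gsum_def mono_inner_simps)
  also have "\<dots> = (\<Sum>g\<in>C. c (inv\<^bsub>?\<Gamma>\<^esub> g) * mono_inner n d p (rep_act ?F (inv\<^bsub>?\<Gamma>\<^esub> g) q))"
  proof (intro sum.cong refl)
    fix g assume g: "g \<in> C"
    have "rep_act ?F g (rep_act ?F (inv\<^bsub>?\<Gamma>\<^esub> g) q) = q"
      using group_rep_forms[of n d] g q C.mem_carrier[OF g] unfolding group_rep_def
      by (metis C.inv_closed C.r_inv)
    then have "mono_inner n d (rep_act ?F g p) q = mono_inner n d p (rep_act ?F (inv\<^bsub>?\<Gamma>\<^esub> g) q)"
      using mono_inner_act[OF C.mem_carrier[OF g]] by metis
    then show "c g * mono_inner n d (rep_act ?F g p) q =
        c (inv\<^bsub>?\<Gamma>\<^esub> g) * mono_inner n d p (rep_act ?F (inv\<^bsub>?\<Gamma>\<^esub> g) q)"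
      using sign_character_inv[OF group_rep_forms C CG g] by simp
  qed
  also have "\<dots> = (\<Sum>g\<in>C. c g * mono_inner n d p (rep_act ?F g q))"
    by (rule C.sum_inv)
  also have "\<dots> = mono_inner n d p (gsum ?F C c q)"
    by (simp add: gsum_def mono_inner_simps)
  finally show ?thesis .
qed

text \<open>Write \<kappa> and \<rho> for the sums over \<open>C\<close> and \<open>D\<close>. By
  self-adjointness and \<rho> \<rho> = |D| \<rho>, the inner product of \<kappa> \<rho> \<kappa> p
  with p is that of \<rho> \<kappa> p with \<kappa> p, hence the square norm of \<rho> \<kappa> p
  divided by |D|. This supplies the hypothesis \<open>pos\<close> of
  \<open>has_multiplicity_dim_symmetrizer\<close>.\<close>

lemma forms_symmetrizer_nonzero:
  assumes C: "sign_character (hyperoctahedral_group n) C c" and CG: "C \<subseteq> carrier (hyperoctahedral_group n)"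
    and D: "sign_character (hyperoctahedral_group n) D \<chi>" and DG: "D \<subseteq> carrier (hyperoctahedral_group n)"
    and p: "p \<in> rep_space (forms n d)"
    and nz: "gsum (forms n d) D \<chi> (gsum (forms n d) C c p) \<noteq> 0"
  shows "gsum (forms n d) C c (gsum (forms n d) D \<chi> (gsum (forms n d) C c p)) \<noteq> 0"
proof
  let ?K = "gsum (forms n d) C c" and ?P = "gsum (forms n d) D \<chi>"
  note inC = gsum_in_space[OF group_rep_forms C CG, of _ d]
  note inD = gsum_in_space[OF group_rep_forms D DG, of _ d]
  assume "?K (?P (?K p)) = 0"
  then have "0 = mono_inner n d (?K (?P (?K p))) p" by (simp add: mono_inner_simps)
  also have "\<dots> = mono_inner n d (?P (?K p)) (?K p)"
    using inC inD p by (intro mono_inner_gsum[OF C CG]) auto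
  finally have "mono_inner n d (?P (?K p)) (?K p) = 0" by simp
  then have "mono_inner n d (?P (?P (?K p))) (?K p) = 0"
    using gsum_gsum[OF group_rep_forms D DG inC[OF p]] by (simp add: mono_inner_simps)
  then have "mono_inner n d (?P (?K p)) (?P (?K p)) = 0"
    using mono_inner_gsum[OF D DG inD[OF inC[OF p]] inC[OF p]] by simp
  then show False using mono_inner_eq_0[OF inD[OF inC[OF p]]] nz by blast
qed

section \<open>Groups of signed permutations\<close>

definition perm_subgroup :: "nat \<Rightarrow> (nat \<Rightarrow> nat) set \<Rightarrow> bool" where
  "perm_subgroup n K \<longleftrightarrow> (\<forall>\<sigma>\<in>K. \<sigma> permutes {..<n}) \<and> id \<in> K \<and>
     (\<forall>\<sigma>\<in>K. \<forall>\<tau>\<in>K. \<sigma> \<circ> \<tau> \<in> K) \<and> (\<forall>\<sigma>\<in>K. inv_into UNIV \<sigma> \<in> K)"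

text \<open>Row stabilizers, column stabilizers and block permutations are all stabilizers of a
  labelling of the letters, so a single set of lemmas serves them.\<close>

definition label_stab :: "nat \<Rightarrow> (nat \<Rightarrow> 'l) \<Rightarrow> (nat \<Rightarrow> nat) set" where
  "label_stab n f = {\<sigma>. \<sigma> permutes {..<n} \<and> (\<forall>a<n. f (\<sigma> a) = f a)}"

lemma perm_subgroup_label_stab: "perm_subgroup n (label_stab n f)"
  unfolding perm_subgroup_def
proof (intro conjI ballI)
  show "\<sigma> \<circ> \<tau> \<in> label_stab n f" if s: "\<sigma> \<in> label_stab n f" and t: "\<tau> \<in> label_stab n f" for \<sigma> \<tau>
    using s t permutes_in_image[of \<tau> "{..<n}"] unfolding label_stab_def by (auto intro: permutes_compose)
  show "inv_into UNIV \<sigma> \<in> label_stab n f" if s: "\<sigma> \<in> label_stab n f" for \<sigma>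
  proof -
    have p: "\<sigma> permutes {..<n}" using s by (simp add: label_stab_def)
    have "f (inv_into UNIV \<sigma> a) = f a" if "a < n" for a
    proof -
      have "inv_into UNIV \<sigma> a < n" using permutes_in_image[OF permutes_inv[OF p], of a] that by simp
      then have "f (\<sigma> (inv_into UNIV \<sigma> a)) = f (inv_into UNIV \<sigma> a)" using s by (simp add: label_stab_def)
      then show ?thesis using permutes_inverses(1)[OF p] by simp
    qed
    then show ?thesis using permutes_inv[OF p] by (simp add: label_stab_def)
  qed
qed (auto simp: label_stab_def permutes_id)

lemma perm_subgroup_permutes: "perm_subgroup n {\<sigma>. \<sigma> permutes {..<n}}"
  using perm_subgroup_label_stab[of n "\<lambda>_. ()"] by (simp add: label_stab_def)

lemma perm_subgroup_subset: "perm_subgroup n K \<Longrightarrow> K \<subseteq> {\<sigma>. \<sigma> permutes {..<n}}"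
  by (auto simp: perm_subgroup_def)

lemma perm_subgroup_finite: "perm_subgroup n K \<Longrightarrow> finite K"
  using finite_subset[OF perm_subgroup_subset finite_permutations[of "{..<n}"]] by simp

lemma perm_subgroup_sum_left:
  assumes "perm_subgroup n K" "\<tau> \<in> K"
  shows "(\<Sum>\<sigma>\<in>K. f (\<tau> \<circ> \<sigma>)) = (\<Sum>\<sigma>\<in>K. f \<sigma>)"
proof (rule sum.reindex_bij_betw)
  have "\<tau> permutes {..<n}" using assms by (simp add: perm_subgroup_def)
  then have "inv_into UNIV \<tau> \<circ> (\<tau> \<circ> \<sigma>) = \<sigma>" "\<tau> \<circ> (inv_into UNIV \<tau> \<circ> \<sigma>) = \<sigma>" for \<sigma>
    by (auto simp: fun_eq_iff permutes_inverses)
  then show "bij_betw ((\<circ>) \<tau>) K K"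
    using assms by (intro bij_betw_byWitness[where f' = "(\<circ>) (inv_into UNIV \<tau>)"]) (auto simp: perm_subgroup_def)
qed

lemma perm_subgroup_sum_right:
  assumes "perm_subgroup n K" "\<tau> \<in> K"
  shows "(\<Sum>\<sigma>\<in>K. f (\<sigma> \<circ> \<tau>)) = (\<Sum>\<sigma>\<in>K. f \<sigma>)"
proof (rule sum.reindex_bij_betw)
  have "\<tau> permutes {..<n}" using assms by (simp add: perm_subgroup_def)
  then have "(\<sigma> \<circ> \<tau>) \<circ> inv_into UNIV \<tau> = \<sigma>" "(\<sigma> \<circ> inv_into UNIV \<tau>) \<circ> \<tau> = \<sigma>" for \<sigma>
    by (auto simp: fun_eq_iff permutes_inverses)
  then show "bij_betw (\<lambda>\<sigma>. \<sigma> \<circ> \<tau>) K K"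
    using assms by (intro bij_betw_byWitness[where f' = "\<lambda>\<sigma>. \<sigma> \<circ> inv_into UNIV \<tau>"]) (auto simp: perm_subgroup_def)
qed

text \<open>The character through which the sign changes act on the inducing module. It depends on
  the sign vector alone, but is multiplicative only as long as the right factor preserves the two
  blocks of letters.\<close>

definition chi :: "nat \<Rightarrow> nat \<Rightarrow> signed_perm \<Rightarrow> real" where
  "chi k n g = (\<Prod>i\<in>{k..<n}. snd g i)"

definition sgn_chi :: "nat \<Rightarrow> nat \<Rightarrow> signed_perm \<Rightarrow> real" where
  "sgn_chi k n g = of_int (sign (fst g)) * chi k n g"

abbreviation block_perms :: "nat \<Rightarrow> nat \<Rightarrow> (nat \<Rightarrow> nat) set" where
  "block_perms k n \<equiv> label_stab n (\<lambda>a. a < k)"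

lemma block_perms_image:
  assumes "\<sigma> \<in> block_perms k n" shows "\<sigma> ` {k..<n} = {k..<n}"
proof -
  have p: "\<sigma> permutes {..<n}" and b: "\<And>a. a < n \<Longrightarrow> \<sigma> a < k \<longleftrightarrow> a < k" using assms by (auto simp: label_stab_def)
  have "\<sigma> ` {k..<n} \<subseteq> {k..<n}" using b permutes_in_image[OF p] by force
  moreover have "card (\<sigma> ` {k..<n}) = card {k..<n}"
    by (rule card_image) (use permutes_inj_on[OF p] in blast)
  ultimately show ?thesis by (intro card_subset_eq) auto
qed

lemma chi_mult:
  assumes "h \<in> carrier (hyperoctahedral_group n)" "fst h \<in> block_perms k n"
  shows "chi k n (g \<otimes>\<^bsub>hyperoctahedral_group n\<^esub> h) = chi k n g * chi k n h"
proof -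
  obtain \<sigma> \<epsilon> \<tau> \<delta> where e: "g = (\<sigma>, \<epsilon>)" "h = (\<tau>, \<delta>)" by (metis prod.exhaust)
  have p: "\<tau> permutes {..<n}" using assms(2) e by (simp add: label_stab_def)
  have "(\<Prod>i\<in>{k..<n}. \<epsilon> (\<tau> i)) = (\<Prod>i\<in>\<tau> ` {k..<n}. \<epsilon> i)"
    using permutes_inj_on[OF p] by (subst prod.reindex) (auto intro: inj_on_subset)
  also have "\<dots> = (\<Prod>i\<in>{k..<n}. \<epsilon> i)" using block_perms_image[of \<tau>] assms(2) e by simp
  finally show ?thesis by (simp add: e mult_hyperoctahedral chi_def prod.distrib)
qed

text \<open>The group \<open>full\<close> consists of all permutations with signs in
  \<open>N\<close>. Trivial signs, all signs, and signs with product 1 give types A, B and D, which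
  can thus be treated together.\<close>

locale signed_family =
  fixes n :: nat and N :: "(nat \<Rightarrow> real) set"
  assumes N_sign: "\<epsilon> \<in> N \<Longrightarrow> \<epsilon> i = 1 \<or> \<epsilon> i = -1"
    and N_beyond: "\<epsilon> \<in> N \<Longrightarrow> i \<ge> n \<Longrightarrow> \<epsilon> i = 1"
    and N_one: "(\<lambda>_. 1) \<in> N"
    and N_mult: "\<epsilon> \<in> N \<Longrightarrow> \<delta> \<in> N \<Longrightarrow> (\<lambda>i. \<epsilon> i * \<delta> i) \<in> N"
    and N_perm: "\<epsilon> \<in> N \<Longrightarrow> \<sigma> permutes {..<n} \<Longrightarrow> (\<lambda>i. \<epsilon> (\<sigma> i)) \<in> N"
begin

abbreviation \<Gamma> :: "signed_perm monoid" where "\<Gamma> \<equiv> hyperoctahedral_group n"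

abbreviation full :: "signed_perm set" where "full \<equiv> {\<sigma>. \<sigma> permutes {..<n}} \<times> N"

lemma finite_N: "finite N"
proof (rule finite_subset)
  show "N \<subseteq> {f. \<forall>x. (x \<in> {..<n} \<longrightarrow> f x \<in> {1, -1}) \<and> (x \<notin> {..<n} \<longrightarrow> f x = 1)}"
  proof clarify
    fix \<epsilon> x assume "\<epsilon> \<in> N"
    then show "(x \<in> {..<n} \<longrightarrow> \<epsilon> x \<in> {1, -1}) \<and> (x \<notin> {..<n} \<longrightarrow> \<epsilon> x = 1)"
      using N_sign[of \<epsilon> x] N_beyond[of \<epsilon> x] by auto
  qed
  show "finite {f. \<forall>x. (x \<in> {..<n} \<longrightarrow> f x \<in> {1::real, -1}) \<and> (x \<notin> {..<n} \<longrightarrow> f x = 1)}"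
    by (rule finite_set_of_finite_funs) auto
qed

lemma card_N: "card N > 0" using finite_N N_one card_gt_0_iff by blast

lemma N_square: "\<epsilon> \<in> N \<Longrightarrow> \<epsilon> i * \<epsilon> i = 1" using N_sign[of \<epsilon> i] by auto

lemma full_subset: "full \<subseteq> carrier \<Gamma>"
  using N_sign N_beyond by (auto simp: mem_hyperoctahedral)

text \<open>A semidirect product of \<open>K\<close> and \<open>N\<close>: products and inverses
  transport a sign vector along a permutation, and \<open>N\<close> is closed under this.\<close>

lemma finite_subgroup_times:
  assumes "perm_subgroup n K"
  shows "finite_subgroup \<Gamma> (K \<times> N)"
proof -
  have sub: "K \<times> N \<subseteq> carrier \<Gamma>" using full_subset perm_subgroup_subset[OF assms] by blast
  interpret group \<Gamma> by (rule group_hyperoctahedral)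
  have "subgroup (K \<times> N) \<Gamma>"
  proof (rule subgroupI[OF sub])
    show "K \<times> N \<noteq> {}" using assms N_one by (auto simp: perm_subgroup_def)
  next
    fix x assume x: "x \<in> K \<times> N"
    obtain \<sigma> \<epsilon> where e: "x = (\<sigma>, \<epsilon>)" by (cases x)
    have p: "\<sigma> permutes {..<n}" using x e perm_subgroup_subset[OF assms] by blast
    let ?y = "(inv_into UNIV \<sigma>, \<lambda>i. \<epsilon> (inv_into UNIV \<sigma> i))"
    have y: "?y \<in> K \<times> N" using x e assms N_perm permutes_inv[OF p] by (auto simp: perm_subgroup_def)
    have "?y \<otimes>\<^bsub>\<Gamma>\<^esub> x = \<one>\<^bsub>\<Gamma>\<^esub>"
      using x by (simp add: e mult_hyperoctahedral one_hyperoctahedral permutes_inverses[OF p] N_square fun_eq_iff)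
    then have "inv\<^bsub>\<Gamma>\<^esub> x = ?y" using x y sub by (intro inv_equality) auto
    then show "inv\<^bsub>\<Gamma>\<^esub> x \<in> K \<times> N" using y by simp
  next
    fix x y assume xy: "x \<in> K \<times> N" "y \<in> K \<times> N"
    obtain \<sigma> \<epsilon> \<tau> \<delta> where e: "x = (\<sigma>, \<epsilon>)" "y = (\<tau>, \<delta>)" by (metis prod.exhaust)
    have "\<tau> permutes {..<n}" using xy e perm_subgroup_subset[OF assms] by blast
    then have "(\<lambda>i. \<epsilon> (\<tau> i) * \<delta> i) \<in> N"
      using xy e N_mult[OF N_perm[of \<epsilon> \<tau>], of \<delta>] by simp
    then show "x \<otimes>\<^bsub>\<Gamma>\<^esub> y \<in> K \<times> N"
      using xy e assms by (simp add: mult_hyperoctahedral perm_subgroup_def)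
  qed
  moreover have "finite (K \<times> N)" using finite_N perm_subgroup_finite[OF assms] by simp
  ultimately show ?thesis by (intro finite_subgroup.intro finite_subgroup_axioms.intro) (rule group_axioms)
qed

lemma chi_cases: "g \<in> full \<Longrightarrow> chi k n g = 1 \<or> chi k n g = -1"
proof -
  assume g: "g \<in> full"
  have "(chi k n g)\<^sup>2 = 1"
    using g N_square by (auto simp: chi_def power2_eq_square simp flip: prod.distrib)
  then show ?thesis by (simp add: power2_eq_1_iff)
qed

lemma sign_character_chi:
  assumes K: "perm_subgroup n K" and KB: "K \<subseteq> block_perms k n"
  shows "sign_character \<Gamma> (K \<times> N) (chi k n)"
  unfolding sign_character_def
proof (intro conjI ballI)
  show "finite_subgroup \<Gamma> (K \<times> N)" by (rule finite_subgroup_times[OF K])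
  have sub: "K \<times> N \<subseteq> full" using perm_subgroup_subset[OF K] by blast
  show "chi k n g = 1 \<or> chi k n g = -1" if "g \<in> K \<times> N" for g using that chi_cases sub by blast
  show "chi k n (g \<otimes>\<^bsub>\<Gamma>\<^esub> h) = chi k n g * chi k n h" if "g \<in> K \<times> N" "h \<in> K \<times> N" for g h
    using that sub full_subset KB by (intro chi_mult) auto
qed

lemma sign_character_sgn_chi:
  assumes K: "perm_subgroup n K" and KB: "K \<subseteq> block_perms k n"
  shows "sign_character \<Gamma> (K \<times> N) (sgn_chi k n)"
  unfolding sign_character_def
proof (intro conjI ballI)
  show "finite_subgroup \<Gamma> (K \<times> N)" by (rule finite_subgroup_times[OF K])
  have sub: "K \<times> N \<subseteq> full" using perm_subgroup_subset[OF K] by blast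
  show "sgn_chi k n g = 1 \<or> sgn_chi k n g = -1" if g: "g \<in> K \<times> N" for g
  proof -
    have "chi k n g = 1 \<or> chi k n g = -1" using g chi_cases sub by blast
    moreover have "sign (fst g) = 1 \<or> sign (fst g) = -1" by (simp add: sign_def)
    ultimately show ?thesis unfolding sgn_chi_def by (elim disjE) simp_all
  qed
  show "sgn_chi k n (g \<otimes>\<^bsub>\<Gamma>\<^esub> h) = sgn_chi k n g * sgn_chi k n h" if gh: "g \<in> K \<times> N" "h \<in> K \<times> N" for g h
  proof -
    have c: "chi k n (g \<otimes>\<^bsub>\<Gamma>\<^esub> h) = chi k n g * chi k n h"
      using gh sub full_subset KB by (intro chi_mult) auto
    obtain \<sigma> \<epsilon> \<tau> \<delta> where e: "g = (\<sigma>, \<epsilon>)" "h = (\<tau>, \<delta>)" by (metis prod.exhaust)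
    have "\<sigma> permutes {..<n}" "\<tau> permutes {..<n}" using gh sub e by auto
    then have "permutation \<sigma>" "permutation \<tau>" by (auto intro: permutes_imp_permutation)
    then have "sign (\<sigma> \<circ> \<tau>) = sign \<sigma> * sign \<tau>" by (rule sign_compose)
    then show ?thesis using c by (simp add: sgn_chi_def e mult_hyperoctahedral)
  qed
qed

end

section \<open>Tabloids and cells\<close>

text \<open>Remove the maximum, which is at least \<open>card Y - 1\<close>, and argue by induction;
  equality of the sums forces equality at every removal.\<close>

lemma sum_nat_set_ge:
  fixes Y :: "nat set"
  assumes "finite Y"
  shows "\<Sum>{..<card Y} \<le> \<Sum>Y \<and> (\<Sum>Y = \<Sum>{..<card Y} \<longrightarrow> Y = {..<card Y})"
  using assms
proof (induction "card Y" arbitrary: Y)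
  case 0
  then show ?case by simp
next
  case (Suc m)
  define M where "M = Max Y"
  define Z where "Z = Y - {M}"
  have "Y \<noteq> {}" using Suc.hyps(2) by auto
  then have M: "M \<in> Y" using Suc.prems by (simp add: M_def)
  have Z: "card Z = m" "finite Z" "Y = insert M Z" "M \<notin> Z" using M Suc by (auto simp: Z_def)
  have "Y \<subseteq> {..M}" using Suc.prems by (auto simp: M_def)
  then have "Suc m \<le> Suc M" using card_mono[of "{..M}" Y] Suc.hyps(2) by simp
  moreover have "\<Sum>Y = M + \<Sum>Z" using Z by simp
  moreover have "\<Sum>{..<card Y} = m + \<Sum>{..<m}" by (simp add: Suc.hyps(2)[symmetric] lessThan_Suc)
  moreover have *: "\<Sum>{..<m} \<le> \<Sum>Z" "\<Sum>Z = \<Sum>{..<m} \<longrightarrow> Z = {..<m}" using Suc.hyps(1)[of Z] Z by auto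
  ultimately have le: "\<Sum>{..<card Y} \<le> \<Sum>Y" and eq: "\<Sum>Y = \<Sum>{..<card Y} \<Longrightarrow> M = m \<and> \<Sum>Z = \<Sum>{..<m}"
    by linarith+
  have "Y = {..<card Y}" if "\<Sum>Y = \<Sum>{..<card Y}"
    using eq[OF that] *(2) Z(3) Suc.hyps(2)[symmetric] by (auto simp: lessThan_Suc)
  then show ?case using le by blast
qed

text \<open>On a fibre of \<open>c\<close> the values of \<open>g\<close> form an initial segment,
  the set with least sum for its size. As the totals over \<open>L\<close> agree, no fibre can have
  a larger sum under \<open>f\<close>, so \<open>f\<close> takes the same values there.\<close>

lemma image_eq_of_sum_eq:
  fixes f g :: "'a \<Rightarrow> nat"
  assumes fin: "finite L" and f: "\<And>\<gamma>. inj_on f {a \<in> L. c a = \<gamma>}"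
    and g: "\<And>\<gamma>. inj_on g {a \<in> L. c a = \<gamma>}"
    and down: "\<And>a i. a \<in> L \<Longrightarrow> i < g a \<Longrightarrow> \<exists>b\<in>L. c b = c a \<and> g b = i"
    and eq: "(\<Sum>a\<in>L. f a) = (\<Sum>a\<in>L. g a)"
  shows "f ` {a \<in> L. c a = \<gamma>} = g ` {a \<in> L. c a = \<gamma>}"
proof -
  define F where "F \<gamma> = {a \<in> L. c a = \<gamma>}" for \<gamma>
  have finF: "finite (F \<gamma>)" for \<gamma> using fin by (simp add: F_def)
  have cards: "card (f ` F \<gamma>) = card (F \<gamma>)" "card (g ` F \<gamma>) = card (F \<gamma>)" for \<gamma>
    using f g by (auto simp: F_def card_image)
  have gF: "g ` F \<gamma> = {..<card (F \<gamma>)}" for \<gamma>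
  proof -
    have "\<And>x y. x \<in> g ` F \<gamma> \<Longrightarrow> y < x \<Longrightarrow> y \<in> g ` F \<gamma>" using down by (fastforce simp: F_def)
    \<comment> \<open>A finite downward closed set of natural numbers is cut off at its least
      missing element.\<close>
    then have "\<exists>m. g ` F \<gamma> = {..<m}"
    proof (intro exI[of _ "LEAST m. m \<notin> g ` F \<gamma>"] equalityI subsetI)
      fix x assume x: "x \<in> g ` F \<gamma>" and closed: "\<And>x y. x \<in> g ` F \<gamma> \<Longrightarrow> y < x \<Longrightarrow> y \<in> g ` F \<gamma>"
      have "\<exists>m. m \<notin> g ` F \<gamma>" using finF ex_new_if_finite[OF infinite_UNIV_nat, of "g ` F \<gamma>"] by blast
      then have "(LEAST m. m \<notin> g ` F \<gamma>) \<notin> g ` F \<gamma>" by (rule LeastI_ex)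
      then show "x \<in> {..<LEAST m. m \<notin> g ` F \<gamma>}" using closed x by (metis lessThan_iff linorder_neqE_nat)
    next
      fix x assume "x \<in> {..<LEAST m. m \<notin> g ` F \<gamma>}"
      then show "x \<in> g ` F \<gamma>" using not_less_Least by blast
    qed
    then show ?thesis using cards(2)[of \<gamma>] by (metis card_lessThan)
  qed
  have sum_f: "\<Sum>(f ` F \<gamma>) = sum f (F \<gamma>)" and sum_g: "\<Sum>(g ` F \<gamma>) = sum g (F \<gamma>)" for \<gamma>
    using f g by (simp_all add: sum.reindex F_def)
  have le: "sum g (F \<gamma>) \<le> sum f (F \<gamma>)" for \<gamma>
    using sum_nat_set_ge[of "f ` F \<gamma>"] finF[of \<gamma>] sum_f[of \<gamma>] sum_g[of \<gamma>]
    unfolding gF cards by simp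
  have "sum f (F \<gamma>) = sum g (F \<gamma>)" if "\<gamma> \<in> c ` L" for \<gamma>
  proof (rule ccontr)
    assume "sum f (F \<gamma>) \<noteq> sum g (F \<gamma>)"
    then have "sum g (F \<gamma>) < sum f (F \<gamma>)" using le[of \<gamma>] by simp
    then have "(\<Sum>\<gamma>\<in>c ` L. sum g (F \<gamma>)) < (\<Sum>\<gamma>\<in>c ` L. sum f (F \<gamma>))"
      using le that fin by (intro sum_strict_mono_ex1) auto
    moreover have "(\<Sum>\<gamma>\<in>c ` L. sum h (F \<gamma>)) = sum h L" for h :: "'a \<Rightarrow> nat"
      unfolding F_def using fin by (intro sum.image_gen[symmetric])
    ultimately show False using eq by simp
  qed
  then have "f ` F \<gamma> = g ` F \<gamma>"
  proof (cases "\<gamma> \<in> c ` L")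
    case True
    assume *: "\<And>\<gamma>. \<gamma> \<in> c ` L \<Longrightarrow> sum f (F \<gamma>) = sum g (F \<gamma>)"
    have "\<Sum>(f ` F \<gamma>) = \<Sum>(g ` F \<gamma>)"
      using *[OF True] by (simp only: sum_f sum_g)
    then show ?thesis using sum_nat_set_ge[of "f ` F \<gamma>"] finF[of \<gamma>] unfolding gF cards by simp
  next
    case False
    then have "F \<gamma> = {}" by (auto simp: F_def)
    then show ?thesis by simp
  qed
  then show ?thesis by (simp add: F_def)
qed

text \<open>Each letter is labelled by its tableau, \<open>True\<close> for the first, and its row;
  equality of pairs of tabloids becomes equality of labels.\<close>

definition tabloid_pair :: "nat \<Rightarrow> (nat \<Rightarrow> bool \<times> nat) \<Rightarrow> tabloid \<times> tabloid" where
  "tabloid_pair n f = (\<lambda>i. {a. a < n \<and> f a = (True, i)}, \<lambda>i. {a. a < n \<and> f a = (False, i)})"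

definition permute_pair :: "(nat \<Rightarrow> nat) \<Rightarrow> tabloid \<times> tabloid \<Rightarrow> tabloid \<times> tabloid" where
  "permute_pair \<sigma> = map_prod (permute_tabloid \<sigma>) (permute_tabloid \<sigma>)"

lemma tabloid_pair_eq_iff: "tabloid_pair n f = tabloid_pair n g \<longleftrightarrow> (\<forall>a<n. f a = g a)"
proof
  assume eq: "tabloid_pair n f = tabloid_pair n g"
  show "\<forall>a<n. f a = g a"
  proof (intro allI impI)
    fix a assume "a < n"
    obtain b i where fa: "f a = (b, i)" by (cases "f a")
    have "a \<in> (if b then fst (tabloid_pair n f) i else snd (tabloid_pair n f) i)"
      using \<open>a < n\<close> fa by (simp add: tabloid_pair_def)
    then show "f a = g a" unfolding eq using fa by (simp add: tabloid_pair_def split: if_splits)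
  qed
qed (auto simp: tabloid_pair_def fun_eq_iff)

lemma permute_pair_tabloid_pair:
  assumes "\<sigma> permutes {..<n}"
  shows "permute_pair \<sigma> (tabloid_pair n f) = tabloid_pair n (f \<circ> inv_into UNIV \<sigma>)"
proof -
  have "\<sigma> ` {a. a < n \<and> f a = x} = {a. a < n \<and> f (inv_into UNIV \<sigma> a) = x}" for x
  proof (intro equalityI subsetI)
    fix a assume a: "a \<in> {a. a < n \<and> f (inv_into UNIV \<sigma> a) = x}"
    have "a = \<sigma> (inv_into UNIV \<sigma> a)" using permutes_inverses(1)[OF assms] by simp
    moreover have "inv_into UNIV \<sigma> a < n" using permutes_in_image[OF permutes_inv[OF assms]] a by simp
    ultimately show "a \<in> \<sigma> ` {a. a < n \<and> f a = x}" using a by blast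
  qed (use permutes_in_image[OF assms] permutes_inverses(2)[OF assms] in auto)
  then show ?thesis by (simp add: permute_pair_def permute_tabloid_def tabloid_pair_def)
qed

lemma permute_pair_comp: "permute_pair \<sigma> (permute_pair \<tau> x) = permute_pair (\<sigma> \<circ> \<tau>) x"
  by (cases x) (simp add: permute_pair_def permute_tabloid_def image_comp)

lemma permute_pair_id [simp]: "permute_pair id x = x"
  by (cases x) (simp add: permute_pair_def permute_tabloid_def)

lemma inj_permute_pair: "bij \<sigma> \<Longrightarrow> inj (permute_pair \<sigma>)"
proof (rule injI)
  fix x y assume b: "bij \<sigma>" and "permute_pair \<sigma> x = permute_pair \<sigma> y"
  then have "permute_pair (inv_into UNIV \<sigma>) (permute_pair \<sigma> x) = permute_pair (inv_into UNIV \<sigma>) (permute_pair \<sigma> y)" by simp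
  then show "x = y" using b by (simp add: permute_pair_comp bij_is_inj)
qed

lemma permute_pair_inv: "bij \<sigma> \<Longrightarrow> permute_pair \<sigma> (permute_pair (inv_into UNIV \<sigma>) x) = x"
  using bij_is_surj[of \<sigma>, unfolded surj_iff] by (simp add: permute_pair_comp)

type_synonym cell = "bool \<times> nat \<times> nat"

text \<open>Rows and columns remember the tableau, so the stabilizers of the rows or columns of a
  pair of tableaux preserve its two blocks of letters.\<close>

definition row_of :: "cell \<Rightarrow> bool \<times> nat" where "row_of = (\<lambda>(b, i, j). (b, i))"
definition col_of :: "cell \<Rightarrow> bool \<times> nat" where "col_of = (\<lambda>(b, i, j). (b, j))"

lemma fst_row_col_of [simp]: "fst (row_of x) = fst x" "fst (col_of x) = fst x"
  by (simp_all add: row_of_def col_of_def case_prod_unfold)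

lemma row_col_of_pair [simp]: "col_of (b, x) = (b, snd x)" "row_of (b, x) = (b, fst x)"
  by (simp_all add: col_of_def row_of_def case_prod_unfold)

lemma cell_eqI: "row_of x = row_of y \<Longrightarrow> col_of x = col_of y \<Longrightarrow> x = y"
  by (cases x; cases y) (auto simp: row_of_def col_of_def)

definition cells :: "nat list \<Rightarrow> nat list \<Rightarrow> cell set" where
  "cells \<alpha> \<beta> = {True} \<times> diagram \<alpha> \<union> {False} \<times> diagram \<beta>"

text \<open>A pair of tableaux as the function sending a letter to its cell.\<close>

definition cell_map :: "nat \<Rightarrow> nat \<Rightarrow> nat list \<Rightarrow> nat list \<Rightarrow> (nat \<Rightarrow> cell) \<Rightarrow> bool" where
  "cell_map n k \<alpha> \<beta> f \<longleftrightarrow> bij_betw f {..<n} (cells \<alpha> \<beta>) \<and> (\<forall>a<n. fst (f a) \<longleftrightarrow> a < k)"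

definition bitableau_cell ::
    "nat \<Rightarrow> nat list \<Rightarrow> nat list \<Rightarrow> (nat \<times> nat \<Rightarrow> nat) \<Rightarrow> (nat \<times> nat \<Rightarrow> nat) \<Rightarrow> nat \<Rightarrow> cell" where
  "bitableau_cell k \<alpha> \<beta> t s a =
     (if a < k then (True, inv_into (diagram \<alpha>) t a) else (False, inv_into (diagram \<beta>) s a))"

lemma cell_map_bitableau_cell:
  assumes "k \<le> n" "tableau {..<k} \<alpha> t" "tableau {k..<n} \<beta> s"
  shows "cell_map n k \<alpha> \<beta> (bitableau_cell k \<alpha> \<beta> t s)"
proof -
  have 1: "bij_betw (inv_into (diagram \<alpha>) t) {..<k} (diagram \<alpha>)"
    and 2: "bij_betw (inv_into (diagram \<beta>) s) {k..<n} (diagram \<beta>)"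
    using assms by (auto simp: tableau_def bij_betw_inv_into)
  have "bij_betw (bitableau_cell k \<alpha> \<beta> t s) ({..<k} \<union> {k..<n}) ({True} \<times> diagram \<alpha> \<union> {False} \<times> diagram \<beta>)"
  proof (rule bij_betw_combine)
    show "bij_betw (bitableau_cell k \<alpha> \<beta> t s) {..<k} ({True} \<times> diagram \<alpha>)"
      using 1 by (auto simp: bij_betw_def inj_on_def bitableau_cell_def image_iff)
    show "bij_betw (bitableau_cell k \<alpha> \<beta> t s) {k..<n} ({False} \<times> diagram \<beta>)"
      using 2 by (auto simp: bij_betw_def inj_on_def bitableau_cell_def image_iff)
  qed auto
  moreover have "{..<k} \<union> {k..<n} = {..<n}" using assms(1) by auto
  ultimately show ?thesis by (simp add: cell_map_def cells_def bitableau_cell_def)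
qed

lemma cell_map_comp:
  assumes f: "cell_map n k \<alpha> \<beta> f" and \<sigma>: "\<sigma> \<in> block_perms k n"
  shows "cell_map n k \<alpha> \<beta> (f \<circ> \<sigma>)"
proof -
  have p: "\<sigma> permutes {..<n}" and b: "\<forall>a<n. \<sigma> a < k \<longleftrightarrow> a < k" using \<sigma> by (auto simp: label_stab_def)
  have "bij_betw (f \<circ> \<sigma>) {..<n} (cells \<alpha> \<beta>)"
    using bij_betw_trans[OF permutes_imp_bij[OF p], of f] f by (simp add: cell_map_def)
  then show ?thesis using f b permutes_in_image[OF p] by (auto simp: cell_map_def)
qed

lemma cell_map_transport:
  assumes f: "cell_map n k \<alpha> \<beta> f" and g: "cell_map n k \<alpha> \<beta> g"
  obtains \<sigma> where "\<sigma> \<in> block_perms k n" "\<And>a. a < n \<Longrightarrow> g (\<sigma> a) = f a"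
proof -
  define \<sigma> where "\<sigma> a = (if a < n then inv_into {..<n} g (f a) else a)" for a
  have "bij_betw (inv_into {..<n} g \<circ> f) {..<n} {..<n}"
    using f g by (meson bij_betw_inv_into bij_betw_trans cell_map_def)
  then have "bij_betw \<sigma> {..<n} {..<n}" by (rule bij_betw_cong[THEN iffD1, rotated]) (simp add: \<sigma>_def)
  then have p: "\<sigma> permutes {..<n}" by (intro bij_imp_permutes) (auto simp: \<sigma>_def)
  have eq: "g (\<sigma> a) = f a" if "a < n" for a
  proof -
    have "f a \<in> g ` {..<n}" using f g that by (auto simp: cell_map_def bij_betw_def)
    then show ?thesis using that by (simp add: \<sigma>_def f_inv_into_f)
  qed
  have "\<sigma> a < k \<longleftrightarrow> a < k" if "a < n" for a
    using eq[OF that] f g that permutes_in_image[OF p, of a] unfolding cell_map_def by (metis lessThan_iff)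
  then show ?thesis using that[of \<sigma>] p eq by (simp add: label_stab_def)
qed

lemma label_stab_col_block:
  assumes "cell_map n k \<alpha> \<beta> f"
  shows "label_stab n (col_of \<circ> f) \<subseteq> block_perms k n" "label_stab n (row_of \<circ> f) \<subseteq> block_perms k n"
proof -
  have fst: "fst (col_of x) = fst x" "fst (row_of x) = fst x" for x :: cell
    by (auto simp: col_of_def row_of_def split: prod.splits)
  have "\<sigma> a < k \<longleftrightarrow> a < k" if "\<sigma> permutes {..<n}" "a < n" "fst (f (\<sigma> a)) = fst (f a)" for \<sigma> a
    using that assms permutes_in_image[of \<sigma> "{..<n}" a] by (auto simp: cell_map_def)
  then show "label_stab n (col_of \<circ> f) \<subseteq> block_perms k n" "label_stab n (row_of \<circ> f) \<subseteq> block_perms k n"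
    by (auto simp: label_stab_def) (metis fst)+
qed

text \<open>A cell is determined by its row and its column, and each cell holds one letter.\<close>

lemma row_col_stab_id:
  assumes f: "cell_map n k \<alpha> \<beta> f" and "\<sigma> \<in> label_stab n (col_of \<circ> f)" "\<sigma> \<in> label_stab n (row_of \<circ> f)"
  shows "\<sigma> = id"
proof
  fix a
  have p: "\<sigma> permutes {..<n}" using assms by (simp add: label_stab_def)
  show "\<sigma> a = id a"
  proof (cases "a < n")
    case True
    have "f (\<sigma> a) = f a" using assms True
      by (intro cell_eqI) (auto simp: label_stab_def)
    then show ?thesis using f True permutes_in_image[OF p, of a] by (auto simp: cell_map_def bij_betw_def inj_on_def)
  qed (use permutes_not_in[OF p] in auto)
qed

text \<open>
  Along a column of \<open>f\<close> the rows under \<open>g\<close> are distinct, so their sum is least exactly when they are the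
  initial rows. As \<open>f\<close> and \<open>g\<close> have the same total sum of rows, this holds in every column.
\<close>

lemma column_sort_exists:
  assumes \<alpha>: "sorted_wrt (\<ge>) \<alpha>" and \<beta>: "sorted_wrt (\<ge>) \<beta>"
    and f: "cell_map n k \<alpha> \<beta> f" and g: "cell_map n k \<alpha> \<beta> g"
    and inj: "inj_on (\<lambda>a. (col_of (f a), row_of (g a))) {..<n}"
  obtains \<pi> where "\<pi> \<in> label_stab n (col_of \<circ> f)" "\<And>a. a < n \<Longrightarrow> row_of (g (\<pi> a)) = row_of (f a)"
proof -
  define ht :: "cell \<Rightarrow> nat" where "ht x = fst (snd x)" for x
  have bf: "bij_betw f {..<n} (cells \<alpha> \<beta>)" and bg: "bij_betw g {..<n} (cells \<alpha> \<beta>)"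
    and ff: "\<And>a. a < n \<Longrightarrow> fst (f a) \<longleftrightarrow> a < k" and fg: "\<And>a. a < n \<Longrightarrow> fst (g a) \<longleftrightarrow> a < k"
    using f g by (auto simp: cell_map_def)
  have row: "row_of x = (fst x, ht x)" and col: "fst (col_of x) = fst x" for x
    by (auto simp: row_of_def col_of_def ht_def split: prod.splits)
  have eqx: "x = y" if "col_of x = col_of y" "ht x = ht y" for x y
    using that by (auto simp: col_of_def ht_def split: prod.splits)
  have fst_fg: "fst (g a) = fst (f a)" if "a < n" for a using ff fg that by auto
  have part_sums: "(\<Sum>a<n. ht (h a)) = (\<Sum>x\<in>cells \<alpha> \<beta>. ht x)" if "bij_betw h {..<n} (cells \<alpha> \<beta>)" for h
    using that by (rule sum.reindex_bij_betw)
  \<comment> \<open>Weakly decreasing parts make every column of a diagram an initial segment of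
    rows, so \<open>f\<close> attains the least row sum in each column.\<close>
  have down: "(b, i', j) \<in> cells \<alpha> \<beta>" if "(b, i, j) \<in> cells \<alpha> \<beta>" "i' < i" for b i i' j
    using that \<alpha> \<beta> by (auto simp: cells_def diagram_def sorted_wrt_iff_nth_less intro: order_less_le_trans)
  have img: "(ht \<circ> g) ` {a \<in> {..<n}. (col_of \<circ> f) a = \<gamma>} = (ht \<circ> f) ` {a \<in> {..<n}. (col_of \<circ> f) a = \<gamma>}" for \<gamma>
  proof (rule image_eq_of_sum_eq)
    show "inj_on (ht \<circ> g) {a \<in> {..<n}. (col_of \<circ> f) a = \<gamma>}" for \<gamma>
    proof (rule inj_onI, clarsimp)
      fix x y assume xy: "ht (g x) = ht (g y)" "x < n" "y < n" "\<gamma> = col_of (f x)" "col_of (f y) = col_of (f x)"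
      have "fst (f x) = fst (f y)" using col[of "f x"] col[of "f y"] xy by simp
      then have "row_of (g x) = row_of (g y)" using xy fst_fg by (simp add: row)
      then show "x = y" using xy inj by (auto simp: inj_on_def)
    qed
    show "inj_on (ht \<circ> f) {a \<in> {..<n}. (col_of \<circ> f) a = \<gamma>}" for \<gamma>
    proof (rule inj_onI, clarsimp)
      fix x y assume xy: "ht (f x) = ht (f y)" "x < n" "y < n" "\<gamma> = col_of (f x)" "col_of (f y) = col_of (f x)"
      then have "f x = f y" using eqx by simp
      then show "x = y" using inj_onD[OF bij_betw_imp_inj_on[OF bf]] xy(2,3) by simp
    qed
    show "(\<Sum>a\<in>{..<n}. (ht \<circ> g) a) = (\<Sum>a\<in>{..<n}. (ht \<circ> f) a)" using part_sums[OF bf] part_sums[OF bg] by simp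
    show "\<exists>b\<in>{..<n}. (col_of \<circ> f) b = (col_of \<circ> f) a \<and> (ht \<circ> f) b = i" if a: "a \<in> {..<n}" "i < (ht \<circ> f) a" for a i
    proof -
      obtain b i0 j where fa: "f a = (b, i0, j)" by (metis prod.exhaust)
      have "f a \<in> cells \<alpha> \<beta>" using bf a by (auto simp: bij_betw_def)
      then have "(b, i, j) \<in> cells \<alpha> \<beta>" using down[of b i0 j i] a fa by (simp add: ht_def)
      then obtain a' where "a' < n" "f a' = (b, i, j)" using bf unfolding bij_betw_def by (metis imageE lessThan_iff)
      then show ?thesis using fa by (intro bexI[of _ a']) (auto simp: col_of_def ht_def)
    qed
  qed simp
  have ex: "\<exists>b<n. col_of (f b) = col_of (f a) \<and> row_of (g b) = row_of (f a)" if a: "a < n" for a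
  proof -
    have "ht (f a) \<in> (ht \<circ> f) ` {b \<in> {..<n}. (col_of \<circ> f) b = col_of (f a)}" using a by auto
    then have "ht (f a) \<in> (ht \<circ> g) ` {b \<in> {..<n}. (col_of \<circ> f) b = col_of (f a)}" by (simp only: img)
    then obtain b where b: "b < n" "col_of (f b) = col_of (f a)" "ht (g b) = ht (f a)" by auto
    then have "fst (g b) = fst (f a)" using fst_fg col[of "f b"] col[of "f a"] by simp
    then show ?thesis using b by (auto simp: row)
  qed
  \<comment> \<open>\<open>ex\<close> finds, in the column of \<open>a\<close> under
    \<open>f\<close>, a letter that \<open>g\<close> puts into the row of \<open>a\<close>. The
    choice is injective because the chosen letter recovers both the column and the row of
    \<open>a\<close>.\<close>
  define \<pi> where "\<pi> a = (if a < n then SOME b. b < n \<and> col_of (f b) = col_of (f a) \<and> row_of (g b) = row_of (f a) else a)" for a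
  have \<pi>: "\<pi> a < n" "col_of (f (\<pi> a)) = col_of (f a)" "row_of (g (\<pi> a)) = row_of (f a)" if "a < n" for a
    using someI_ex[OF ex[OF that]] that by (auto simp: \<pi>_def)
  have "inj_on \<pi> {..<n}"
  proof (rule inj_onI)
    fix x y assume "x \<in> {..<n}" "y \<in> {..<n}" "\<pi> x = \<pi> y"
    then have "x < n" "y < n" "col_of (f x) = col_of (f y)" "row_of (f x) = row_of (f y)"
      using \<pi>(2,3)[of x] \<pi>(2,3)[of y] by simp_all
    then have "f x = f y" using eqx by (simp add: row)
    then show "x = y" using inj_onD[OF bij_betw_imp_inj_on[OF bf]] \<open>x < n\<close> \<open>y < n\<close> by simp
  qed
  then have "bij_betw \<pi> {..<n} {..<n}"
    using \<pi>(1) endo_inj_surj[of "{..<n}" \<pi>] by (auto simp: bij_betw_def image_subset_iff)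
  then have "\<pi> permutes {..<n}" by (intro bij_imp_permutes) (auto simp: \<pi>_def)
  then show ?thesis using that[of \<pi>] \<pi> by (simp add: label_stab_def)
qed

section \<open>The block representation\<close>

lemma tableau_image_eq:
  assumes "tableau A \<alpha> t"
  shows "t ` {x \<in> diagram \<alpha>. P x} = {a \<in> A. P (inv_into (diagram \<alpha>) t a)}"
proof -
  have b: "inj_on t (diagram \<alpha>)" "t ` diagram \<alpha> = A" using assms by (auto simp: tableau_def bij_betw_def)
  show ?thesis
  proof (intro equalityI subsetI)
    fix a assume "a \<in> {a \<in> A. P (inv_into (diagram \<alpha>) t a)}"
    then show "a \<in> t ` {x \<in> diagram \<alpha>. P x}"
      using b by (intro image_eqI[of _ _ "inv_into (diagram \<alpha>) t a"]) (auto simp: f_inv_into_f inv_into_into)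
  qed (use b in auto)
qed

text \<open>A permutation mapping a finite column into itself maps it onto itself, so the setwise
  condition turns into one on the column label of each letter.\<close>

lemma column_stabilizer_eq:
  assumes "tableau A \<alpha> t" "finite A"
  shows "column_stabilizer A \<alpha> t =
    {\<pi>. \<pi> permutes A \<and> (\<forall>a\<in>A. snd (inv_into (diagram \<alpha>) t (\<pi> a)) = snd (inv_into (diagram \<alpha>) t a))}"
proof -
  let ?q = "\<lambda>a. snd (inv_into (diagram \<alpha>) t a)"
  have "(\<forall>j. \<pi> ` {a \<in> A. ?q a = j} = {a \<in> A. ?q a = j}) \<longleftrightarrow> (\<forall>a\<in>A. ?q (\<pi> a) = ?q a)" if p: "\<pi> permutes A" for \<pi>
  proof
    assume "\<forall>j. \<pi> ` {a \<in> A. ?q a = j} = {a \<in> A. ?q a = j}"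
    then show "\<forall>a\<in>A. ?q (\<pi> a) = ?q a" by blast
  next
    assume q: "\<forall>a\<in>A. ?q (\<pi> a) = ?q a"
    have "\<pi> ` {a \<in> A. ?q a = j} = {a \<in> A. ?q a = j}" for j
      using q permutes_in_image[OF p] permutes_inj_on[OF p] assms(2)
      by (intro endo_inj_surj) auto
    then show "\<forall>j. \<pi> ` {a \<in> A. ?q a = j} = {a \<in> A. ?q a = j}" by blast
  qed
  then show ?thesis unfolding column_stabilizer_def tableau_image_eq[OF assms(1)] by blast
qed

lemma linear_tensor: "linear (\<lambda>u. tensor u v)" "linear (\<lambda>v. tensor u v)"
proof -
  show "linear (\<lambda>u. tensor u v)" unfolding tensor_def by (rule linear_linear_extension)
  show "linear (\<lambda>v. tensor u v)" unfolding tensor_def linear_extension_def[of _ u]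
    by (intro linear_compose_sum ballI linear_compose_scale_right linear_linear_extension)
qed

lemma tensor_single:
  "tensor (single a x) (single b y) = single (a, b) (x * y)"
  by (simp add: tensor_def scaleR_single)

text \<open>Bilinearity. It makes the tensor product of two Specht modules the span of the tensors
  of polytabloids.\<close>

lemma span_tensor:
  "span {tensor u v | u v. u \<in> span A \<and> v \<in> span B} = span {tensor a b | a b. a \<in> A \<and> b \<in> B}"
proof -
  let ?X = "span {tensor a b | a b. a \<in> A \<and> b \<in> B}"
  have 1: "tensor a v \<in> ?X" if "a \<in> A" "v \<in> span B" for a v
  proof -
    have "tensor a v \<in> span (tensor a ` B)"
      using that(2) linear_span_image[OF linear_tensor(2)] by blast
    then show ?thesis using span_mono[of "tensor a ` B" "{tensor a b | a b. a \<in> A \<and> b \<in> B}"] that(1) by blast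
  qed
  have 2: "tensor u v \<in> ?X" if uv: "u \<in> span A" "v \<in> span B" for u v
  proof -
    have "tensor u v \<in> span ((\<lambda>u. tensor u v) ` A)"
      using uv(1) linear_span_image[OF linear_tensor(1)] by blast
    also have "\<dots> \<subseteq> ?X" using 1 uv(2) by (intro span_minimal) auto
    finally show ?thesis .
  qed
  show ?thesis
  proof
    show "span {tensor u v | u v. u \<in> span A \<and> v \<in> span B} \<subseteq> ?X"
      using 2 by (intro span_minimal) auto
    show "?X \<subseteq> span {tensor u v | u v. u \<in> span A \<and> v \<in> span B}"
      by (rule span_mono) (auto intro: span_base)
  qed
qed

definition bipolytabloid :: "nat \<Rightarrow> (nat \<Rightarrow> cell) \<Rightarrow> (tabloid \<times> tabloid) \<Rightarrow>\<^sub>0 real" where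
  "bipolytabloid n f = (\<Sum>\<sigma>\<in>label_stab n (col_of \<circ> f).
     single (permute_pair \<sigma> (tabloid_pair n (row_of \<circ> f))) (of_int (sign \<sigma>)))"

text \<open>The column stabilizer of the pair is the direct product of the two column stabilizers,
  and signs multiply along it.\<close>

lemma tensor_polytabloids:
  assumes kn: "k \<le> n" and t: "tableau {..<k} \<alpha> t" and s: "tableau {k..<n} \<beta> s"
  shows "tensor (polytabloid {..<k} \<alpha> t) (polytabloid {k..<n} \<beta> s) = bipolytabloid n (bitableau_cell k \<alpha> \<beta> t s)"
proof -
  let ?f = "bitableau_cell k \<alpha> \<beta> t s"
  let ?P = "column_stabilizer {..<k} \<alpha> t" and ?Q = "column_stabilizer {k..<n} \<beta> s"
  let ?T = "tabloid_of \<alpha> t" and ?S = "tabloid_of \<beta> s"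
  have P: "?P = {\<pi>. \<pi> permutes {..<k} \<and> (\<forall>a\<in>{..<k}. col_of (?f (\<pi> a)) = col_of (?f a))}"
    unfolding column_stabilizer_eq[OF t finite_lessThan]
  proof (intro Collect_cong conj_cong refl ball_cong)
    fix \<pi> a assume "\<pi> permutes {..<k}" "a \<in> {..<k}"
    then have "\<pi> a < k" "a < k" using permutes_in_image[of \<pi> "{..<k}" a] by simp_all
    then show "snd (inv_into (diagram \<alpha>) t (\<pi> a)) = snd (inv_into (diagram \<alpha>) t a) \<longleftrightarrow>
      col_of (?f (\<pi> a)) = col_of (?f a)" by (simp add: bitableau_cell_def)
  qed
  have Q: "?Q = {\<pi>. \<pi> permutes {k..<n} \<and> (\<forall>a\<in>{k..<n}. col_of (?f (\<pi> a)) = col_of (?f a))}"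
    unfolding column_stabilizer_eq[OF s finite_atLeastLessThan]
  proof (intro Collect_cong conj_cong refl ball_cong)
    fix \<pi> a assume "\<pi> permutes {k..<n}" "a \<in> {k..<n}"
    then have "\<not> \<pi> a < k" "\<not> a < k" using permutes_in_image[of \<pi> "{k..<n}" a] by simp_all
    then show "snd (inv_into (diagram \<beta>) s (\<pi> a)) = snd (inv_into (diagram \<beta>) s a) \<longleftrightarrow>
      col_of (?f (\<pi> a)) = col_of (?f a)" by (simp add: bitableau_cell_def)
  qed
  have tp: "tabloid_pair n (row_of \<circ> ?f) = (?T, ?S)"
    unfolding tabloid_pair_def tabloid_of_def tableau_image_eq[OF t] tableau_image_eq[OF s]
    using kn by (auto simp: fun_eq_iff bitableau_cell_def split: if_splits)
  have Tk: "?T i \<subseteq> {..<k}" and Sk: "?S i \<subseteq> {k..<n}" for i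
    using t s by (auto simp: tabloid_of_def tableau_def bij_betw_def)
  have fin: "finite ?P" "finite ?Q"
    unfolding P Q by (auto intro: finite_subset[OF _ finite_permutations])
  have perm: "permute_pair (\<pi> \<circ> \<rho>) (?T, ?S) = (permute_tabloid \<pi> ?T, permute_tabloid \<rho> ?S)"
    if pr: "\<pi> permutes {..<k}" "\<rho> permutes {k..<n}" for \<pi> \<rho>
  proof -
    have "(\<pi> \<circ> \<rho>) ` ?T i = \<pi> ` ?T i" for i
      using Tk[of i] permutes_not_in[OF pr(2)] by (intro image_cong) auto
    moreover have "(\<pi> \<circ> \<rho>) ` ?S i = \<rho> ` ?S i" for i
    proof (intro image_cong refl)
      fix a assume "a \<in> ?S i"
      then have "\<rho> a \<in> {k..<n}" using Sk[of i] permutes_in_image[OF pr(2)] by blast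
      then show "(\<pi> \<circ> \<rho>) a = \<rho> a" using permutes_not_in[OF pr(1)] by simp
    qed
    ultimately show ?thesis by (simp add: permute_pair_def permute_tabloid_def)
  qed
  have "tensor (polytabloid {..<k} \<alpha> t) (polytabloid {k..<n} \<beta> s) =
    (\<Sum>\<pi>\<in>?P. \<Sum>\<rho>\<in>?Q. single (permute_tabloid \<pi> ?T, permute_tabloid \<rho> ?S) (of_int (sign \<pi>) * of_int (sign \<rho>)))"
    unfolding polytabloid_def
    by (simp add: linear_sum[OF linear_tensor(1)] linear_sum[OF linear_tensor(2)] tensor_single) (rule sum.swap)
  also have "\<dots> = (\<Sum>(\<pi>, \<rho>)\<in>?P \<times> ?Q. single (permute_pair (\<pi> \<circ> \<rho>) (?T, ?S)) (of_int (sign (\<pi> \<circ> \<rho>))))"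
    unfolding sum.cartesian_product
  proof (intro sum.cong refl, clarify)
    fix \<pi> \<rho> assume "\<pi> \<in> ?P" "\<rho> \<in> ?Q"
    then have p: "\<pi> permutes {..<k}" "\<rho> permutes {k..<n}" by (auto simp: P Q)
    then have "permutation \<pi>" "permutation \<rho>" by (auto intro: permutes_imp_permutation[rotated])
    then have "sign (\<pi> \<circ> \<rho>) = sign \<pi> * sign \<rho>" by (rule sign_compose)
    then show "single (permute_tabloid \<pi> ?T, permute_tabloid \<rho> ?S) (of_int (sign \<pi>) * of_int (sign \<rho>)) =
      single (permute_pair (\<pi> \<circ> \<rho>) (?T, ?S)) (of_int (sign (\<pi> \<circ> \<rho>)) :: real)"
      using perm[OF p] by simp
  qed
  also have "\<dots> = (\<Sum>x\<in>?P \<times> ?Q. (\<lambda>\<sigma>. single (permute_pair \<sigma> (?T, ?S)) (of_int (sign \<sigma>))) (fst x \<circ> snd x))"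
    by (simp add: case_prod_beta)
  also have "\<dots> = (\<Sum>\<sigma>\<in>label_stab n (col_of \<circ> ?f). single (permute_pair \<sigma> (?T, ?S)) (of_int (sign \<sigma>)))"
  proof (rule sum.reindex_bij_betw)
    \<comment> \<open>The two restrictions of a permutation to the blocks, each extended by the
      identity.\<close>
    let ?l = "\<lambda>\<sigma> a. if a < k then \<sigma> a else a" and ?u = "\<lambda>\<sigma> a. if a < k then a else \<sigma> a"
    have stab: "\<sigma> permutes {..<n} \<and> (\<forall>a<n. \<sigma> a < k \<longleftrightarrow> a < k) \<and> (\<forall>a<n. col_of (?f (\<sigma> a)) = col_of (?f a))"
      if "\<sigma> \<in> label_stab n (col_of \<circ> ?f)" for \<sigma>
      using that label_stab_col_block(1)[OF cell_map_bitableau_cell[OF kn t s]] by (auto simp: label_stab_def)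
    have lu: "?l \<sigma> \<in> ?P" "?u \<sigma> \<in> ?Q" "?l \<sigma> \<circ> ?u \<sigma> = \<sigma>" if "\<sigma> \<in> label_stab n (col_of \<circ> ?f)" for \<sigma>
    proof -
      note st = stab[OF that]
      have inj: "inj \<sigma>" using st permutes_inj by blast
      have "?l \<sigma> ` {..<k} = {..<k}"
        using st kn by (intro endo_inj_surj) (auto simp: inj_on_def inj_eq[OF inj])
      then have "?l \<sigma> permutes {..<k}"
        by (intro bij_imp_permutes) (auto simp: bij_betw_def inj_on_def inj_eq[OF inj])
      then show "?l \<sigma> \<in> ?P" using st kn by (auto simp: P)
      have lt: "\<sigma> a < n" if "a < n" for a using st permutes_in_image[of \<sigma> "{..<n}" a] that by simp
      have "?u \<sigma> ` {k..<n} = {k..<n}"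
      proof (rule endo_inj_surj)
        show "?u \<sigma> ` {k..<n} \<subseteq> {k..<n}" using st lt by (auto simp: not_less[symmetric])
      qed (auto simp: inj_on_def inj_eq[OF inj])
      moreover have "\<sigma> x = x" if "x \<ge> n" for x using st permutes_not_in[of \<sigma> "{..<n}" x] that by simp
      ultimately have "?u \<sigma> permutes {k..<n}"
        by (intro bij_imp_permutes) (auto simp: bij_betw_def inj_on_def inj_eq[OF inj])
      then show "?u \<sigma> \<in> ?Q" using st by (auto simp: Q)
      show "?l \<sigma> \<circ> ?u \<sigma> = \<sigma>"
      proof
        fix a
        show "(?l \<sigma> \<circ> ?u \<sigma>) a = \<sigma> a"
        proof (cases "a < n")
          case True
          then show ?thesis using st by (auto simp: o_def)
        next
          case False
          then have "\<sigma> a = a" using st permutes_not_in[of \<sigma> "{..<n}" a] by simp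
          then show ?thesis by (auto simp: o_def)
        qed
      qed
    qed
    have comp: "\<pi> \<circ> \<rho> \<in> label_stab n (col_of \<circ> ?f) \<and> ?l (\<pi> \<circ> \<rho>) = \<pi> \<and> ?u (\<pi> \<circ> \<rho>) = \<rho>"
      if "\<pi> \<in> ?P" "\<rho> \<in> ?Q" for \<pi> \<rho>
    proof -
      have p: "\<pi> permutes {..<k}" "\<rho> permutes {k..<n}"
        and c: "\<forall>a<k. col_of (?f (\<pi> a)) = col_of (?f a)" "\<forall>a\<in>{k..<n}. col_of (?f (\<rho> a)) = col_of (?f a)"
        using that by (auto simp: P Q)
      have 1: "\<rho> a = a" if "a < k" for a using permutes_not_in[OF p(2)] that by simp
      have 2: "\<not> \<rho> a < k" if "\<not> a < k" for a
        using permutes_in_image[OF p(2), of a] permutes_not_in[OF p(2), of a] that by (cases "a < n") auto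
      have 3: "\<pi> a = a" if "\<not> a < k" for a using permutes_not_in[OF p(1)] that by simp
      have "\<pi> permutes {..<n}" "\<rho> permutes {..<n}" using p kn by (auto intro: permutes_subset)
      then have "\<pi> \<circ> \<rho> permutes {..<n}" by (rule permutes_compose[rotated])
      moreover have "col_of (?f ((\<pi> \<circ> \<rho>) a)) = col_of (?f a)" if "a < n" for a
        using 1 2 3 c that by (cases "a < k") auto
      ultimately show ?thesis using 1 2 3 by (auto simp: label_stab_def fun_eq_iff)
    qed
    show "bij_betw (\<lambda>x. fst x \<circ> snd x) (?P \<times> ?Q) (label_stab n (col_of \<circ> ?f))"
      by (rule bij_betw_byWitness[where f' = "\<lambda>\<sigma>. (?l \<sigma>, ?u \<sigma>)"]) (use lu comp in \<open>auto\<close>)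
  qed
  finally show ?thesis unfolding bipolytabloid_def tp .
qed

text \<open>The action of \<open>block_rep\<close> on all formal combinations of pairs of tabloids,
  so that single tabloids, which need not lie in the Specht modules, can be moved and
  symmetrized.\<close>

definition pair_rep :: "nat \<Rightarrow> nat \<Rightarrow> (signed_perm, (tabloid \<times> tabloid) \<Rightarrow>\<^sub>0 real) rep" where
  "pair_rep k n = \<lparr>rep_space = UNIV,
     rep_act = (\<lambda>g. linear_extension (\<lambda>x. single (permute_pair (fst g) x) (chi k n g)))\<rparr>"

lemma block_rep_act:
  assumes "sum_list \<alpha> = k" "sum_list \<alpha> + sum_list \<beta> = n"
  shows "rep_act (block_rep \<alpha> \<beta>) = rep_act (pair_rep k n)"
  using assms by (auto simp: block_rep_def pair_rep_def Let_def fun_eq_iff chi_def permute_pair_def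
      case_prod_unfold map_prod_def)

lemma linear_pair_act: "linear (rep_act (pair_rep k n) g)"
  by (simp add: pair_rep_def linear_linear_extension)

lemma lookup_pair_act:
  assumes "bij (fst g)"
  shows "lookup (rep_act (pair_rep k n) g v) (permute_pair (fst g) x) = chi k n g * lookup v x"
  unfolding pair_rep_def using lookup_monomial_map[OF inj_permute_pair[OF assms], of "\<lambda>_. chi k n g"] by simp

lemma pair_act_single:
  "rep_act (pair_rep k n) g (single x c) = single (permute_pair (fst g) x) (c * chi k n g)"
  by (simp add: pair_rep_def scaleR_single)

lemma pair_act_eqI:
  assumes "bij (fst g)" "\<And>x. lookup w (permute_pair (fst g) x) = chi k n g * lookup v x"
  shows "rep_act (pair_rep k n) g v = w"
proof (rule poly_mapping_eqI)
  fix x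
  show "lookup (rep_act (pair_rep k n) g v) x = lookup w x"
    using lookup_pair_act[OF assms(1)] assms(2) permute_pair_inv[OF assms(1)] by metis
qed

text \<open>Conjugation by \<sigma> carries the column stabilizer of \<open>f\<close> to that of
  \<open>g\<close> and preserves signs.\<close>

lemma bipolytabloid_transport:
  assumes \<sigma>: "\<sigma> permutes {..<n}" and eq: "\<And>a. a < n \<Longrightarrow> g (\<sigma> a) = f a"
  shows "rep_act (pair_rep k n) (\<sigma>, \<lambda>_. 1) (bipolytabloid n f) = bipolytabloid n g"
proof -
  note inv = permutes_inverses[OF \<sigma>]
  have lt: "inv_into UNIV \<sigma> a < n" if "a < n" for a
    using permutes_in_image[OF permutes_inv[OF \<sigma>], of a] that by simp
  have lt': "\<sigma> a < n" if "a < n" for a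
    using permutes_in_image[OF \<sigma>, of a] that by simp
  have eq': "f (inv_into UNIV \<sigma> a) = g a" if "a < n" for a
    using eq[OF lt[OF that]] inv by simp
  have tp: "tabloid_pair n (row_of \<circ> g) = permute_pair \<sigma> (tabloid_pair n (row_of \<circ> f))"
    unfolding permute_pair_tabloid_pair[OF \<sigma>] tabloid_pair_eq_iff using eq' by simp
  have ch: "chi k n (\<sigma>, \<lambda>_. 1) = 1" by (simp add: chi_def)
  have "bipolytabloid n g = (\<Sum>\<tau>\<in>label_stab n (col_of \<circ> f).
      single (permute_pair (\<sigma> \<circ> \<tau> \<circ> inv_into UNIV \<sigma>) (tabloid_pair n (row_of \<circ> g)))
        (of_int (sign (\<sigma> \<circ> \<tau> \<circ> inv_into UNIV \<sigma>))))"
    unfolding bipolytabloid_def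
  proof (rule sum.reindex_bij_betw[symmetric])
    show "bij_betw (\<lambda>\<tau>. \<sigma> \<circ> \<tau> \<circ> inv_into UNIV \<sigma>) (label_stab n (col_of \<circ> f)) (label_stab n (col_of \<circ> g))"
    proof (rule bij_betw_byWitness[where f' = "\<lambda>\<tau>. inv_into UNIV \<sigma> \<circ> \<tau> \<circ> \<sigma>"])
      show "(\<lambda>\<tau>. \<sigma> \<circ> \<tau> \<circ> inv_into UNIV \<sigma>) ` label_stab n (col_of \<circ> f) \<subseteq> label_stab n (col_of \<circ> g)"
      proof clarify
        fix \<tau> assume \<tau>: "\<tau> \<in> label_stab n (col_of \<circ> f)"
        then have p: "\<tau> permutes {..<n}" by (simp add: label_stab_def)
        have "col_of (g (\<sigma> (\<tau> (inv_into UNIV \<sigma> a)))) = col_of (g a)" if "a < n" for a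
        proof -
          have "\<tau> (inv_into UNIV \<sigma> a) < n" using permutes_in_image[OF p] lt[OF that] by simp
          then have "col_of (g (\<sigma> (\<tau> (inv_into UNIV \<sigma> a)))) = col_of (f (\<tau> (inv_into UNIV \<sigma> a)))" using eq by simp
          also have "\<dots> = col_of (f (inv_into UNIV \<sigma> a))" using \<tau> lt[OF that] by (simp add: label_stab_def)
          finally show ?thesis using eq'[OF that] by simp
        qed
        then show "\<sigma> \<circ> \<tau> \<circ> inv_into UNIV \<sigma> \<in> label_stab n (col_of \<circ> g)"
          using \<sigma> p by (auto simp: label_stab_def intro!: permutes_compose permutes_inv)
      qed
      show "(\<lambda>\<tau>. inv_into UNIV \<sigma> \<circ> \<tau> \<circ> \<sigma>) ` label_stab n (col_of \<circ> g) \<subseteq> label_stab n (col_of \<circ> f)"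
      proof clarify
        fix \<tau> assume \<tau>: "\<tau> \<in> label_stab n (col_of \<circ> g)"
        then have p: "\<tau> permutes {..<n}" by (simp add: label_stab_def)
        have "col_of (f (inv_into UNIV \<sigma> (\<tau> (\<sigma> a)))) = col_of (f a)" if "a < n" for a
        proof -
          have "\<tau> (\<sigma> a) < n" using permutes_in_image[OF p] lt'[OF that] by simp
          then have "col_of (f (inv_into UNIV \<sigma> (\<tau> (\<sigma> a)))) = col_of (g (\<tau> (\<sigma> a)))" using eq' by simp
          also have "\<dots> = col_of (g (\<sigma> a))" using \<tau> lt'[OF that] by (simp add: label_stab_def)
          finally show ?thesis using eq[OF that] by simp
        qed
        then show "inv_into UNIV \<sigma> \<circ> \<tau> \<circ> \<sigma> \<in> label_stab n (col_of \<circ> f)"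
          using \<sigma> p by (auto simp: label_stab_def intro!: permutes_compose permutes_inv)
      qed
    qed (auto simp: fun_eq_iff inv)
  qed
  also have "\<dots> = (\<Sum>\<tau>\<in>label_stab n (col_of \<circ> f).
      single (permute_pair \<sigma> (permute_pair \<tau> (tabloid_pair n (row_of \<circ> f)))) (of_int (sign \<tau>)))"
  proof (intro sum.cong refl)
    fix \<tau> assume "\<tau> \<in> label_stab n (col_of \<circ> f)"
    then have "permutation \<tau>" "permutation \<sigma>" "permutation (inv_into UNIV \<sigma>)"
      using \<sigma> permutes_inv[OF \<sigma>] by (auto simp: label_stab_def intro: permutes_imp_permutation[rotated])
    then have "sign (\<sigma> \<circ> \<tau> \<circ> inv_into UNIV \<sigma>) = sign \<tau>"
      by (simp add: sign_compose permutation_compose sign_inverse)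
    moreover have "(\<sigma> \<circ> \<tau> \<circ> inv_into UNIV \<sigma>) \<circ> \<sigma> = \<sigma> \<circ> \<tau>" by (auto simp: fun_eq_iff inv)
    ultimately show "single (permute_pair (\<sigma> \<circ> \<tau> \<circ> inv_into UNIV \<sigma>) (tabloid_pair n (row_of \<circ> g)))
        (of_int (sign (\<sigma> \<circ> \<tau> \<circ> inv_into UNIV \<sigma>))) =
      single (permute_pair \<sigma> (permute_pair \<tau> (tabloid_pair n (row_of \<circ> f)))) (of_int (sign \<tau>) :: real)"
      by (simp add: tp permute_pair_comp)
  qed
  also have "\<dots> = rep_act (pair_rep k n) (\<sigma>, \<lambda>_. 1) (bipolytabloid n f)"
    unfolding bipolytabloid_def by (simp add: linear_sum[OF linear_pair_act] pair_act_single ch)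
  finally show ?thesis by simp
qed

section \<open>The inducing module: one line under the column symmetrizer\<close>

locale bitableau = signed_family n N for n N +
  fixes k :: nat and \<alpha> \<beta> :: "nat list" and t s :: "nat \<times> nat \<Rightarrow> nat"
  assumes kn: "k \<le> n" and \<alpha>: "\<alpha> \<in> partitions k" and \<beta>: "\<beta> \<in> partitions (n - k)"
    and t: "tableau {..<k} \<alpha> t" and s: "tableau {k..<n} \<beta> s"
begin

definition cell :: "nat \<Rightarrow> cell" where "cell = bitableau_cell k \<alpha> \<beta> t s"
text \<open>Both stabilizers contain all sign changes in \<open>N\<close>, so each symmetrizer also
  projects, up to a factor, onto the vectors on which \<open>N\<close> acts through
  \<open>chi\<close>.\<close>

definition col_group :: "signed_perm set" where "col_group = label_stab n (col_of \<circ> cell) \<times> N"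
definition row_group :: "signed_perm set" where "row_group = label_stab n (row_of \<circ> cell) \<times> N"
definition block_G :: "signed_perm set" where "block_G = block_perms k n \<times> N"
definition base :: "(tabloid \<times> tabloid) \<Rightarrow>\<^sub>0 real" where
  "base = single (tabloid_pair n (row_of \<circ> cell)) 1"
text \<open>This is \<open>card N\<close> times the polytabloid of the pair. As a symmetrized vector
  it falls under the laws of \<open>gsum\<close> for sign characters.\<close>

definition poly0 :: "(tabloid \<times> tabloid) \<Rightarrow>\<^sub>0 real" where
  "poly0 = gsum (pair_rep k n) col_group (sgn_chi k n) base"

lemma part_sums: "sum_list \<alpha> = k" "sum_list \<alpha> + sum_list \<beta> = n"
  using \<alpha> \<beta> kn by (auto simp: partitions_def)

lemma cell_map_cell: "cell_map n k \<alpha> \<beta> cell"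
  unfolding cell_def by (rule cell_map_bitableau_cell[OF kn t s])

lemma stab_block: "label_stab n (col_of \<circ> cell) \<subseteq> block_perms k n" "label_stab n (row_of \<circ> cell) \<subseteq> block_perms k n"
  by (rule label_stab_col_block[OF cell_map_cell])+

lemma group_subsets: "col_group \<subseteq> block_G" "row_group \<subseteq> block_G" "block_G \<subseteq> full" "block_G \<subseteq> carrier \<Gamma>" "col_group \<subseteq> carrier \<Gamma>" "row_group \<subseteq> carrier \<Gamma>" "col_group \<subseteq> full" "row_group \<subseteq> full"
  using stab_block full_subset by (auto simp: col_group_def row_group_def block_G_def) (auto simp: label_stab_def)

lemma finite_subgroup_block_G: "finite_subgroup \<Gamma> block_G"
  unfolding block_G_def by (rule finite_subgroup_times[OF perm_subgroup_label_stab])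

lemma sign_character_col_group: "sign_character \<Gamma> col_group (sgn_chi k n)"
  unfolding col_group_def by (rule sign_character_sgn_chi[OF perm_subgroup_label_stab stab_block(1)])

lemma sign_character_row_group: "sign_character \<Gamma> row_group (chi k n)"
  unfolding row_group_def by (rule sign_character_chi[OF perm_subgroup_label_stab stab_block(2)])

lemma block_G_bij: "g \<in> block_G \<Longrightarrow> bij (fst g)" "g \<in> full \<Longrightarrow> bij (fst g)"
  by (auto simp: block_G_def label_stab_def intro: permutes_bij)

lemma chi_square: "g \<in> full \<Longrightarrow> chi k n g * chi k n g = 1"
  using chi_cases[of g k] by auto

lemma group_rep_pair: "group_rep \<Gamma> block_G (pair_rep k n)"
  unfolding group_rep_def
proof (intro conjI ballI)
  fix v
  show "rep_act (pair_rep k n) \<one>\<^bsub>\<Gamma>\<^esub> v = v"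
    unfolding one_hyperoctahedral by (rule pair_act_eqI) (simp_all add: chi_def)
next
  fix g h v assume g: "g \<in> block_G" and h: "h \<in> block_G"
  have "fst (g \<otimes>\<^bsub>\<Gamma>\<^esub> h) = fst g \<circ> fst h" by (cases g; cases h) (simp add: mult_hyperoctahedral)
  moreover have "chi k n (g \<otimes>\<^bsub>\<Gamma>\<^esub> h) = chi k n g * chi k n h"
    using h group_subsets(4) by (intro chi_mult) (auto simp: block_G_def)
  ultimately show "rep_act (pair_rep k n) (g \<otimes>\<^bsub>\<Gamma>\<^esub> h) v = rep_act (pair_rep k n) g (rep_act (pair_rep k n) h v)"
    using block_G_bij(1)[OF g] block_G_bij(1)[OF h]
    by (intro pair_act_eqI) (simp_all add: bij_comp permute_pair_comp[symmetric] lookup_pair_act)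
qed (auto simp: pair_rep_def linear_linear_extension subspace_UNIV)

lemma in_pair_space [simp]: "v \<in> rep_space (pair_rep k n)"
  by (simp add: pair_rep_def)

lemma poly0_eq: "poly0 = real (card N) *\<^sub>R bipolytabloid n cell"
proof -
  have "poly0 = (\<Sum>\<sigma>\<in>label_stab n (col_of \<circ> cell). \<Sum>\<epsilon>\<in>N. single
      (permute_pair \<sigma> (tabloid_pair n (row_of \<circ> cell))) (of_int (sign \<sigma>)))"
    unfolding poly0_def gsum_def col_group_def sum.cartesian_product
  proof (intro sum.cong refl, clarify)
    fix \<sigma> \<epsilon> assume "\<sigma> \<in> label_stab n (col_of \<circ> cell)" "\<epsilon> \<in> N"
    then have "chi k n (\<sigma>, \<epsilon>) * chi k n (\<sigma>, \<epsilon>) = 1"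
      by (intro chi_square) (auto simp: label_stab_def)
    then show "sgn_chi k n (\<sigma>, \<epsilon>) *\<^sub>R rep_act (pair_rep k n) (\<sigma>, \<epsilon>) base =
      single (permute_pair \<sigma> (tabloid_pair n (row_of \<circ> cell))) (of_int (sign \<sigma>))"
      by (simp add: base_def pair_act_single sgn_chi_def scaleR_single mult.assoc)
  qed
  also have "\<dots> = real (card N) *\<^sub>R bipolytabloid n cell"
    by (simp only: sum_constant_scaleR bipolytabloid_def scaleR_sum_right)
  finally show ?thesis .
qed

lemma rep_space_block:
  "rep_space (block_rep \<alpha> \<beta>) = span {bipolytabloid n (bitableau_cell k \<alpha> \<beta> t' s') | t' s'.
     tableau {..<k} \<alpha> t' \<and> tableau {k..<n} \<beta> s'}"
proof -
  have "rep_space (block_rep \<alpha> \<beta>) = span {tensor a b | a b.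
      a \<in> {polytabloid {..<k} \<alpha> t' | t'. tableau {..<k} \<alpha> t'} \<and> b \<in> {polytabloid {k..<n} \<beta> s' | s'. tableau {k..<n} \<beta> s'}}"
    using part_sums by (simp add: block_rep_def Let_def) (simp only: specht_space_def span_tensor mem_Collect_eq)
  also have "{tensor a b | a b. a \<in> {polytabloid {..<k} \<alpha> t' | t'. tableau {..<k} \<alpha> t'} \<and> b \<in> {polytabloid {k..<n} \<beta> s' | s'. tableau {k..<n} \<beta> s'}} =
     {bipolytabloid n (bitableau_cell k \<alpha> \<beta> t' s') | t' s'. tableau {..<k} \<alpha> t' \<and> tableau {k..<n} \<beta> s'}"
  proof (intro equalityI subsetI)
    fix x assume "x \<in> {bipolytabloid n (bitableau_cell k \<alpha> \<beta> t' s') | t' s'. tableau {..<k} \<alpha> t' \<and> tableau {k..<n} \<beta> s'}"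
    then obtain t' s' where ts: "tableau {..<k} \<alpha> t'" "tableau {k..<n} \<beta> s'"
      "x = bipolytabloid n (bitableau_cell k \<alpha> \<beta> t' s')" by blast
    then have "x = tensor (polytabloid {..<k} \<alpha> t') (polytabloid {k..<n} \<beta> s')"
      using tensor_polytabloids[OF kn] by simp
    then show "x \<in> {tensor a b | a b. a \<in> {polytabloid {..<k} \<alpha> t' | t'. tableau {..<k} \<alpha> t'} \<and>
        b \<in> {polytabloid {k..<n} \<beta> s' | s'. tableau {k..<n} \<beta> s'}}" using ts by blast
  qed (clarsimp simp: tensor_polytabloids[OF kn], blast)
  finally show ?thesis .
qed

lemma block_act: "rep_act (block_rep \<alpha> \<beta>) = rep_act (pair_rep k n)"
  by (rule block_rep_act[OF part_sums])

lemma gsum_block: "gsum (block_rep \<alpha> \<beta>) = gsum (pair_rep k n)"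
  by (simp add: gsum_def block_act fun_eq_iff)

lemma poly0_in_block: "poly0 \<in> rep_space (block_rep \<alpha> \<beta>)"
  unfolding poly0_eq rep_space_block cell_def using t s by (intro span_scale span_base) blast

text \<open>Any two pairs of tableaux of the given shape differ by a block permutation, and it
  carries one polytabloid to the other.\<close>

lemma block_space_generated: "rep_space (block_rep \<alpha> \<beta>) \<subseteq> span {rep_act (pair_rep k n) g poly0 | g. g \<in> block_G}"
  unfolding rep_space_block
proof (rule span_minimal, clarify)
  fix t' s' assume t': "tableau {..<k} \<alpha> t'" and s': "tableau {k..<n} \<beta> s'"
  obtain \<sigma> where \<sigma>: "\<sigma> \<in> block_perms k n" "\<And>a. a < n \<Longrightarrow> bitableau_cell k \<alpha> \<beta> t' s' (\<sigma> a) = cell a"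
    using cell_map_transport[OF cell_map_cell cell_map_bitableau_cell[OF kn t' s']] by blast
  have "rep_act (pair_rep k n) (\<sigma>, \<lambda>_. 1) (bipolytabloid n cell) = bipolytabloid n (bitableau_cell k \<alpha> \<beta> t' s')"
    using \<sigma> by (intro bipolytabloid_transport) (auto simp: label_stab_def)
  then have "bipolytabloid n (bitableau_cell k \<alpha> \<beta> t' s') = (1 / card N) *\<^sub>R rep_act (pair_rep k n) (\<sigma>, \<lambda>_. 1) poly0"
    using card_N by (simp add: poly0_eq linear_cmul[OF linear_pair_act])
  moreover have "(\<sigma>, \<lambda>_. 1) \<in> block_G" using \<sigma> N_one by (simp add: block_G_def)
  ultimately show "bipolytabloid n (bitableau_cell k \<alpha> \<beta> t' s') \<in> span {rep_act (pair_rep k n) g poly0 | g. g \<in> block_G}"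
    by (metis (mono_tags, lifting) mem_Collect_eq span_base span_scale)
qed (rule subspace_span)

lemma base_transport:
  assumes \<sigma>: "\<sigma> permutes {..<n}" and "\<And>a. a < n \<Longrightarrow> row_of (g (\<sigma> a)) = row_of (f a)"
  shows "permute_pair \<sigma> (tabloid_pair n (row_of \<circ> f)) = tabloid_pair n (row_of \<circ> g)"
  unfolding permute_pair_tabloid_pair[OF \<sigma>] tabloid_pair_eq_iff
  using assms(2) permutes_in_image[OF permutes_inv[OF \<sigma>]] permutes_inverses(1)[OF \<sigma>]
  by (metis comp_apply lessThan_iff)

text \<open>If two letters share a column of the fixed pair and a row of \<open>g\<close>, their
  transposition fixes the tabloids but has sign -1, so the signed sum vanishes. Otherwise sorting
  the columns shows that the tabloids arise from the base pair by a column permutation, which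
  changes the sum by a sign only.\<close>

lemma gsum_tabloid_in_line:
  assumes g: "cell_map n k \<alpha> \<beta> g"
  shows "gsum (pair_rep k n) col_group (sgn_chi k n) (single (tabloid_pair n (row_of \<circ> g)) 1) \<in> span {poly0}"
proof (cases "inj_on (\<lambda>a. (col_of (cell a), row_of (g a))) {..<n}")
  case True
  have "sorted_wrt (\<ge>) \<alpha>" "sorted_wrt (\<ge>) \<beta>" using \<alpha> \<beta> by (auto simp: partitions_def)
  then obtain \<pi> where \<pi>: "\<pi> \<in> label_stab n (col_of \<circ> cell)" "\<And>a. a < n \<Longrightarrow> row_of (g (\<pi> a)) = row_of (cell a)"
    using column_sort_exists[OF _ _ cell_map_cell g True] by metis
  have p: "\<pi> permutes {..<n}" using \<pi>(1) by (simp add: label_stab_def)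
  have C: "(\<pi>, \<lambda>_. 1) \<in> col_group" using \<pi>(1) N_one by (simp add: col_group_def)
  have "single (tabloid_pair n (row_of \<circ> g)) 1 = rep_act (pair_rep k n) (\<pi>, \<lambda>_. 1) base"
    using base_transport[OF p, of g cell] \<pi>(2) by (simp add: base_def pair_act_single chi_def)
  then have "gsum (pair_rep k n) col_group (sgn_chi k n) (single (tabloid_pair n (row_of \<circ> g)) 1) =
      sgn_chi k n (\<pi>, \<lambda>_. 1) *\<^sub>R poly0"
    using gsum_act[OF group_rep_pair sign_character_col_group group_subsets(1) C, of base] by (simp add: poly0_def)
  then show ?thesis by (auto simp: span_singleton)
next
  case False
  then obtain a b where ab: "a < n" "b < n" "a \<noteq> b" "col_of (cell a) = col_of (cell b)" "row_of (g a) = row_of (g b)"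
    by (auto simp: inj_on_def)
  define \<tau> where "\<tau> = Transposition.transpose a b"
  have p: "\<tau> permutes {..<n}" unfolding \<tau>_def using ab by (intro permutes_swap_id) auto
  have "\<tau> \<in> label_stab n (col_of \<circ> cell)"
    using p ab(4) by (auto simp: label_stab_def \<tau>_def Transposition.transpose_def)
  then have C: "(\<tau>, \<lambda>_. 1) \<in> col_group" using N_one by (simp add: col_group_def)
  let ?b = "single (tabloid_pair n (row_of \<circ> g)) (1::real)"
  have "rep_act (pair_rep k n) (\<tau>, \<lambda>_. 1) ?b = ?b"
    using base_transport[OF p, of g g] ab(5) by (simp add: pair_act_single chi_def \<tau>_def Transposition.transpose_def)
  then have "gsum (pair_rep k n) col_group (sgn_chi k n) ?b = sgn_chi k n (\<tau>, \<lambda>_. 1) *\<^sub>R gsum (pair_rep k n) col_group (sgn_chi k n) ?b"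
    using gsum_act[OF group_rep_pair sign_character_col_group group_subsets(1) C, of ?b] by simp
  moreover have "sgn_chi k n (\<tau>, \<lambda>_. 1) = -1" using ab(3) by (simp add: sgn_chi_def chi_def \<tau>_def sign_swap_id)
  ultimately have "gsum (pair_rep k n) col_group (sgn_chi k n) ?b = - gsum (pair_rep k n) col_group (sgn_chi k n) ?b" by simp
  then have "gsum (pair_rep k n) col_group (sgn_chi k n) ?b = 0"
    by (metis (no_types) add_eq_0_iff2 real_vector.scale_eq_0_iff scaleR_2 zero_neq_numeral)
  then show ?thesis by (simp add: span_zero)
qed

lemma linear_gsum_pair: "linear (gsum (pair_rep k n) A c)"
  by (intro linear_gsum linear_pair_act)

lemma gsum_block_in_line:
  assumes "v \<in> rep_space (block_rep \<alpha> \<beta>)"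
  shows "gsum (pair_rep k n) col_group (sgn_chi k n) v \<in> span {poly0}"
proof -
  let ?K = "gsum (pair_rep k n) col_group (sgn_chi k n)"
  have "bipolytabloid n (bitableau_cell k \<alpha> \<beta> t' s') \<in> {v. ?K v \<in> span {poly0}}"
    if t': "tableau {..<k} \<alpha> t'" and s': "tableau {k..<n} \<beta> s'" for t' s'
  proof -
    let ?f = "bitableau_cell k \<alpha> \<beta> t' s'"
    have f: "cell_map n k \<alpha> \<beta> ?f" by (rule cell_map_bitableau_cell[OF kn t' s'])
    have "?K (single (permute_pair \<sigma> (tabloid_pair n (row_of \<circ> ?f))) (of_int (sign \<sigma>))) \<in> span {poly0}"
      if \<sigma>: "\<sigma> \<in> label_stab n (col_of \<circ> ?f)" for \<sigma>
    proof -
      have \<sigma>b: "\<sigma> \<in> block_perms k n" using \<sigma> label_stab_col_block(1)[OF f] by blast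
      have p: "\<sigma> permutes {..<n}" using \<sigma> by (simp add: label_stab_def)
      have ib: "inv_into UNIV \<sigma> \<in> block_perms k n"
        using \<sigma>b perm_subgroup_label_stab[of n "\<lambda>a. a < k"] by (simp add: perm_subgroup_def)
      have "single (permute_pair \<sigma> (tabloid_pair n (row_of \<circ> ?f))) (of_int (sign \<sigma>)) =
          of_int (sign \<sigma>) *\<^sub>R single (tabloid_pair n (row_of \<circ> (?f \<circ> inv_into UNIV \<sigma>))) (1::real)"
        by (simp add: permute_pair_tabloid_pair[OF p] scaleR_single o_assoc)
      then show ?thesis
        using gsum_tabloid_in_line[OF cell_map_comp[OF f ib]]
        by (simp add: linear_cmul[OF linear_gsum_pair] span_scale)
    qed
    then show ?thesis unfolding bipolytabloid_def by (simp add: linear_sum[OF linear_gsum_pair] span_sum)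
  qed
  moreover have "subspace {v. ?K v \<in> span {poly0}}"
    by (rule linear_subspace_vimage[OF linear_gsum_pair subspace_span, unfolded vimage_def])
  ultimately have "rep_space (block_rep \<alpha> \<beta>) \<subseteq> {v. ?K v \<in> span {poly0}}"
    unfolding rep_space_block by (intro span_minimal) auto
  then show ?thesis using assms by blast
qed

lemma gsum_poly0: "gsum (pair_rep k n) col_group (sgn_chi k n) poly0 = real (card col_group) *\<^sub>R poly0"
  unfolding poly0_def by (rule gsum_gsum[OF group_rep_pair sign_character_col_group group_subsets(1)]) simp

lemma card_col_group: "card col_group > 0"
  by (rule card_sign_character[OF group_rep_pair sign_character_col_group group_subsets(1)])

text \<open>A column permutation fixing the base pair of tabloids preserves the rows too, hence is
  the identity; so only the identity contributes, once for each sign vector.\<close>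

lemma lookup_poly0: "lookup poly0 (tabloid_pair n (row_of \<circ> cell)) = card N"
proof -
  let ?b = "tabloid_pair n (row_of \<circ> cell)"
  let ?C = "label_stab n (col_of \<circ> cell)"
  have fin: "finite ?C" by (rule perm_subgroup_finite[OF perm_subgroup_label_stab])
  have id: "id \<in> ?C" using perm_subgroup_label_stab[of n "col_of \<circ> cell"] by (simp add: perm_subgroup_def)
  have "permute_pair \<sigma> ?b = ?b \<longleftrightarrow> \<sigma> = id" if \<sigma>: "\<sigma> \<in> ?C" for \<sigma>
  proof
    assume eq: "permute_pair \<sigma> ?b = ?b"
    have p: "\<sigma> permutes {..<n}" using \<sigma> by (simp add: label_stab_def)
    have "row_of (cell (inv_into UNIV \<sigma> a)) = row_of (cell a)" if "a < n" for a
      using eq that unfolding permute_pair_tabloid_pair[OF p] tabloid_pair_eq_iff by simp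
    then have "row_of (cell (\<sigma> a)) = row_of (cell a)" if "a < n" for a
      using that permutes_in_image[OF p] permutes_inverses(2)[OF p] by (metis lessThan_iff)
    then have "\<sigma> \<in> label_stab n (row_of \<circ> cell)" using p by (simp add: label_stab_def)
    then show "\<sigma> = id" using row_col_stab_id[OF cell_map_cell \<sigma>] by simp
  qed simp
  then have "lookup (bipolytabloid n cell) ?b = (\<Sum>\<sigma>\<in>?C. if \<sigma> = id then 1 else 0)"
    unfolding bipolytabloid_def lookup_sum by (intro sum.cong refl) (auto simp: lookup_single when_def)
  also have "\<dots> = 1" using fin id by simp
  finally show ?thesis by (simp add: poly0_eq)
qed

lemma row_group_fixes_base:
  assumes "g \<in> block_G"
  shows "permute_pair (fst g) (tabloid_pair n (row_of \<circ> cell)) = tabloid_pair n (row_of \<circ> cell) \<longleftrightarrow> g \<in> row_group"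
proof
  have p: "fst g permutes {..<n}" using assms by (auto simp: block_G_def label_stab_def)
  assume eq: "permute_pair (fst g) (tabloid_pair n (row_of \<circ> cell)) = tabloid_pair n (row_of \<circ> cell)"
  have "row_of (cell (inv_into UNIV (fst g) a)) = row_of (cell a)" if "a < n" for a
    using eq that unfolding permute_pair_tabloid_pair[OF p] tabloid_pair_eq_iff by simp
  then have "row_of (cell (fst g a)) = row_of (cell a)" if "a < n" for a
    using that permutes_in_image[OF p] permutes_inverses(2)[OF p] by (metis lessThan_iff)
  then show "g \<in> row_group" using p assms by (auto simp: row_group_def block_G_def label_stab_def)
next
  assume "g \<in> row_group"
  then show "permute_pair (fst g) (tabloid_pair n (row_of \<circ> cell)) = tabloid_pair n (row_of \<circ> cell)"
    by (intro base_transport) (auto simp: row_group_def label_stab_def)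
qed

text \<open>At the base pair of tabloids nothing cancels: every element of \<open>row_group\<close>
  fixes this pair and the two factors \<open>chi\<close> square to 1, so each summand has
  coefficient \<open>card N\<close>.\<close>

lemma gsum_row_group_poly0: "gsum (pair_rep k n) row_group (chi k n) poly0 \<noteq> 0"
proof
  let ?b = "tabloid_pair n (row_of \<circ> cell)"
  assume "gsum (pair_rep k n) row_group (chi k n) poly0 = 0"
  then have "0 = lookup (gsum (pair_rep k n) row_group (chi k n) poly0) ?b" by simp
  also have "\<dots> = (\<Sum>g\<in>row_group. chi k n g * lookup (rep_act (pair_rep k n) g poly0) ?b)"
    by (simp add: gsum_def lookup_sum)
  also have "\<dots> = (\<Sum>g\<in>row_group. real (card N))"
  proof (intro sum.cong refl)
    fix g assume g: "g \<in> row_group"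
    then have gb: "g \<in> block_G" using group_subsets by blast
    have "lookup (rep_act (pair_rep k n) g poly0) ?b = chi k n g * lookup poly0 ?b"
      using lookup_pair_act[OF block_G_bij(1)[OF gb], of k n poly0 ?b] row_group_fixes_base[OF gb] g by simp
    moreover have "chi k n g * chi k n g = 1" using gb group_subsets by (intro chi_square) auto
    ultimately show "chi k n g * lookup (rep_act (pair_rep k n) g poly0) ?b = real (card N)"
      by (simp add: lookup_poly0 mult.assoc[symmetric])
  qed
  also have "\<dots> = real (card row_group) * real (card N)" by simp
  finally show False
    using card_N card_sign_character[OF group_rep_pair sign_character_row_group group_subsets(2)] by simp
qed

text \<open>
  The pairs of tabloids form a monomial representation, induced from the character of the row stabilizer,
  so a vector \<open>u\<close> of \<open>R\<close> yields a map sending the base pair to the symmetrization of \<open>u\<close>.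
\<close>

lemma ex_equivariant_pair_rep:
  fixes R :: "(signed_perm, 'v::real_vector) rep"
  assumes R: "group_rep \<Gamma> block_G R" and u: "u \<in> rep_space R"
  shows "\<exists>f. equivariant block_G (pair_rep k n) R f \<and>
    f poly0 = gsum R col_group (sgn_chi k n) (gsum R row_group (chi k n) u)"
proof -
  interpret B: finite_subgroup \<Gamma> block_G by (rule finite_subgroup_block_G)
  let ?b = "tabloid_pair n (row_of \<circ> cell)"
  note Rd = group_repD[OF R]
  \<comment> \<open>The coefficient of \<open>v\<close> at a translate of the base pair weights the
    corresponding translate of \<open>u\<close>. Summing over the group instead of cosets makes
    \<open>f base\<close> the full sum over \<open>row_group\<close>.\<close>
  define f where "f v = (\<Sum>g\<in>block_G. (chi k n g * lookup v (permute_pair (fst g) ?b)) *\<^sub>R rep_act R g u)" for v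
  have lf: "linear f"
    by (rule linearI) (simp_all add: f_def lookup_add algebra_simps scaleR_add_left sum.distrib scaleR_sum_right)
  have fR: "f v \<in> rep_space R" for v
    unfolding f_def using Rd u by (intro subspace_sum subspace_scale) auto
  have eq: "f (rep_act (pair_rep k n) h v) = rep_act R h (f v)" if h: "h \<in> block_G" for h v
  proof -
    have "f (rep_act (pair_rep k n) h v) = (\<Sum>g\<in>block_G. (chi k n (h \<otimes>\<^bsub>\<Gamma>\<^esub> g) *
        lookup (rep_act (pair_rep k n) h v) (permute_pair (fst (h \<otimes>\<^bsub>\<Gamma>\<^esub> g)) ?b)) *\<^sub>R rep_act R (h \<otimes>\<^bsub>\<Gamma>\<^esub> g) u)"
      unfolding f_def by (rule B.sum_mult_left[OF h, symmetric])
    also have "\<dots> = (\<Sum>g\<in>block_G. (chi k n g * lookup v (permute_pair (fst g) ?b)) *\<^sub>R rep_act R h (rep_act R g u))"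
    proof (intro sum.cong refl)
      fix g assume g: "g \<in> block_G"
      have 1: "fst (h \<otimes>\<^bsub>\<Gamma>\<^esub> g) = fst h \<circ> fst g" by (cases g; cases h) (simp add: mult_hyperoctahedral)
      have 2: "chi k n (h \<otimes>\<^bsub>\<Gamma>\<^esub> g) = chi k n h * chi k n g"
        using g group_subsets(4) by (intro chi_mult) (auto simp: block_G_def)
      have 3: "chi k n h * chi k n h = 1" using h group_subsets by (intro chi_square) auto
      have "chi k n (h \<otimes>\<^bsub>\<Gamma>\<^esub> g) * lookup (rep_act (pair_rep k n) h v) (permute_pair (fst (h \<otimes>\<^bsub>\<Gamma>\<^esub> g)) ?b) =
          (chi k n h * chi k n h) * (chi k n g * lookup v (permute_pair (fst g) ?b))"
        by (simp add: 1 2 permute_pair_comp[symmetric] lookup_pair_act[OF block_G_bij(1)[OF h]])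
      then show "(chi k n (h \<otimes>\<^bsub>\<Gamma>\<^esub> g) * lookup (rep_act (pair_rep k n) h v) (permute_pair (fst (h \<otimes>\<^bsub>\<Gamma>\<^esub> g)) ?b)) *\<^sub>R rep_act R (h \<otimes>\<^bsub>\<Gamma>\<^esub> g) u =
          (chi k n g * lookup v (permute_pair (fst g) ?b)) *\<^sub>R rep_act R h (rep_act R g u)"
        using 3 Rd(5)[OF h g u] by simp
    qed
    also have "\<dots> = rep_act R h (f v)"
      unfolding f_def by (simp add: linear_sum[OF Rd(2)[OF h]] linear_cmul[OF Rd(2)[OF h]])
    finally show ?thesis .
  qed
  have eqv: "equivariant block_G (pair_rep k n) R f" using lf fR eq by (auto simp: equivariant_def)
  have "f base = (\<Sum>g\<in>block_G. if g \<in> row_group then chi k n g *\<^sub>R rep_act R g u else 0)"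
    unfolding f_def base_def
    by (intro sum.cong refl) (auto simp: lookup_single when_def dest: row_group_fixes_base)
  also have "\<dots> = gsum R row_group (chi k n) u"
    unfolding gsum_def using group_subsets(2) B.finite_G by (simp add: sum.inter_restrict[symmetric] Int_absorb1)
  finally have "f poly0 = gsum R col_group (sgn_chi k n) (gsum R row_group (chi k n) u)"
    unfolding poly0_def using gsum_equivariant[OF eqv group_subsets(1)] by simp
  then show ?thesis using eqv by blast
qed

text \<open>An element with permutation \<sigma> carries the polytabloid of a pair of tableaux, up
  to sign, to that of the pair with letters renamed by \<sigma>.\<close>

lemma group_rep_block: "group_rep \<Gamma> block_G (block_rep \<alpha> \<beta>)"
proof -
  interpret B: finite_subgroup \<Gamma> block_G by (rule finite_subgroup_block_G)
  have "submodule block_G (pair_rep k n) (rep_space (block_rep \<alpha> \<beta>))"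
    unfolding submodule_def
  proof (intro conjI ballI)
    fix g v assume g: "g \<in> block_G" and v: "v \<in> rep_space (block_rep \<alpha> \<beta>)"
    have sub: "subspace (rep_space (block_rep \<alpha> \<beta>))" by (simp add: rep_space_block)
    have "rep_act (pair_rep k n) g (bipolytabloid n (bitableau_cell k \<alpha> \<beta> t' s')) \<in> rep_space (block_rep \<alpha> \<beta>)"
      if t': "tableau {..<k} \<alpha> t'" and s': "tableau {k..<n} \<beta> s'" for t' s'
    proof -
      obtain \<sigma> \<epsilon> where ge: "g = (\<sigma>, \<epsilon>)" by (cases g)
      have b: "\<sigma> \<in> block_perms k n" and p: "\<sigma> permutes {..<n}" using g by (auto simp: block_G_def label_stab_def ge)
      have 1: "rep_act (pair_rep k n) g v = chi k n g *\<^sub>R rep_act (pair_rep k n) (\<sigma>, \<lambda>_. 1) v" for v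
        using permutes_bij[OF p] by (intro pair_act_eqI) (auto simp: ge chi_def lookup_pair_act[where g = "(\<sigma>, \<lambda>_. 1)", simplified])
      have lt: "\<sigma> a < n" if "a < n" for a using permutes_in_image[OF p, of a] that by simp
      have bt: "bij_betw \<sigma> {..<k} {..<k}" "bij_betw \<sigma> {k..<n} {k..<n}"
      proof -
        have "\<sigma> ` {..<k} = {..<k}"
          using b kn permutes_inj_on[OF p] by (intro endo_inj_surj) (auto simp: label_stab_def)
        then show "bij_betw \<sigma> {..<k} {..<k}" using permutes_inj_on[OF p] by (auto simp: bij_betw_def)
        show "bij_betw \<sigma> {k..<n} {k..<n}" using block_perms_image[OF b] permutes_inj_on[OF p] by (auto simp: bij_betw_def)
      qed
      have tabs: "tableau {..<k} \<alpha> (\<sigma> \<circ> t')" "tableau {k..<n} \<beta> (\<sigma> \<circ> s')"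
        using t' s' bt unfolding tableau_def by (auto intro: bij_betw_trans)
      have "bitableau_cell k \<alpha> \<beta> (\<sigma> \<circ> t') (\<sigma> \<circ> s') (\<sigma> a) = bitableau_cell k \<alpha> \<beta> t' s' a" if a: "a < n" for a
      proof -
        have ab: "\<sigma> a < k \<longleftrightarrow> a < k" using b a by (simp add: label_stab_def)
        show ?thesis
        proof (cases "a < k")
          case True
          then have "a \<in> t' ` diagram \<alpha>" using t' by (simp add: tableau_def bij_betw_def)
          then obtain x where x: "x \<in> diagram \<alpha>" "t' x = a" by auto
          have "inv_into (diagram \<alpha>) t' a = x"
            using t' x by (auto simp: tableau_def bij_betw_def)
          moreover have "inv_into (diagram \<alpha>) (\<sigma> \<circ> t') (\<sigma> a) = x"
            using tabs(1) x inv_into_f_eq[of "\<sigma> \<circ> t'" "diagram \<alpha>" x "\<sigma> a"] by (simp add: tableau_def bij_betw_def)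
          ultimately show ?thesis using True ab by (simp add: bitableau_cell_def)
        next
          case False
          then have "a \<in> s' ` diagram \<beta>" using a s' by (simp add: tableau_def bij_betw_def)
          then obtain x where x: "x \<in> diagram \<beta>" "s' x = a" by auto
          have "inv_into (diagram \<beta>) s' a = x"
            using s' x by (auto simp: tableau_def bij_betw_def)
          moreover have "inv_into (diagram \<beta>) (\<sigma> \<circ> s') (\<sigma> a) = x"
            using tabs(2) x inv_into_f_eq[of "\<sigma> \<circ> s'" "diagram \<beta>" x "\<sigma> a"] by (simp add: tableau_def bij_betw_def)
          ultimately show ?thesis using False ab by (simp add: bitableau_cell_def)
        qed
      qed
      then have "rep_act (pair_rep k n) (\<sigma>, \<lambda>_. 1) (bipolytabloid n (bitableau_cell k \<alpha> \<beta> t' s')) =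
          bipolytabloid n (bitableau_cell k \<alpha> \<beta> (\<sigma> \<circ> t') (\<sigma> \<circ> s'))"
        by (rule bipolytabloid_transport[OF p])
      also have "\<dots> \<in> rep_space (block_rep \<alpha> \<beta>)" unfolding rep_space_block using tabs by (intro span_base) blast
      finally show ?thesis unfolding 1 using sub by (intro subspace_scale)
    qed
    then have "rep_space (block_rep \<alpha> \<beta>) \<subseteq> {v. rep_act (pair_rep k n) g v \<in> rep_space (block_rep \<alpha> \<beta>)}"
      using linear_subspace_vimage[OF linear_pair_act[of k n g] sub, unfolded vimage_def]
      by (subst (1) rep_space_block) (intro span_minimal, auto)
    then show "rep_act (pair_rep k n) g v \<in> rep_space (block_rep \<alpha> \<beta>)" using v by blast
  qed (simp_all add: rep_space_block subsetI)
  then have "group_rep \<Gamma> block_G (subrep (pair_rep k n) (rep_space (block_rep \<alpha> \<beta>)))"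
    by (rule B.group_rep_subrep[OF group_rep_pair])
  then show ?thesis by (simp add: group_rep_def block_act)
qed

end

section \<open>The induced representation\<close>

definition all_signs :: "nat \<Rightarrow> (nat \<Rightarrow> real) set" where
  "all_signs n = {\<epsilon>. (\<forall>i<n. \<epsilon> i = 1 \<or> \<epsilon> i = -1) \<and> (\<forall>i\<ge>n. \<epsilon> i = 1)}"

lemma signed_family_all: "signed_family n (all_signs n)"
proof
  fix \<epsilon> i assume "\<epsilon> \<in> all_signs n"
  then show "\<epsilon> i = 1 \<or> \<epsilon> i = -1" by (cases "i < n") (auto simp: all_signs_def)
next
  fix \<epsilon> \<delta> assume e: "\<epsilon> \<in> all_signs n" and d: "\<delta> \<in> all_signs n"
  have "\<epsilon> i * \<delta> i = 1 \<or> \<epsilon> i * \<delta> i = -1" if "i < n" for i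
  proof -
    have "\<epsilon> i = 1 \<or> \<epsilon> i = -1" "\<delta> i = 1 \<or> \<delta> i = -1" using e d that by (auto simp: all_signs_def)
    then show ?thesis by (elim disjE) simp_all
  qed
  then show "(\<lambda>i. \<epsilon> i * \<delta> i) \<in> all_signs n" using e d by (simp add: all_signs_def)
next
  fix \<epsilon> \<sigma> assume e: "\<epsilon> \<in> all_signs n" and s: "\<sigma> permutes {..<n}"
  show "(\<lambda>i. \<epsilon> (\<sigma> i)) \<in> all_signs n"
    using e permutes_in_image[OF s] permutes_not_in[OF s] by (simp add: all_signs_def)
qed (auto simp: all_signs_def)

lemma carrier_hyperoctahedral_eq:
  "carrier (hyperoctahedral_group n) = {\<sigma>. \<sigma> permutes {..<n}} \<times> all_signs n"
  by (auto simp: mem_hyperoctahedral all_signs_def)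

lemma block_subgroup_eq:
  assumes "k \<le> n" shows "block_subgroup k n = block_perms k n \<times> all_signs n"
proof -
  have "\<sigma> ` {..<k} = {..<k} \<longleftrightarrow> (\<forall>a<n. \<sigma> a < k \<longleftrightarrow> a < k)" if p: "\<sigma> permutes {..<n}" for \<sigma>
  proof
    assume "\<sigma> ` {..<k} = {..<k}"
    then have "\<sigma> a \<in> {..<k} \<longleftrightarrow> a \<in> {..<k}" for a
      using inj_image_mem_iff[OF permutes_inj[OF p], of a "{..<k}"] by simp
    then show "\<forall>a<n. \<sigma> a < k \<longleftrightarrow> a < k" by simp
  next
    assume "\<forall>a<n. \<sigma> a < k \<longleftrightarrow> a < k"
    then show "\<sigma> ` {..<k} = {..<k}"
      using assms permutes_inj_on[OF p] by (intro endo_inj_surj) auto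
  qed
  then show ?thesis by (auto simp: block_subgroup_def carrier_hyperoctahedral_eq label_stab_def)
qed

section \<open>Mackey theory for restricting the induced module to fewer sign changes\<close>

context bitableau
begin

text \<open>The subgroup from which \<open>specht_B\<close> is induced, with all sign changes even
  if \<open>N\<close> is smaller; \<open>block_G\<close> is its intersection with
  \<open>full\<close>.\<close>

definition block_B :: "signed_perm set" where "block_B = block_perms k n \<times> all_signs n"
definition ind :: "(signed_perm, signed_perm \<Rightarrow>\<^sub>0 ((tabloid \<times> tabloid) \<Rightarrow>\<^sub>0 real)) rep" where
  "ind = specht_B \<alpha> \<beta>"
text \<open>The copy of the inducing module in the induced one: the function supported on
  \<open>block_B\<close> with value \<open>v\<close> at the unit.\<close>

definition ext :: "((tabloid \<times> tabloid) \<Rightarrow>\<^sub>0 real) \<Rightarrow> signed_perm \<Rightarrow>\<^sub>0 ((tabloid \<times> tabloid) \<Rightarrow>\<^sub>0 real)" where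
  "ext v = (\<Sum>x\<in>block_B. single x (rep_act (pair_rep k n) x v))"

lemma bitableau_all: "bitableau n (all_signs n) k \<alpha> \<beta> t s"
  by (intro bitableau.intro bitableau_axioms.intro signed_family_all kn \<alpha> \<beta> t s)

lemma ind_eq: "ind = induced_rep \<Gamma> block_B (block_rep \<alpha> \<beta>)"
  using part_sums block_subgroup_eq[OF kn] by (simp add: ind_def specht_B_def Let_def block_B_def)

lemma group_Gamma: "group \<Gamma>" by (rule group_hyperoctahedral)

lemma finite_subgroup_block_B: "finite_subgroup \<Gamma> block_B" and group_rep_block_B: "group_rep \<Gamma> block_B (block_rep \<alpha> \<beta>)"
  and group_rep_pair_block_B: "group_rep \<Gamma> block_B (pair_rep k n)"
proof -
  interpret B: bitableau n "all_signs n" k \<alpha> \<beta> t s by (rule bitableau_all)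
  show "finite_subgroup \<Gamma> block_B" "group_rep \<Gamma> block_B (block_rep \<alpha> \<beta>)" "group_rep \<Gamma> block_B (pair_rep k n)"
    using B.finite_subgroup_block_G B.group_rep_block B.group_rep_pair by (simp_all add: B.block_G_def block_B_def)
qed

lemma finite_subgroup_carrier: "finite_subgroup \<Gamma> (carrier \<Gamma>)"
  using signed_family.finite_subgroup_times[OF signed_family_all perm_subgroup_permutes, of n]
  by (simp add: carrier_hyperoctahedral_eq)

lemma finite_subgroup_full: "finite_subgroup \<Gamma> full"
  by (rule finite_subgroup_times[OF perm_subgroup_permutes])

lemma finite_carrier: "finite (carrier \<Gamma>)"
  using finite_subgroup_carrier by (simp add: finite_subgroup_def finite_subgroup_axioms_def)

lemma block_B_subset: "block_B \<subseteq> carrier \<Gamma>" "finite block_B" "\<one>\<^bsub>\<Gamma>\<^esub> \<in> block_B"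
proof -
  interpret H: finite_subgroup \<Gamma> block_B by (rule finite_subgroup_block_B)
  show "block_B \<subseteq> carrier \<Gamma>" "finite block_B" "\<one>\<^bsub>\<Gamma>\<^esub> \<in> block_B" using H.subset H.finite_G H.one_closed by auto
qed

lemma block_G_eq: "block_G = block_B \<inter> full"
  using full_subset by (auto simp: block_G_def block_B_def carrier_hyperoctahedral_eq label_stab_def)

lemma block_B_mult_iff: "h \<in> block_B \<Longrightarrow> g \<in> carrier \<Gamma> \<Longrightarrow> h \<otimes>\<^bsub>\<Gamma>\<^esub> g \<in> block_B \<longleftrightarrow> g \<in> block_B"
proof -
  interpret H: finite_subgroup \<Gamma> block_B by (rule finite_subgroup_block_B)
  assume h: "h \<in> block_B" and g: "g \<in> carrier \<Gamma>"
  have "g \<in> block_B" if "h \<otimes>\<^bsub>\<Gamma>\<^esub> g \<in> block_B"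
  proof -
    have "inv\<^bsub>\<Gamma>\<^esub> h \<otimes>\<^bsub>\<Gamma>\<^esub> (h \<otimes>\<^bsub>\<Gamma>\<^esub> g) = g"
      using h g by (simp add: H.m_assoc[symmetric] H.mem_carrier)
    then show ?thesis using h that H.m_closed[OF H.m_inv_closed] by metis
  qed
  then show "h \<otimes>\<^bsub>\<Gamma>\<^esub> g \<in> block_B \<longleftrightarrow> g \<in> block_B" using H.m_closed[OF h] by blast
qed

lemma mem_ind: "F \<in> rep_space ind \<longleftrightarrow> keys F \<subseteq> carrier \<Gamma> \<and>
    (\<forall>g\<in>carrier \<Gamma>. lookup F g \<in> rep_space (block_rep \<alpha> \<beta>)) \<and>
    (\<forall>h\<in>block_B. \<forall>g\<in>carrier \<Gamma>. lookup F (h \<otimes>\<^bsub>\<Gamma>\<^esub> g) = rep_act (pair_rep k n) h (lookup F g))"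
  by (simp add: ind_eq induced_rep_def block_act)

lemma lookup_ind_act: "y \<in> carrier \<Gamma> \<Longrightarrow> lookup (rep_act ind g F) y = lookup F (y \<otimes>\<^bsub>\<Gamma>\<^esub> g)"
  and lookup_ind_act': "y \<notin> carrier \<Gamma> \<Longrightarrow> lookup (rep_act ind g F) y = 0"
  using finite_carrier by (auto simp: ind_eq induced_rep_def lookup_sum lookup_single when_def)

lemma linear_ind_act: "linear (rep_act ind g)"
proof (rule linearI)
  fix F F'
  show "rep_act ind g (F + F') = rep_act ind g F + rep_act ind g F'"
  proof (rule poly_mapping_eqI)
    fix y show "lookup (rep_act ind g (F + F')) y = lookup (rep_act ind g F + rep_act ind g F') y"
      by (cases "y \<in> carrier \<Gamma>") (simp_all add: lookup_ind_act lookup_ind_act' lookup_add)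
  qed
next
  fix r F
  show "rep_act ind g (r *\<^sub>R F) = r *\<^sub>R rep_act ind g F"
  proof (rule poly_mapping_eqI)
    fix y show "lookup (rep_act ind g (r *\<^sub>R F)) y = lookup (r *\<^sub>R rep_act ind g F) y"
      by (cases "y \<in> carrier \<Gamma>") (simp_all add: lookup_ind_act lookup_ind_act')
  qed
qed

lemma ind_eqI:
  assumes "F \<in> rep_space ind" "F' \<in> rep_space ind" "\<And>y. y \<in> carrier \<Gamma> \<Longrightarrow> lookup F y = lookup F' y"
  shows "F = F'"
proof (rule poly_mapping_eqI)
  fix y show "lookup F y = lookup F' y"
  proof (cases "y \<in> carrier \<Gamma>")
    case False
    then have "y \<notin> keys F" "y \<notin> keys F'" using assms(1,2) unfolding mem_ind by blast+
    then show ?thesis by (simp add: in_keys_iff)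
  qed (rule assms(3))
qed

lemma subspace_block: "subspace (rep_space (block_rep \<alpha> \<beta>))"
  by (simp add: rep_space_block)

lemma group_rep_ind: "group_rep \<Gamma> (carrier \<Gamma>) ind"
  unfolding group_rep_def
proof (intro conjI ballI)
  interpret group \<Gamma> by (rule group_Gamma)
  show "subspace (rep_space ind)"
    unfolding subspace_def
  proof (intro conjI ballI allI)
    show "0 \<in> rep_space ind" using linear_0[OF linear_pair_act] subspace_0[OF subspace_block] by (simp add: mem_ind)
  next
    fix F F' assume F: "F \<in> rep_space ind" "F' \<in> rep_space ind"
    have "keys (F + F') \<subseteq> carrier \<Gamma>"
      using F keys_add[of F F'] by (auto simp: mem_ind)
    then show "F + F' \<in> rep_space ind" using F subspace_add[OF subspace_block]
      by (simp add: mem_ind lookup_add linear_add[OF linear_pair_act])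
  next
    fix r F assume F: "F \<in> rep_space ind"
    have "keys (r *\<^sub>R F) \<subseteq> carrier \<Gamma>"
      using F by (auto simp: mem_ind in_keys_iff)
    then show "r *\<^sub>R F \<in> rep_space ind" using F subspace_scale[OF subspace_block]
      by (simp add: mem_ind linear_cmul[OF linear_pair_act])
  qed
  show "linear (rep_act ind g)" for g by (rule linear_ind_act)
  show in_ind: "rep_act ind g F \<in> rep_space ind" if g: "g \<in> carrier \<Gamma>" and F: "F \<in> rep_space ind" for g F
    unfolding mem_ind
  proof (intro conjI ballI)
    show "keys (rep_act ind g F) \<subseteq> carrier \<Gamma>"
      using lookup_ind_act' by (metis in_keys_iff subsetI)
    show "lookup (rep_act ind g F) x \<in> rep_space (block_rep \<alpha> \<beta>)" if "x \<in> carrier \<Gamma>" for x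
      using F g that by (simp add: lookup_ind_act mem_ind)
    show "lookup (rep_act ind g F) (h \<otimes>\<^bsub>\<Gamma>\<^esub> x) = rep_act (pair_rep k n) h (lookup (rep_act ind g F) x)"
      if h: "h \<in> block_B" and x: "x \<in> carrier \<Gamma>" for h x
    proof -
      have "h \<in> carrier \<Gamma>" using h block_B_subset(1) by blast
      then show ?thesis using F g h x by (simp add: lookup_ind_act mem_ind m_assoc)
    qed
  qed
  show "rep_act ind \<one>\<^bsub>\<Gamma>\<^esub> F = F" if F: "F \<in> rep_space ind" for F
    by (rule ind_eqI[OF in_ind[OF one_closed F] F]) (simp add: lookup_ind_act)
  show "rep_act ind (g \<otimes>\<^bsub>\<Gamma>\<^esub> h) F = rep_act ind g (rep_act ind h F)"
    if g: "g \<in> carrier \<Gamma>" and h: "h \<in> carrier \<Gamma>" and F: "F \<in> rep_space ind" for g h F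
    by (rule ind_eqI[OF in_ind[OF m_closed[OF g h] F] in_ind[OF g in_ind[OF h F]]])
      (use g h in \<open>simp add: lookup_ind_act m_assoc\<close>)
qed

lemma group_rep_ind_full: "group_rep \<Gamma> full ind"
  using finite_subgroup.group_rep_mono[OF finite_subgroup_full group_rep_ind full_subset] .

lemma group_rep_forms_full: "group_rep \<Gamma> full (forms n d)" "group_rep \<Gamma> block_G (forms n d)"
  using finite_subgroup.group_rep_mono[OF finite_subgroup_full group_rep_forms full_subset]
    finite_subgroup.group_rep_mono[OF finite_subgroup_block_G group_rep_forms group_subsets(4)] by auto

lemma lookup_ext: "lookup (ext v) y = (if y \<in> block_B then rep_act (pair_rep k n) y v else 0)"
  using block_B_subset(2) by (auto simp: ext_def lookup_sum lookup_single when_def)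

lemma lookup_ext_one: "lookup (ext v) \<one>\<^bsub>\<Gamma>\<^esub> = v"
  using block_B_subset(3) group_repD(4)[OF group_rep_pair_block_B] by (simp add: lookup_ext)

lemma ext_in_ind: "v \<in> rep_space (block_rep \<alpha> \<beta>) \<Longrightarrow> ext v \<in> rep_space ind"
  unfolding mem_ind
proof (intro conjI ballI)
  assume v: "v \<in> rep_space (block_rep \<alpha> \<beta>)"
  show "keys (ext v) \<subseteq> carrier \<Gamma>" using block_B_subset(1) by (auto simp: in_keys_iff lookup_ext split: if_splits)
  show "lookup (ext v) g \<in> rep_space (block_rep \<alpha> \<beta>)" for g
    using v group_repD(3)[OF group_rep_block_B] subspace_0[OF subspace_block] by (simp add: lookup_ext block_act)
  show "lookup (ext v) (h \<otimes>\<^bsub>\<Gamma>\<^esub> g) = rep_act (pair_rep k n) h (lookup (ext v) g)"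
    if "h \<in> block_B" "g \<in> carrier \<Gamma>" for h g
    using that group_repD(5)[OF group_rep_pair_block_B, of h g v] linear_0[OF linear_pair_act]
    by (simp add: lookup_ext block_B_mult_iff)
qed

lemma linear_ext: "linear ext"
proof (rule linearI)
  show "ext (v + w) = ext v + ext w" for v w
    by (rule poly_mapping_eqI) (simp add: lookup_ext lookup_add linear_add[OF linear_pair_act])
  show "ext (r *\<^sub>R v) = r *\<^sub>R ext v" for r v
    by (rule poly_mapping_eqI) (simp add: lookup_ext linear_cmul[OF linear_pair_act])
qed

lemma ind_act_ext:
  assumes h: "h \<in> block_B" and v: "v \<in> rep_space (block_rep \<alpha> \<beta>)"
  shows "rep_act ind h (ext v) = ext (rep_act (pair_rep k n) h v)"
proof (rule ind_eqI)
  interpret H: finite_subgroup \<Gamma> block_B by (rule finite_subgroup_block_B)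
  have hc: "h \<in> carrier \<Gamma>" using h by (rule H.mem_carrier)
  show "rep_act ind h (ext v) \<in> rep_space ind"
    using group_repD(3)[OF group_rep_ind hc ext_in_ind[OF v]] .
  show "ext (rep_act (pair_rep k n) h v) \<in> rep_space ind"
    using ext_in_ind group_repD(3)[OF group_rep_block_B h v] by (simp add: block_act)
  fix y assume y: "y \<in> carrier \<Gamma>"
  have "y \<otimes>\<^bsub>\<Gamma>\<^esub> h \<in> block_B \<longleftrightarrow> y \<in> block_B"
  proof
    assume "y \<otimes>\<^bsub>\<Gamma>\<^esub> h \<in> block_B"
    then have "y \<otimes>\<^bsub>\<Gamma>\<^esub> h \<otimes>\<^bsub>\<Gamma>\<^esub> inv\<^bsub>\<Gamma>\<^esub> h \<in> block_B" by (rule H.m_closed[OF _ H.m_inv_closed[OF h]])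
    moreover have "y \<otimes>\<^bsub>\<Gamma>\<^esub> h \<otimes>\<^bsub>\<Gamma>\<^esub> inv\<^bsub>\<Gamma>\<^esub> h = y" using y hc by (simp add: H.m_assoc)
    ultimately show "y \<in> block_B" by metis
  qed (use h in \<open>simp add: H.m_closed\<close>)
  then show "lookup (rep_act ind h (ext v)) y = lookup (ext (rep_act (pair_rep k n) h v)) y"
    using y h group_repD(5)[OF group_rep_pair_block_B, of y h v] by (simp add: lookup_ind_act lookup_ext)
qed

text \<open>Evaluation at the unit commutes with the action of \<open>block_B\<close>, which brings
  the symmetrizers on \<open>ind\<close> back to \<open>pair_rep\<close>.\<close>

lemma lookup_gsum_one:
  assumes F: "F \<in> rep_space ind" and A: "A \<subseteq> block_B"
  shows "lookup (gsum ind A c F) \<one>\<^bsub>\<Gamma>\<^esub> = gsum (pair_rep k n) A c (lookup F \<one>\<^bsub>\<Gamma>\<^esub>)"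
proof -
  interpret group \<Gamma> by (rule group_Gamma)
  have "lookup (rep_act ind g F) \<one>\<^bsub>\<Gamma>\<^esub> = rep_act (pair_rep k n) g (lookup F \<one>\<^bsub>\<Gamma>\<^esub>)" if g: "g \<in> A" for g
  proof -
    have gH: "g \<in> block_B" and gc: "g \<in> carrier \<Gamma>" using g A block_B_subset(1) by auto
    have "lookup (rep_act ind g F) \<one>\<^bsub>\<Gamma>\<^esub> = lookup F (g \<otimes>\<^bsub>\<Gamma>\<^esub> \<one>\<^bsub>\<Gamma>\<^esub>)"
      using gc by (simp add: lookup_ind_act)
    then show ?thesis using F gH one_closed by (simp only: mem_ind)
  qed
  then show ?thesis by (simp add: gsum_def lookup_sum)
qed

lemma col_group_row_group_block_B: "col_group \<subseteq> block_B" "row_group \<subseteq> block_B"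
  using group_subsets block_G_eq by blast+

text \<open>A single double coset: \<open>block_B\<close> and \<open>full\<close> together generate
  the carrier by products. Elements of \<open>ind\<close> are then determined by their values on
  \<open>full\<close>, and the restriction to \<open>full\<close> behaves as if induced from
  \<open>block_G\<close>.\<close>

definition covering :: bool where
  "covering \<longleftrightarrow> (\<forall>x\<in>carrier \<Gamma>. \<exists>h\<in>block_B. h \<otimes>\<^bsub>\<Gamma>\<^esub> x \<in> full)"

text \<open>Mackey's irreducibility condition for \<open>chi\<close>: a permutation that does not
  preserve the blocks carries \<open>chi\<close> on \<open>N\<close> to a different character, since
  the product of two signs is -1 exactly if they differ.\<close>

definition separating :: bool where
  "separating \<longleftrightarrow> (\<forall>\<sigma>. \<sigma> permutes {..<n} \<longrightarrow> \<sigma> \<notin> block_perms k n \<longrightarrow>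
     (\<exists>\<delta>\<in>N. (\<Prod>i\<in>{k..<n}. \<delta> i) * (\<Prod>i\<in>{k..<n}. \<delta> (inv_into UNIV \<sigma> i)) = -1))"

lemma ind_eqI_full:
  assumes cov: covering and F: "F \<in> rep_space ind" and F': "F' \<in> rep_space ind"
    and eq: "\<And>y. y \<in> full \<Longrightarrow> lookup F y = lookup F' y"
  shows "F = F'"
proof (rule ind_eqI[OF F F'])
  interpret H: finite_subgroup \<Gamma> block_B by (rule finite_subgroup_block_B)
  fix y assume y: "y \<in> carrier \<Gamma>"
  then obtain h where h: "h \<in> block_B" "h \<otimes>\<^bsub>\<Gamma>\<^esub> y \<in> full" using cov by (auto simp: covering_def)
  have *: "lookup G y = rep_act (pair_rep k n) (inv\<^bsub>\<Gamma>\<^esub> h) (lookup G (h \<otimes>\<^bsub>\<Gamma>\<^esub> y))" if G: "G \<in> rep_space ind" for G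
  proof -
    have "inv\<^bsub>\<Gamma>\<^esub> h \<otimes>\<^bsub>\<Gamma>\<^esub> (h \<otimes>\<^bsub>\<Gamma>\<^esub> y) = y" using h y by (simp add: H.m_assoc[symmetric] H.mem_carrier)
    moreover have "lookup G (inv\<^bsub>\<Gamma>\<^esub> h \<otimes>\<^bsub>\<Gamma>\<^esub> (h \<otimes>\<^bsub>\<Gamma>\<^esub> y)) = rep_act (pair_rep k n) (inv\<^bsub>\<Gamma>\<^esub> h) (lookup G (h \<otimes>\<^bsub>\<Gamma>\<^esub> y))"
      using G h y H.m_inv_closed unfolding mem_ind by (simp add: H.mem_carrier)
    ultimately show ?thesis by simp
  qed
  show "lookup F y = lookup F' y" using *[OF F] *[OF F'] eq[OF h(2)] by simp
qed

lemma ind_generated: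
  assumes cov: covering
  shows "rep_space ind \<subseteq> span {rep_act ind g (ext poly0) | g. g \<in> full}"
proof
  interpret G: finite_subgroup \<Gamma> full by (rule finite_subgroup_full)
  interpret H: finite_subgroup \<Gamma> block_G by (rule finite_subgroup_block_G)
  let ?U = "span {rep_act ind g (ext poly0) | g. g \<in> full}"
  note Sd = group_repD[OF group_rep_ind_full]
  have e0: "ext poly0 \<in> rep_space ind" by (rule ext_in_ind[OF poly0_in_block])
  have Uact: "rep_act ind x F \<in> ?U" if x: "x \<in> full" and F: "F \<in> ?U" for x F
  proof -
    have "?U \<subseteq> {F. rep_act ind x F \<in> ?U}"
    proof (rule span_minimal)
      show "subspace {F. rep_act ind x F \<in> ?U}"
        by (rule linear_subspace_vimage[OF linear_ind_act subspace_span, unfolded vimage_def])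
      show "{rep_act ind g (ext poly0) | g. g \<in> full} \<subseteq> {F. rep_act ind x F \<in> ?U}"
      proof clarify
        fix \<sigma> \<epsilon> assume "\<sigma> permutes {..<n}" "\<epsilon> \<in> N"
        then have g: "(\<sigma>, \<epsilon>) \<in> full" by simp
        show "rep_act ind x (rep_act ind (\<sigma>, \<epsilon>) (ext poly0)) \<in> ?U"
          unfolding Sd(5)[OF x g e0, symmetric]
          by (rule span_base, rule CollectI, rule exI, rule conjI, rule refl, rule G.m_closed[OF x g])
      qed
    qed
    then show ?thesis using F by blast
  qed
  have Uext: "ext v \<in> ?U" if v: "v \<in> rep_space (block_rep \<alpha> \<beta>)" for v
  proof -
    have "v \<in> span {rep_act (pair_rep k n) g poly0 | g. g \<in> block_G}" using v block_space_generated by blast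
    then have "ext v \<in> span (ext ` {rep_act (pair_rep k n) g poly0 | g. g \<in> block_G})"
      using linear_span_image[OF linear_ext] by blast
    moreover have "ext ` {rep_act (pair_rep k n) g poly0 | g. g \<in> block_G} \<subseteq> {rep_act ind g (ext poly0) | g. g \<in> full}"
    proof clarify
      fix a b assume "(a, b) \<in> block_G"
      then have "(a, b) \<in> block_B" "(a, b) \<in> full" unfolding block_G_eq by auto
      then show "\<exists>g. ext (rep_act (pair_rep k n) (a, b) poly0) = rep_act ind g (ext poly0) \<and> g \<in> full"
        using ind_act_ext[OF _ poly0_in_block] by metis
    qed
    ultimately show ?thesis using span_mono by blast
  qed
  fix F assume F: "F \<in> rep_space ind"
  have Fb: "lookup F x \<in> rep_space (block_rep \<alpha> \<beta>)" if "x \<in> full" for x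
    using F that full_subset unfolding mem_ind by blast
  \<comment> \<open>A sum of translates that recovers \<open>F\<close>: at \<open>y\<close> only
    those \<open>x\<close> with \<open>y \<otimes> inv x\<close> in \<open>block_G\<close>
    contribute, each giving the value of \<open>F\<close> at \<open>y\<close>. Hence the factor
    \<open>card block_G\<close>.\<close>
  define E where "E = (\<Sum>x\<in>full. rep_act ind (inv\<^bsub>\<Gamma>\<^esub> x) (ext (lookup F x)))"
  have EU: "E \<in> ?U" unfolding E_def using Uact Uext Fb by (intro span_sum) (simp add: G.m_inv_closed)
  have "?U \<subseteq> rep_space ind"
    using Sd(1,3) e0 by (intro span_minimal) auto
  then have E: "E \<in> rep_space ind" using EU by blast
  have "E = real (card block_G) *\<^sub>R F"
  proof (rule ind_eqI_full[OF cov E subspace_scale[OF Sd(1) F]])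
    fix y assume y: "y \<in> full"
    have yc: "y \<in> carrier \<Gamma>" using y by (rule G.mem_carrier)
    have bij: "bij_betw (\<lambda>z. inv\<^bsub>\<Gamma>\<^esub> z \<otimes>\<^bsub>\<Gamma>\<^esub> y) full full"
      using bij_betw_trans[OF G.bij_inv G.bij_mult_right[OF y]] by (simp add: o_def)
    have "lookup E y = (\<Sum>x\<in>full. lookup (ext (lookup F x)) (y \<otimes>\<^bsub>\<Gamma>\<^esub> inv\<^bsub>\<Gamma>\<^esub> x))"
      using yc by (simp add: E_def lookup_sum lookup_ind_act)
    also have "\<dots> = (\<Sum>z\<in>full. lookup (ext (lookup F (inv\<^bsub>\<Gamma>\<^esub> z \<otimes>\<^bsub>\<Gamma>\<^esub> y))) (y \<otimes>\<^bsub>\<Gamma>\<^esub> inv\<^bsub>\<Gamma>\<^esub> (inv\<^bsub>\<Gamma>\<^esub> z \<otimes>\<^bsub>\<Gamma>\<^esub> y)))"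
      by (rule sum.reindex_bij_betw[OF bij, symmetric])
    also have "\<dots> = (\<Sum>z\<in>full. if z \<in> block_G then lookup F y else 0)"
    proof (intro sum.cong refl)
      fix z assume z: "z \<in> full"
      have zc: "z \<in> carrier \<Gamma>" using z by (rule G.mem_carrier)
      have "y \<otimes>\<^bsub>\<Gamma>\<^esub> inv\<^bsub>\<Gamma>\<^esub> (inv\<^bsub>\<Gamma>\<^esub> z \<otimes>\<^bsub>\<Gamma>\<^esub> y) = z"
        using zc yc by (simp add: G.inv_mult_group G.m_assoc[symmetric])
      moreover have "rep_act (pair_rep k n) z (lookup F (inv\<^bsub>\<Gamma>\<^esub> z \<otimes>\<^bsub>\<Gamma>\<^esub> y)) = lookup F y" if "z \<in> block_B"
      proof -
        have "lookup F (z \<otimes>\<^bsub>\<Gamma>\<^esub> (inv\<^bsub>\<Gamma>\<^esub> z \<otimes>\<^bsub>\<Gamma>\<^esub> y)) = rep_act (pair_rep k n) z (lookup F (inv\<^bsub>\<Gamma>\<^esub> z \<otimes>\<^bsub>\<Gamma>\<^esub> y))"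
          using F that zc yc unfolding mem_ind by simp
        then show ?thesis using zc yc by (simp add: G.m_assoc[symmetric])
      qed
      ultimately show "lookup (ext (lookup F (inv\<^bsub>\<Gamma>\<^esub> z \<otimes>\<^bsub>\<Gamma>\<^esub> y))) (y \<otimes>\<^bsub>\<Gamma>\<^esub> inv\<^bsub>\<Gamma>\<^esub> (inv\<^bsub>\<Gamma>\<^esub> z \<otimes>\<^bsub>\<Gamma>\<^esub> y)) =
          (if z \<in> block_G then lookup F y else 0)"
        using z by (simp add: lookup_ext block_G_eq)
    qed
    also have "\<dots> = (\<Sum>z\<in>block_G. lookup F y)"
      using group_subsets(3) G.finite_G by (simp only: sum.inter_restrict[symmetric] Int_absorb1)
    also have "\<dots> = lookup (real (card block_G) *\<^sub>R F) y" by (simp add: sum_constant_scaleR)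
    finally show "lookup E y = lookup (real (card block_G) *\<^sub>R F) y" .
  qed
  moreover have "card block_G > 0" using H.finite_G H.one_closed card_gt_0_iff by blast
  ultimately have "F = (1 / real (card block_G)) *\<^sub>R E" by simp
  then show "F \<in> ?U" using EU by (simp add: span_scale)
qed

text \<open>The symmetrized function is one on which \<open>N\<close> acts through
  \<open>chi\<close>. By \<open>separating\<close> it vanishes at the elements of
  \<open>full\<close> outside \<open>block_B\<close>, so its value at the unit determines
  it.\<close>

lemma gsum_ind_line:
  assumes cov: covering and sep: separating and F: "F \<in> rep_space ind"
    and a: "gsum (pair_rep k n) col_group (sgn_chi k n) (lookup F \<one>\<^bsub>\<Gamma>\<^esub>) = a *\<^sub>R poly0"
  shows "gsum ind col_group (sgn_chi k n) F = a *\<^sub>R ext poly0"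
proof -
  interpret group \<Gamma> by (rule group_Gamma)
  define K where "K = gsum ind col_group (sgn_chi k n) F"
  note Sd = group_repD[OF group_rep_ind_full]
  have K: "K \<in> rep_space ind" unfolding K_def
    by (rule gsum_in_space[OF group_rep_ind_full sign_character_col_group group_subsets(7) F])
  have e0: "ext poly0 \<in> rep_space ind" by (rule ext_in_ind[OF poly0_in_block])
  have K1: "lookup K \<one>\<^bsub>\<Gamma>\<^esub> = a *\<^sub>R poly0" unfolding K_def lookup_gsum_one[OF F col_group_row_group_block_B(1)] by (rule a)
  have "K = a *\<^sub>R ext poly0"
  proof (rule ind_eqI_full[OF cov K subspace_scale[OF Sd(1) e0]])
    fix x assume x: "x \<in> full"
    have xc: "x \<in> carrier \<Gamma>" using x full_subset by blast
    show "lookup K x = lookup (a *\<^sub>R ext poly0) x"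
    proof (cases "x \<in> block_B")
      case True
      have "lookup K (x \<otimes>\<^bsub>\<Gamma>\<^esub> \<one>\<^bsub>\<Gamma>\<^esub>) = rep_act (pair_rep k n) x (lookup K \<one>\<^bsub>\<Gamma>\<^esub>)"
        using K True one_closed unfolding mem_ind by blast
      then show ?thesis using xc True by (simp add: K1 lookup_ext linear_cmul[OF linear_pair_act])
    next
      case False
      obtain \<sigma> \<epsilon> where xe: "x = (\<sigma>, \<epsilon>)" by (cases x)
      have p: "\<sigma> permutes {..<n}" and eN: "\<epsilon> \<in> N" using x xe by auto
      have "\<epsilon> \<in> all_signs n" using xc xe by (simp add: carrier_hyperoctahedral_eq)
      then have "\<sigma> \<notin> block_perms k n" using False xe by (simp add: block_B_def)
      then obtain \<delta> where \<delta>: "\<delta> \<in> N" "(\<Prod>i\<in>{k..<n}. \<delta> i) * (\<Prod>i\<in>{k..<n}. \<delta> (inv_into UNIV \<sigma> i)) = -1"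
        using sep p unfolding separating_def by blast
      define \<delta>' where "\<delta>' i = \<delta> (inv_into UNIV \<sigma> i)" for i
      have \<delta>'N: "\<delta>' \<in> N" unfolding \<delta>'_def by (rule N_perm[OF \<delta>(1) permutes_inv[OF p]])
      have idb: "id \<in> label_stab n f" for f :: "nat \<Rightarrow> 'l" by (simp add: label_stab_def permutes_id)
      have dC: "(id, \<delta>) \<in> col_group" using \<delta>(1) idb by (simp add: col_group_def)
      have "(id, \<delta>') \<in> carrier \<Gamma>" using \<delta>'N full_subset permutes_id by blast
      then have "\<delta>' \<in> all_signs n" by (simp add: carrier_hyperoctahedral_eq)
      then have d'H: "(id, \<delta>') \<in> block_B" using idb by (simp add: block_B_def)
      have dc: "(id, \<delta>) \<in> carrier \<Gamma>" using dC group_subsets(5) by blast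
      \<comment> \<open>The value at this element is computed twice: the right factor \<delta> acts
        through \<open>chi\<close>, and so does the left factor \<delta>' by the condition defining
        induced functions. Where the two signs differ, the value is 0.\<close>
      have comm: "x \<otimes>\<^bsub>\<Gamma>\<^esub> (id, \<delta>) = (id, \<delta>') \<otimes>\<^bsub>\<Gamma>\<^esub> x"
        by (simp add: xe mult_hyperoctahedral \<delta>'_def permutes_inverses[OF p] mult.commute)
      have "rep_act ind (id, \<delta>) K = sgn_chi k n (id, \<delta>) *\<^sub>R K"
        unfolding K_def by (rule act_gsum[OF group_rep_ind_full sign_character_col_group group_subsets(7) dC F])
      then have "lookup K (x \<otimes>\<^bsub>\<Gamma>\<^esub> (id, \<delta>)) = sgn_chi k n (id, \<delta>) *\<^sub>R lookup K x"
        using lookup_ind_act[OF xc, of "(id, \<delta>)" K] by simp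
      moreover have "lookup K ((id, \<delta>') \<otimes>\<^bsub>\<Gamma>\<^esub> x) = rep_act (pair_rep k n) (id, \<delta>') (lookup K x)"
        using K d'H xc unfolding mem_ind by blast
      moreover have "rep_act (pair_rep k n) (id, \<delta>') (lookup K x) = chi k n (id, \<delta>') *\<^sub>R lookup K x"
        by (rule pair_act_eqI) simp_all
      moreover have "sgn_chi k n (id, \<delta>) = chi k n (id, \<delta>)" by (simp add: sgn_chi_def)
      ultimately have eq: "chi k n (id, \<delta>) *\<^sub>R lookup K x = chi k n (id, \<delta>') *\<^sub>R lookup K x"
        using comm by metis
      have "chi k n (id, \<delta>) * chi k n (id, \<delta>) = 1" using dC group_subsets(7) by (intro chi_square) blast
      moreover have "chi k n (id, \<delta>) * chi k n (id, \<delta>') = -1" using \<delta>(2) by (simp add: chi_def \<delta>'_def)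
      ultimately have "chi k n (id, \<delta>) \<noteq> chi k n (id, \<delta>')" by auto
      then have "lookup K x = 0" using eq by (simp add: real_vector.scale_right_imp_eq)
      then show ?thesis using False by (simp add: lookup_ext)
    qed
  qed
  then show ?thesis by (simp add: K_def)
qed

text \<open>Frobenius reciprocity: a map out of the inducing module extends to \<open>ind\<close> by
  summing \<open>inv x\<close> applied to the image of the value at \<open>x\<close>. On
  \<open>ext poly0\<close> all elements of \<open>block_G\<close> contribute equally, whence the
  scalar \<open>r\<close>.\<close>

lemma ex_equivariant_ind:
  fixes R :: "(signed_perm, 'v::real_vector) rep"
  assumes R: "group_rep \<Gamma> full R" and u: "u \<in> rep_space R"
  shows "\<exists>f r. equivariant full ind R f \<and> r \<noteq> 0 \<and>
    f (ext poly0) = r *\<^sub>R gsum R col_group (sgn_chi k n) (gsum R row_group (chi k n) u)"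
proof -
  interpret G: finite_subgroup \<Gamma> full by (rule finite_subgroup_full)
  interpret H: finite_subgroup \<Gamma> block_G by (rule finite_subgroup_block_G)
  note Rd = group_repD[OF R]
  obtain f where f: "equivariant block_G (pair_rep k n) R f"
    "f poly0 = gsum R col_group (sgn_chi k n) (gsum R row_group (chi k n) u)"
    using ex_equivariant_pair_rep[OF H.group_rep_mono[OF R group_subsets(3)] u] by blast
  have lf: "linear f" and fR: "\<And>v. f v \<in> rep_space R"
    and feq: "\<And>g v. g \<in> block_G \<Longrightarrow> f (rep_act (pair_rep k n) g v) = rep_act R g (f v)"
    using f(1) by (auto simp: equivariant_def pair_rep_def image_subset_iff)
  define h where "h F = (\<Sum>x\<in>full. rep_act R (inv\<^bsub>\<Gamma>\<^esub> x) (f (lookup F x)))" for F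
  have lh: "linear h"
  proof (rule linearI)
    show "h (F + F') = h F + h F'" for F F'
      unfolding h_def sum.distrib[symmetric]
      by (intro sum.cong refl) (simp add: lookup_add linear_add[OF lf] linear_add[OF Rd(2)] G.m_inv_closed del: mem_Sigma_iff)
    show "h (r *\<^sub>R F) = r *\<^sub>R h F" for r F
      unfolding h_def scaleR_sum_right
      by (intro sum.cong refl) (simp add: linear_cmul[OF lf] linear_cmul[OF Rd(2)] G.m_inv_closed del: mem_Sigma_iff)
  qed
  have hR: "h F \<in> rep_space R" for F
    unfolding h_def using Rd(1,3) fR G.m_inv_closed by (intro subspace_sum) auto
  have heq: "h (rep_act ind g F) = rep_act R g (h F)" if g: "g \<in> full" for g F
  proof -
    have gc: "g \<in> carrier \<Gamma>" using g by (rule G.mem_carrier)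
    have "h (rep_act ind g F) = (\<Sum>x\<in>full. rep_act R (inv\<^bsub>\<Gamma>\<^esub> x) (f (lookup F (x \<otimes>\<^bsub>\<Gamma>\<^esub> g))))"
      unfolding h_def by (intro sum.cong refl) (simp add: lookup_ind_act G.mem_carrier del: mem_Sigma_iff)
    also have "\<dots> = (\<Sum>x\<in>full. rep_act R (g \<otimes>\<^bsub>\<Gamma>\<^esub> inv\<^bsub>\<Gamma>\<^esub> (x \<otimes>\<^bsub>\<Gamma>\<^esub> g)) (f (lookup F (x \<otimes>\<^bsub>\<Gamma>\<^esub> g))))"
    proof (intro sum.cong refl)
      fix x assume x: "x \<in> full"
      have "g \<otimes>\<^bsub>\<Gamma>\<^esub> inv\<^bsub>\<Gamma>\<^esub> (x \<otimes>\<^bsub>\<Gamma>\<^esub> g) = inv\<^bsub>\<Gamma>\<^esub> x"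
        using gc G.mem_carrier[OF x] by (simp add: G.inv_mult_group G.m_assoc[symmetric])
      then show "rep_act R (inv\<^bsub>\<Gamma>\<^esub> x) (f (lookup F (x \<otimes>\<^bsub>\<Gamma>\<^esub> g))) =
        rep_act R (g \<otimes>\<^bsub>\<Gamma>\<^esub> inv\<^bsub>\<Gamma>\<^esub> (x \<otimes>\<^bsub>\<Gamma>\<^esub> g)) (f (lookup F (x \<otimes>\<^bsub>\<Gamma>\<^esub> g)))" by simp
    qed
    also have "\<dots> = (\<Sum>y\<in>full. rep_act R (g \<otimes>\<^bsub>\<Gamma>\<^esub> inv\<^bsub>\<Gamma>\<^esub> y) (f (lookup F y)))"
      by (rule G.sum_mult_right[OF g])
    also have "\<dots> = (\<Sum>y\<in>full. rep_act R g (rep_act R (inv\<^bsub>\<Gamma>\<^esub> y) (f (lookup F y))))"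
      by (intro sum.cong refl Rd(5) g G.m_inv_closed fR)
    also have "\<dots> = rep_act R g (h F)"
      unfolding h_def by (simp add: linear_sum[OF Rd(2)[OF g]])
    finally show ?thesis .
  qed
  have "h (ext poly0) = (\<Sum>x\<in>full. if x \<in> block_G then f poly0 else 0)"
    unfolding h_def
  proof (intro sum.cong refl)
    fix x assume x: "x \<in> full"
    show "rep_act R (inv\<^bsub>\<Gamma>\<^esub> x) (f (lookup (ext poly0) x)) = (if x \<in> block_G then f poly0 else 0)"
    proof (cases "x \<in> block_G")
      case True
      then have "x \<in> block_B" unfolding block_G_eq by blast
      then have "rep_act R (inv\<^bsub>\<Gamma>\<^esub> x) (f (lookup (ext poly0) x)) = rep_act R (inv\<^bsub>\<Gamma>\<^esub> x) (rep_act R x (f poly0))"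
        using feq[OF True] by (simp add: lookup_ext)
      also have "\<dots> = rep_act R (inv\<^bsub>\<Gamma>\<^esub> x \<otimes>\<^bsub>\<Gamma>\<^esub> x) (f poly0)"
        using Rd(5)[OF G.m_inv_closed[OF x] x fR] by simp
      also have "\<dots> = f poly0" using Rd(4)[OF fR] G.mem_carrier[OF x] by simp
      finally show ?thesis using True by simp
    next
      case False
      then have "x \<notin> block_B" using x unfolding block_G_eq by blast
      then show ?thesis using False linear_0[OF lf] linear_0[OF Rd(2)[OF G.m_inv_closed[OF x]]]
        by (simp add: lookup_ext)
    qed
  qed
  also have "\<dots> = (\<Sum>x\<in>block_G. f poly0)"
    using group_subsets(3) G.finite_G by (simp only: sum.inter_restrict[symmetric] Int_absorb1)
  also have "\<dots> = real (card block_G) *\<^sub>R f poly0" by (simp add: sum_constant_scaleR)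
  finally have "h (ext poly0) = real (card block_G) *\<^sub>R f poly0" .
  moreover have "card block_G > 0" using H.finite_G H.one_closed card_gt_0_iff by blast
  then have "real (card block_G) \<noteq> 0" by simp
  moreover have "equivariant full ind R h" using lh hR heq by (auto simp: equivariant_def)
  ultimately show ?thesis unfolding f(2)[symmetric] by blast
qed

section \<open>Multiplicities as ranks on the forms\<close>

definition symm :: "nat \<Rightarrow> real_mpoly \<Rightarrow> real_mpoly" where
  "symm d p = gsum (forms n d) row_group (chi k n) (gsum (forms n d) col_group (sgn_chi k n) p)"

lemma forms_pos:
  assumes "p \<in> rep_space (forms n d)" "gsum (forms n d) row_group (chi k n) (gsum (forms n d) col_group (sgn_chi k n) p) \<noteq> 0"
  shows "gsum (forms n d) col_group (sgn_chi k n) (gsum (forms n d) row_group (chi k n) (gsum (forms n d) col_group (sgn_chi k n) p)) \<noteq> 0"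
  by (rule forms_symmetrizer_nonzero[OF sign_character_col_group group_subsets(5) sign_character_row_group group_subsets(6) assms])

lemma finite_forms_basis:
  "finite ((\<lambda>m. single m (1::real)) ` monomials n d)"
  "rep_space (forms n d) \<subseteq> span ((\<lambda>m. single m 1) ` monomials n d)"
  using finite_monomials by (simp_all add: rep_space_forms supported_eq_span)

text \<open>\<open>covering\<close> makes \<open>ext poly0\<close> generate the module, and together
  with \<open>separating\<close> it confines the column symmetrizer to one line; the remaining facts
  are read off at the unit.\<close>

lemma has_multiplicity_specht_B:
  assumes cov: covering and sep: separating
  shows "has_multiplicity full (forms n d) (specht_B \<alpha> \<beta>) (dim (symm d ` rep_space (forms n d)))"
proof -
  interpret G: finite_subgroup \<Gamma> full by (rule finite_subgroup_full)
  have e0: "ext poly0 \<in> rep_space ind" by (rule ext_in_ind[OF poly0_in_block])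
  have "has_multiplicity full (forms n d) ind (dim ((\<lambda>p. gsum (forms n d) row_group (chi k n)
      (gsum (forms n d) col_group (sgn_chi k n) p)) ` rep_space (forms n d)))"
  proof (rule G.has_multiplicity_dim_symmetrizer[OF group_rep_forms_full(1) group_rep_ind_full finite_forms_basis
        group_subsets(7,8) e0 ind_generated[OF cov]])
    fix F assume F: "F \<in> rep_space ind"
    have "lookup F \<one>\<^bsub>\<Gamma>\<^esub> \<in> rep_space (block_rep \<alpha> \<beta>)" using F G.one_closed full_subset unfolding mem_ind by blast
    then obtain a where "gsum (pair_rep k n) col_group (sgn_chi k n) (lookup F \<one>\<^bsub>\<Gamma>\<^esub>) = a *\<^sub>R poly0"
      using gsum_block_in_line by (auto simp: span_singleton)
    then show "gsum ind col_group (sgn_chi k n) F \<in> span {ext poly0}"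
      using gsum_ind_line[OF cov sep F] by (auto simp: span_singleton)
  next
    show "gsum ind col_group (sgn_chi k n) (ext poly0) = real (card col_group) *\<^sub>R ext poly0"
      by (rule gsum_ind_line[OF cov sep e0]) (simp add: lookup_ext_one gsum_poly0)
    show "real (card col_group) \<noteq> 0" using card_col_group by simp
    have "lookup (gsum ind row_group (chi k n) (ext poly0)) \<one>\<^bsub>\<Gamma>\<^esub> \<noteq> 0"
      using gsum_row_group_poly0 by (simp add: lookup_gsum_one[OF e0 col_group_row_group_block_B(2)] lookup_ext_one)
    then show "gsum ind row_group (chi k n) (ext poly0) \<noteq> 0" by auto
  qed (use forms_pos ex_equivariant_ind[OF group_rep_forms_full(1)] in blast)+
  then show ?thesis by (simp add: ind_def symm_def[abs_def])
qed

text \<open>If \<open>k = n\<close>, every permutation preserves the blocks, so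
  \<open>block_rep\<close> is itself a representation of \<open>full\<close>. This case handles type
  A, where no induction takes place.\<close>

lemma has_multiplicity_block:
  assumes "k = n"
  shows "has_multiplicity full (forms n d) (block_rep \<alpha> \<beta>) (dim (symm d ` rep_space (forms n d)))"
proof -
  interpret G: finite_subgroup \<Gamma> full by (rule finite_subgroup_full)
  have "\<sigma> a < n" if "\<sigma> permutes {..<n}" "a < n" for \<sigma> a
    using permutes_in_image[OF that(1), of a] that(2) by simp
  then have bf: "block_G = full" unfolding block_G_def label_stab_def using assms by auto
  have "has_multiplicity full (forms n d) (block_rep \<alpha> \<beta>) (dim ((\<lambda>p. gsum (forms n d) row_group (chi k n)
      (gsum (forms n d) col_group (sgn_chi k n) p)) ` rep_space (forms n d)))"
  proof (rule G.has_multiplicity_dim_symmetrizer[OF group_rep_forms_full(1) group_rep_block[unfolded bf] finite_forms_basis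
        group_subsets(7,8) poly0_in_block block_space_generated[unfolded bf block_act[symmetric]]])
    show "gsum (block_rep \<alpha> \<beta>) col_group (sgn_chi k n) v \<in> span {poly0}" if "v \<in> rep_space (block_rep \<alpha> \<beta>)" for v
      unfolding gsum_block by (rule gsum_block_in_line[OF that])
    show "gsum (block_rep \<alpha> \<beta>) col_group (sgn_chi k n) poly0 = real (card col_group) *\<^sub>R poly0"
      unfolding gsum_block by (rule gsum_poly0)
    show "real (card col_group) \<noteq> 0" using card_col_group by simp
    show "gsum (block_rep \<alpha> \<beta>) row_group (chi k n) poly0 \<noteq> 0" unfolding gsum_block by (rule gsum_row_group_poly0)
    fix u assume u: "u \<in> rep_space (forms n d)"
    obtain f where f: "equivariant block_G (pair_rep k n) (forms n d) f"
      "f poly0 = gsum (forms n d) col_group (sgn_chi k n) (gsum (forms n d) row_group (chi k n) u)"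
      using ex_equivariant_pair_rep[OF group_rep_forms_full(2) u] by blast
    have "equivariant full (block_rep \<alpha> \<beta>) (forms n d) f"
      using f(1) bf by (auto simp: equivariant_def block_act pair_rep_def image_subset_iff)
    then show "\<exists>f r. equivariant full (block_rep \<alpha> \<beta>) (forms n d) f \<and> r \<noteq> 0 \<and>
        f poly0 = r *\<^sub>R gsum (forms n d) col_group (sgn_chi k n) (gsum (forms n d) row_group (chi k n) u)"
      using f(2) by (intro exI[of _ f] exI[of _ "1::real"]) simp
  qed (use forms_pos in blast)
  then show ?thesis by (simp add: symm_def[abs_def])
qed

text \<open>Every nonzero submodule of \<open>ind\<close> has a nonzero vector on which the sign changes act through \<open>chi\<close>.\<close>

lemma has_multiplicity_zero:
  assumes cov: covering and W: "submodule full (specht_B \<alpha> \<beta>) W" "W \<noteq> {0}"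
    and vanish: "\<And>p. p \<in> rep_space (forms n d) \<Longrightarrow> gsum (forms n d) ({id} \<times> N) (chi k n) p = 0"
  shows "has_multiplicity full (forms n d) (subrep (specht_B \<alpha> \<beta>) W) 0"
proof -
  interpret G: finite_subgroup \<Gamma> full by (rule finite_subgroup_full)
  let ?A = "{id} \<times> N :: signed_perm set"
  have idb: "id \<in> label_stab n f" for f :: "nat \<Rightarrow> 'l" by (simp add: label_stab_def permutes_id)
  have Af: "?A \<subseteq> full" using permutes_id by auto
  have AH: "?A \<subseteq> block_B" using Af full_subset idb by (auto simp: block_B_def carrier_hyperoctahedral_eq)
  have sW: "subspace W" and WS: "W \<subseteq> rep_space ind" and Wact: "\<And>g F. g \<in> full \<Longrightarrow> F \<in> W \<Longrightarrow> rep_act ind g F \<in> W"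
    using W(1) by (auto simp: submodule_def ind_def)
  obtain F where F: "F \<in> W" "F \<noteq> 0" using W(2) subspace_0[OF sW] by blast
  have "\<exists>x\<in>full. lookup F x \<noteq> 0"
    using ind_eqI_full[OF cov, of F 0] F WS group_repD(1)[OF group_rep_ind] by (force simp: subspace_0)
  then obtain x where x: "x \<in> full" "lookup F x \<noteq> 0" by blast
  \<comment> \<open>Translation by \<open>x\<close> moves a nonzero value to the unit, where the
    sign changes act by \<open>chi\<close>; the twisted sum over \<open>N\<close> multiplies it by
    \<open>card N\<close>.\<close>
  define F1 where "F1 = rep_act ind x F"
  have F1: "F1 \<in> W" using Wact x F by (simp add: F1_def)
  have "lookup F1 \<one>\<^bsub>\<Gamma>\<^esub> = lookup F x"
    using x G.mem_carrier[OF x(1)] by (simp add: F1_def lookup_ind_act del: mem_Sigma_iff)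
  then have F11: "lookup F1 \<one>\<^bsub>\<Gamma>\<^esub> \<noteq> 0" using x by simp
  have "lookup (gsum ind ?A (chi k n) F1) \<one>\<^bsub>\<Gamma>\<^esub> = (\<Sum>g\<in>?A. lookup F1 \<one>\<^bsub>\<Gamma>\<^esub>)"
    unfolding lookup_gsum_one[OF subsetD[OF WS F1] AH] unfolding gsum_def
  proof (intro sum.cong refl)
    fix g assume g: "g \<in> ?A"
    have "rep_act (pair_rep k n) g v = chi k n g *\<^sub>R v" for v
      using g by (intro pair_act_eqI) (auto simp: permute_pair_id)
    then show "chi k n g *\<^sub>R rep_act (pair_rep k n) g (lookup F1 \<one>\<^bsub>\<Gamma>\<^esub>) = lookup F1 \<one>\<^bsub>\<Gamma>\<^esub>"
      using chi_square[OF subsetD[OF Af g]] by simp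
  qed
  also have "\<dots> = real (card N) *\<^sub>R lookup F1 \<one>\<^bsub>\<Gamma>\<^esub>" by (simp add: sum_constant_scaleR card_cartesian_product)
  finally have nz: "gsum ind ?A (chi k n) F1 \<noteq> 0" using F11 card_N by auto
  have inW: "gsum ind ?A (chi k n) F1 \<in> W"
    using gsum_in_submodule[OF W(1) Af F1] by (simp add: ind_def)
  have none: "\<not> isomorphic_reps full (subrep (forms n d) V) (subrep (specht_B \<alpha> \<beta>) W)"
    if V: "submodule full (forms n d) V" for V
  proof
    assume iso: "isomorphic_reps full (subrep (forms n d) V) (subrep (specht_B \<alpha> \<beta>) W)"
    have "isomorphic_reps full (subrep (specht_B \<alpha> \<beta>) W) (subrep (forms n d) V)"
      by (rule isomorphic_reps_sym[OF _ _ iso]) (use V in \<open>auto simp: submodule_def\<close>)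
    then obtain f where f: "linear f" "bij_betw f W V"
      "\<forall>g\<in>full. \<forall>v\<in>W. f (rep_act ind g v) = rep_act (forms n d) g (f v)"
      unfolding isomorphic_reps_def by (auto simp: ind_def)
    have VF: "V \<subseteq> rep_space (forms n d)" using V by (simp add: submodule_def)
    have fW: "f ` W = V" and inj: "inj_on f W" using f(2) by (auto simp: bij_betw_def)
    have "equivariant full (subrep ind W) (forms n d) f" using f fW VF by (auto simp: equivariant_def)
    then have "f (gsum ind ?A (chi k n) F1) = gsum (forms n d) ?A (chi k n) (f F1)"
      using gsum_equivariant[of full "subrep ind W" "forms n d" f ?A F1] Af F1 by simp
    also have "\<dots> = 0" using vanish fW VF F1 by blast
    finally have "gsum ind ?A (chi k n) F1 = 0"
      using inj_onD[OF inj _ inW subspace_0[OF sW]] linear_0[OF f(1)] by simp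
    then show False using nz by simp
  qed
  show ?thesis unfolding has_multiplicity_def
  proof (intro conjI allI impI)
    show "\<exists>\<W>. irreducible_decomposition full (forms n d) \<W>"
      by (rule G.ex_irreducible_decomposition[OF group_rep_forms_full(1) finite_forms_basis])
    fix \<W> assume "irreducible_decomposition full (forms n d) \<W>"
    then have "{V \<in> \<W>. isomorphic_reps full (subrep (forms n d) V) (subrep (specht_B \<alpha> \<beta>) W)} = {}"
      using none by (auto simp: irreducible_decomposition_def irreducible_submodule_def)
    then show "card {V \<in> \<W>. isomorphic_reps full (subrep (forms n d) V) (subrep (specht_B \<alpha> \<beta>) W)} = 0"
      by (simp only: card.empty)
  qed
qed

end

section \<open>Stability of the symmetrized monomials\<close>

definition perm_act :: "(nat \<Rightarrow> nat) \<Rightarrow> real_mpoly \<Rightarrow> real_mpoly" where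
  "perm_act \<sigma> = linear_extension (\<lambda>m. single (perm_mono \<sigma> m) 1)"

text \<open>Symmetrizers stripped of sign changes and taken for an arbitrary labelling, so that
  \<open>n\<close> and \<open>Suc n\<close> letters can be compared without tableaux.\<close>

definition col_sum :: "nat \<Rightarrow> (nat \<Rightarrow> 'l) \<Rightarrow> real_mpoly \<Rightarrow> real_mpoly" where
  "col_sum n c p = (\<Sum>\<sigma>\<in>label_stab n c. of_int (sign \<sigma>) *\<^sub>R perm_act \<sigma> p)"

definition row_sum :: "nat \<Rightarrow> (nat \<Rightarrow> 'l) \<Rightarrow> real_mpoly \<Rightarrow> real_mpoly" where
  "row_sum n r p = (\<Sum>\<sigma>\<in>label_stab n r. perm_act \<sigma> p)"

lemma linear_perm_act: "linear (perm_act \<sigma>)"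
  by (simp add: perm_act_def linear_linear_extension)

lemma linear_col_sum: "linear (col_sum n c)"
  unfolding col_sum_def by (intro linear_compose_sum ballI linear_compose_scale_right linear_perm_act)

lemma linear_row_sum: "linear (row_sum n r)"
  unfolding row_sum_def by (intro linear_compose_sum ballI linear_perm_act)

lemma perm_act_single: "perm_act \<sigma> (single m x) = single (perm_mono \<sigma> m) x"
  by (simp add: perm_act_def scaleR_single)

lemma lookup_perm_act: "bij \<sigma> \<Longrightarrow> lookup (perm_act \<sigma> p) (perm_mono \<sigma> m) = lookup p m"
  unfolding perm_act_def using lookup_monomial_map[OF inj_perm_mono, of \<sigma> "\<lambda>_. 1"] by simp

lemma lookup_perm_act_inv: "bij \<sigma> \<Longrightarrow> lookup (perm_act \<sigma> p) m = lookup p (perm_mono (inv_into UNIV \<sigma>) m)"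
  using lookup_perm_act[of \<sigma> p "perm_mono (inv_into UNIV \<sigma>) m"] perm_mono_inv(2) by simp

lemma perm_act_comp:
  assumes "bij \<sigma>" "bij \<tau>" shows "perm_act \<sigma> (perm_act \<tau> p) = perm_act (\<sigma> \<circ> \<tau>) p"
proof (rule poly_mapping_eqI)
  fix m
  define m' where "m' = perm_mono (inv_into UNIV (\<sigma> \<circ> \<tau>)) m"
  have m: "m = perm_mono (\<sigma> \<circ> \<tau>) m'" using perm_mono_inv(2)[OF bij_comp[OF assms(2,1)]] by (simp add: m'_def)
  have "lookup (perm_act (\<sigma> \<circ> \<tau>) p) m = lookup p m'" unfolding m by (rule lookup_perm_act[OF bij_comp[OF assms(2,1)]])
  moreover have "lookup (perm_act \<sigma> (perm_act \<tau> p)) m = lookup p m'"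
    unfolding m perm_mono_comp[OF assms, symmetric] by (simp add: lookup_perm_act assms)
  ultimately show "lookup (perm_act \<sigma> (perm_act \<tau> p)) m = lookup (perm_act (\<sigma> \<circ> \<tau>) p) m" by simp
qed

lemma perm_act_id [simp]: "perm_act id p = p"
  by (rule poly_mapping_eqI) (use lookup_perm_act[of id p] in simp)

lemma perm_act_supported:
  assumes "bij \<sigma>" "\<And>m. m \<in> M \<Longrightarrow> perm_mono \<sigma> m \<in> M'" "p \<in> supported M"
  shows "perm_act \<sigma> p \<in> supported M'"
  unfolding supported_def
proof clarify
  fix m assume "m \<in> keys (perm_act \<sigma> p)"
  then have "perm_mono (inv_into UNIV \<sigma>) m \<in> M"
    using assms(3) by (auto simp: in_keys_iff lookup_perm_act_inv[OF assms(1)] supported_def)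
  then show "m \<in> M'" using assms(2) perm_mono_inv(2)[OF assms(1)] by metis
qed

lemma label_stab_bij: "\<sigma> \<in> label_stab n f \<Longrightarrow> bij \<sigma>"
  by (auto simp: label_stab_def intro: permutes_bij)

lemma finite_label_stab: "finite (label_stab n f)"
  by (rule perm_subgroup_finite[OF perm_subgroup_label_stab])

lemma row_sum_perm_act:
  assumes "\<tau> \<in> label_stab n r" shows "row_sum n r (perm_act \<tau> p) = row_sum n r p"
proof -
  have "row_sum n r (perm_act \<tau> p) = (\<Sum>\<sigma>\<in>label_stab n r. perm_act (\<sigma> \<circ> \<tau>) p)"
    unfolding row_sum_def using assms by (intro sum.cong refl) (simp add: perm_act_comp label_stab_bij)
  then show ?thesis
    using perm_subgroup_sum_right[OF perm_subgroup_label_stab assms, of "\<lambda>\<sigma>. perm_act \<sigma> p"] by (simp add: row_sum_def)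
qed

lemma perm_act_row_sum:
  assumes "\<tau> \<in> label_stab n r" shows "perm_act \<tau> (row_sum n r p) = row_sum n r p"
proof -
  have "perm_act \<tau> (row_sum n r p) = (\<Sum>\<sigma>\<in>label_stab n r. perm_act (\<tau> \<circ> \<sigma>) p)"
    unfolding row_sum_def linear_sum[OF linear_perm_act]
    using assms by (intro sum.cong refl) (simp add: perm_act_comp label_stab_bij)
  then show ?thesis
    using perm_subgroup_sum_left[OF perm_subgroup_label_stab assms, of "\<lambda>\<sigma>. perm_act \<sigma> p"] by (simp add: row_sum_def)
qed

lemma col_sum_perm_act:
  assumes "\<tau> \<in> label_stab n c"
  shows "col_sum n c (perm_act \<tau> p) = of_int (sign \<tau>) *\<^sub>R col_sum n c p"
proof -
  have perm: "permutation \<sigma>" if "\<sigma> \<in> label_stab n c" for \<sigma>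
    using that by (auto simp: label_stab_def intro: permutes_imp_permutation[rotated])
  have "of_int (sign \<tau>) *\<^sub>R col_sum n c p =
      (\<Sum>\<sigma>\<in>label_stab n c. (of_int (sign \<tau>) * of_int (sign \<sigma>)) *\<^sub>R perm_act \<sigma> p)"
    by (simp add: col_sum_def scaleR_sum_right)
  also have "\<dots> = (\<Sum>\<sigma>\<in>label_stab n c. (of_int (sign \<tau>) * of_int (sign (\<sigma> \<circ> \<tau>))) *\<^sub>R perm_act (\<sigma> \<circ> \<tau>) p)"
    by (rule perm_subgroup_sum_right[OF perm_subgroup_label_stab assms, symmetric])
  also have "\<dots> = col_sum n c (perm_act \<tau> p)"
    unfolding col_sum_def
  proof (intro sum.cong refl)
    fix \<sigma> assume \<sigma>: "\<sigma> \<in> label_stab n c"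
    have "sign \<tau> * sign (\<sigma> \<circ> \<tau>) = sign \<sigma>"
      using sign_compose[OF perm[OF \<sigma>] perm[OF assms]] by (simp add: sign_def)
    then have "real_of_int (sign \<tau>) * of_int (sign (\<sigma> \<circ> \<tau>)) = of_int (sign \<sigma>)"
      by (metis of_int_mult)
    then show "(real_of_int (sign \<tau>) * of_int (sign (\<sigma> \<circ> \<tau>))) *\<^sub>R perm_act (\<sigma> \<circ> \<tau>) p =
        of_int (sign \<sigma>) *\<^sub>R perm_act \<sigma> (perm_act \<tau> p)"
      using \<sigma> assms by (simp add: perm_act_comp label_stab_bij)
  qed
  finally show ?thesis by simp
qed

lemma label_stab_supported:
  assumes "\<And>\<sigma> m. \<sigma> \<in> label_stab n c \<Longrightarrow> m \<in> M \<Longrightarrow> perm_mono \<sigma> m \<in> M" "p \<in> supported M"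
  shows "col_sum n c p \<in> supported M" "row_sum n c p \<in> supported M"
  unfolding col_sum_def row_sum_def using assms perm_act_supported[OF label_stab_bij, of _ n c M M]
  by (auto intro!: subspace_sum[OF subspace_supported] subspace_scale[OF subspace_supported])

text \<open>
  The letter \<open>n\<close> is added in a new column. Symmetrizing over the larger row stabilizer is injective on
  row invariants not involving \<open>n\<close>, and a monomial not killed by the column sum can be made free of \<open>n\<close>
  by a transposition that commutes with the column stabilizer.
\<close>

lemma dim_symmetrized_extend:
  fixes r c r' c' :: "nat \<Rightarrow> 'l"
  assumes r: "\<And>a. a < n \<Longrightarrow> r' a = r a" and c: "\<And>a. a < n \<Longrightarrow> c' a = c a"
    and new: "\<And>a. a < n \<Longrightarrow> c a \<noteq> c' n"
    and M: "M = {m \<in> M'. lookup m n = 0}"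
    and Mr: "\<And>\<sigma> m. \<sigma> \<in> label_stab (Suc n) r' \<Longrightarrow> m \<in> M' \<Longrightarrow> perm_mono \<sigma> m \<in> M'"
    and Mc: "\<And>\<sigma> m. \<sigma> \<in> label_stab (Suc n) c' \<Longrightarrow> m \<in> M' \<Longrightarrow> perm_mono \<sigma> m \<in> M'"
    and zero: "\<And>m. m \<in> M' \<Longrightarrow> (\<And>a b. a < n \<Longrightarrow> b < n \<Longrightarrow> a \<noteq> b \<Longrightarrow> c a = c b \<Longrightarrow> lookup m a \<noteq> lookup m b) \<Longrightarrow>
      \<exists>z\<le>n. lookup m z = 0 \<and> r' z = r' n \<and> (\<forall>a\<le>n. a \<noteq> z \<longrightarrow> c' a \<noteq> c' z)"
  shows "dim ((\<lambda>p. row_sum n r (col_sum n c p)) ` supported M) =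
    dim ((\<lambda>p. row_sum (Suc n) r' (col_sum (Suc n) c' p)) ` supported M')"
proof -
  have fix_n: "\<sigma> permutes {..<n}" if "\<sigma> permutes {..<Suc n}" "\<sigma> n = n" for \<sigma>
    by (rule permutes_superset[OF that(1)]) (use that(2) in \<open>auto simp: less_Suc_eq\<close>)
  have in_Suc: "\<sigma> permutes {..<Suc n}" "\<sigma> n = n" if "\<sigma> permutes {..<n}" for \<sigma>
    using that permutes_not_in[OF that] by (auto intro: permutes_subset)
  have lt: "\<sigma> a < n" if "\<sigma> permutes {..<n}" "a < n" for \<sigma> a using permutes_in_image[OF that(1), of a] that(2) by simp
  \<comment> \<open>The new letter is alone in its column, so the column stabilizer does not
    grow.\<close>
  have C: "label_stab (Suc n) c' = label_stab n c"
  proof (intro equalityI subsetI)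
    fix \<sigma> assume s: "\<sigma> \<in> label_stab (Suc n) c'"
    then have p: "\<sigma> permutes {..<Suc n}" and cs: "\<And>a. a < Suc n \<Longrightarrow> c' (\<sigma> a) = c' a" by (auto simp: label_stab_def)
    have "\<sigma> n < Suc n" using permutes_in_image[OF p, of n] by simp
    then have "\<sigma> n = n" using new[of "\<sigma> n"] c[of "\<sigma> n"] cs[of n] by (cases "\<sigma> n < n") auto
    then have p': "\<sigma> permutes {..<n}" by (rule fix_n[OF p])
    have "c (\<sigma> a) = c a" if "a < n" for a
      using cs[of a] c[OF that] c[OF lt[OF p' that]] that by simp
    then show "\<sigma> \<in> label_stab n c" using p' by (simp add: label_stab_def)
  next
    fix \<sigma> assume s: "\<sigma> \<in> label_stab n c"
    then have p: "\<sigma> permutes {..<n}" by (simp add: label_stab_def)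
    then show "\<sigma> \<in> label_stab (Suc n) c'" using s in_Suc[OF p] c lt[OF p] by (auto simp: label_stab_def less_Suc_eq)
  qed
  have R: "label_stab n r \<subseteq> label_stab (Suc n) r'"
  proof
    fix \<sigma> assume s: "\<sigma> \<in> label_stab n r"
    then have p: "\<sigma> permutes {..<n}" by (simp add: label_stab_def)
    then show "\<sigma> \<in> label_stab (Suc n) r'" using s in_Suc[OF p] r lt[OF p] by (auto simp: label_stab_def less_Suc_eq)
  qed
  have R': "\<sigma> \<in> label_stab n r" if s: "\<sigma> \<in> label_stab (Suc n) r'" "\<sigma> n = n" for \<sigma>
  proof -
    have p: "\<sigma> permutes {..<n}" using s by (intro fix_n) (auto simp: label_stab_def)
    have "r (\<sigma> a) = r a" if "a < n" for a
      using s(1) r[OF that] r[OF lt[OF p that]] that by (simp add: label_stab_def)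
    then show ?thesis using p by (simp add: label_stab_def)
  qed
  have Mrn: "perm_mono \<sigma> m \<in> M" if "\<sigma> permutes {..<n}" "\<sigma> \<in> label_stab (Suc n) r' \<or> \<sigma> \<in> label_stab (Suc n) c'" "m \<in> M" for \<sigma> m
  proof -
    have "lookup (perm_mono \<sigma> m) (\<sigma> n) = lookup m n" by (rule lookup_perm_mono_image[OF permutes_bij[OF that(1)]])
    then show ?thesis using that Mr Mc in_Suc(2)[OF that(1)] by (auto simp: M)
  qed
  define \<kappa> where "\<kappa> = col_sum n c"
  define \<rho>' where "\<rho>' = row_sum (Suc n) r'"
  have \<kappa>': "col_sum (Suc n) c' = \<kappa>" by (simp add: \<kappa>_def col_sum_def[abs_def] C)
  have lin: "linear \<kappa>" "linear \<rho>'" by (simp_all add: \<kappa>_def \<rho>'_def linear_col_sum linear_row_sum)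
  have lcomp: "linear (\<lambda>p. \<rho>' (\<kappa> p))" "linear (\<lambda>p. row_sum n r (\<kappa> p))"
    using linear_compose[OF lin] linear_compose[OF lin(1) linear_row_sum] by (simp_all add: o_def)
  have Mst: "perm_mono \<sigma> m \<in> M" if "\<sigma> \<in> label_stab n c \<or> \<sigma> \<in> label_stab n r" "m \<in> M" for \<sigma> m
  proof (rule Mrn)
    show "\<sigma> permutes {..<n}" using that(1) by (auto simp: label_stab_def)
    show "\<sigma> \<in> label_stab (Suc n) r' \<or> \<sigma> \<in> label_stab (Suc n) c'" using that(1) C R by blast
  qed (rule that(2))
  have \<kappa>M: "\<kappa> p \<in> supported M" if "p \<in> supported M" for p
    unfolding \<kappa>_def
    by (rule label_stab_supported(1)[OF _ that]) (simp add: Mst)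
  have \<rho>M: "row_sum n r p \<in> supported M" if "p \<in> supported M" for p
    by (rule label_stab_supported(2)[OF _ that]) (simp add: Mst)
  define V where "V = (\<lambda>p. row_sum n r (\<kappa> p)) ` supported M"
  have sV: "subspace V" unfolding V_def by (rule linear_subspace_image[OF lcomp(2) subspace_supported])
  have idR: "id \<in> label_stab n f" for f :: "nat \<Rightarrow> 'l" by (simp add: label_stab_def permutes_id)
  have cR: "card (label_stab n r) > 0" using finite_label_stab idR card_gt_0_iff by blast
  \<comment> \<open>The larger row stabilizer contains the smaller one, so its sum absorbs the
    smaller sum up to a factor.\<close>
  have \<rho>\<rho>: "\<rho>' (row_sum n r p) = real (card (label_stab n r)) *\<^sub>R \<rho>' p" for p
  proof -
    have "\<rho>' (row_sum n r p) = (\<Sum>\<tau>\<in>label_stab n r. \<rho>' (perm_act \<tau> p))"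
      unfolding row_sum_def[of n r p] by (rule linear_sum[OF lin(2)])
    also have "\<dots> = (\<Sum>\<tau>\<in>label_stab n r. \<rho>' p)"
      unfolding \<rho>'_def using R by (intro sum.cong refl row_sum_perm_act) blast
    finally show ?thesis by (simp only: sum_constant_scaleR)
  qed
  have "\<rho>' ` V = (\<lambda>p. \<rho>' (\<kappa> p)) ` supported M"
  proof (intro equalityI subsetI)
    fix y assume "y \<in> \<rho>' ` V"
    then obtain p where p: "p \<in> supported M" "y = \<rho>' (row_sum n r (\<kappa> p))" by (auto simp: V_def)
    then have "y = \<rho>' (\<kappa> (real (card (label_stab n r)) *\<^sub>R p))" by (simp add: \<rho>\<rho> linear_cmul[OF lin(1)] linear_cmul[OF lin(2)])
    then show "y \<in> (\<lambda>p. \<rho>' (\<kappa> p)) ` supported M" using subspace_scale[OF subspace_supported p(1)] by blast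
  next
    fix y assume "y \<in> (\<lambda>p. \<rho>' (\<kappa> p)) ` supported M"
    then obtain p where p: "p \<in> supported M" "y = \<rho>' (\<kappa> p)" by blast
    define q where "q = (1 / real (card (label_stab n r))) *\<^sub>R p"
    have "\<rho>' (row_sum n r (\<kappa> q)) = y" using cR p by (simp add: \<rho>\<rho> q_def linear_cmul[OF lin(1)] linear_cmul[OF lin(2)])
    moreover have "q \<in> supported M" unfolding q_def by (rule subspace_scale[OF subspace_supported p(1)])
    ultimately show "y \<in> \<rho>' ` V" unfolding V_def by blast
  qed
  also have "\<dots> = (\<lambda>p. \<rho>' (\<kappa> p)) ` supported M'"
  proof
    show "(\<lambda>p. \<rho>' (\<kappa> p)) ` supported M \<subseteq> (\<lambda>p. \<rho>' (\<kappa> p)) ` supported M'"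
      by (intro image_mono) (auto simp: M supported_def)
    let ?U = "(\<lambda>p. \<rho>' (\<kappa> p)) ` supported M"
    have sU: "subspace ?U" by (rule linear_subspace_image[OF lcomp(1) subspace_supported])
    have gen: "\<rho>' (\<kappa> (single m 1)) \<in> ?U" if m: "m \<in> M'" for m
    proof (cases "\<exists>a b. a < n \<and> b < n \<and> a \<noteq> b \<and> c a = c b \<and> lookup m a = lookup m b")
      case True
      then obtain a b where ab: "a < n" "b < n" "a \<noteq> b" "c a = c b" "lookup m a = lookup m b" by blast
      define \<tau> where "\<tau> = Transposition.transpose a b"
      have p: "\<tau> permutes {..<n}" unfolding \<tau>_def using ab by (intro permutes_swap_id) auto
      have \<tau>C: "\<tau> \<in> label_stab n c" using p ab by (auto simp: label_stab_def \<tau>_def Transposition.transpose_def)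
      have "perm_mono \<tau> m = m"
        using ab(5) by (intro perm_mono_eqI permutes_bij[OF p]) (auto simp: \<tau>_def Transposition.transpose_def)
      then have "\<kappa> (single m 1) = - \<kappa> (single m 1)"
        using col_sum_perm_act[OF \<tau>C, of "single m 1"] ab(3)
        by (simp add: \<kappa>_def perm_act_single \<tau>_def sign_swap_id)
      then have "\<kappa> (single m 1) = 0"
        by (metis (no_types) add_eq_0_iff2 real_vector.scale_eq_0_iff scaleR_2 zero_neq_numeral)
      then show ?thesis using subspace_0[OF sU] linear_0[OF lin(2)] by simp
    next
      case False
      then obtain z where z: "z \<le> n" "lookup m z = 0" "r' z = r' n" "\<And>a. a \<le> n \<Longrightarrow> a \<noteq> z \<Longrightarrow> c' a \<noteq> c' z"
        using zero[OF m] by blast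
      \<comment> \<open>Both \<open>z\<close> and \<open>n\<close> are alone in their columns and
        lie in the same row. So \<tau> commutes with the column stabilizer, is absorbed by the row
        sum, and moves the exponent 0 from \<open>z\<close> to \<open>n\<close>.\<close>
      define \<tau> where "\<tau> = Transposition.transpose z n"
      have p: "\<tau> permutes {..<Suc n}" unfolding \<tau>_def using z by (intro permutes_swap_id) auto
      have b: "bij \<tau>" by (rule permutes_bij[OF p])
      have \<tau>R: "\<tau> \<in> label_stab (Suc n) r'" using p z(3) by (auto simp: label_stab_def \<tau>_def Transposition.transpose_def)
      have "lookup (perm_mono \<tau> m) (\<tau> z) = lookup m z" by (rule lookup_perm_mono_image[OF b])
      then have m1: "perm_mono \<tau> m \<in> M" using Mr[OF \<tau>R m] z(2) by (simp add: M \<tau>_def)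
      have comm: "\<tau> \<circ> \<sigma> = \<sigma> \<circ> \<tau>" if \<sigma>: "\<sigma> \<in> label_stab n c" for \<sigma>
      proof -
        have ps: "\<sigma> permutes {..<n}" using \<sigma> by (simp add: label_stab_def)
        have sn: "\<sigma> n = n" by (rule in_Suc(2)[OF ps])
        have sz: "\<sigma> z = z"
        proof (cases "z < n")
          case True
          then have "c' (\<sigma> z) = c' z" using \<sigma> c lt[OF ps] by (auto simp: label_stab_def)
          then show ?thesis using z(4)[of "\<sigma> z"] lt[OF ps True] by auto
        qed (use z(1) sn in simp)
        have inj: "\<sigma> x = \<sigma> y \<longleftrightarrow> x = y" for x y using permutes_inj[OF ps] by (auto simp: inj_eq)
        show ?thesis
        proof
          fix x
          show "(\<tau> \<circ> \<sigma>) x = (\<sigma> \<circ> \<tau>) x"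
            using sn sz inj[of x n] inj[of x z] by (auto simp: \<tau>_def Transposition.transpose_def)
        qed
      qed
      have "\<kappa> (perm_act \<tau> q) = perm_act \<tau> (\<kappa> q)" for q
        unfolding \<kappa>_def col_sum_def linear_sum[OF linear_perm_act] linear_cmul[OF linear_perm_act]
        by (intro sum.cong refl) (simp add: perm_act_comp label_stab_bij b comm)
      then have "\<rho>' (\<kappa> (perm_act \<tau> (single m 1))) = \<rho>' (\<kappa> (single m 1))"
        unfolding \<rho>'_def by (simp add: row_sum_perm_act[OF \<tau>R])
      then have "\<rho>' (\<kappa> (single m 1)) = \<rho>' (\<kappa> (single (perm_mono \<tau> m) 1))"
        by (simp add: perm_act_single)
      moreover have "single (perm_mono \<tau> m) 1 \<in> supported M" using m1 by (simp add: supported_def)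
      ultimately show ?thesis by blast
    qed
    have "(\<lambda>p. \<rho>' (\<kappa> p)) ` supported M' = span ((\<lambda>p. \<rho>' (\<kappa> p)) ` (\<lambda>m. single m 1) ` M')"
      unfolding supported_eq_span by (rule linear_span_image[OF lcomp(1), symmetric])
    also have "\<dots> \<subseteq> ?U" by (rule span_minimal[OF _ sU]) (use gen in blast)
    finally show "(\<lambda>p. \<rho>' (\<kappa> p)) ` supported M' \<subseteq> ?U" .
  qed
  finally have img: "\<rho>' ` V = (\<lambda>p. \<rho>' (\<kappa> p)) ` supported M'" .
  have ker: "v = 0" if v: "v \<in> V" "\<rho>' v = 0" for v
  proof (rule ccontr)
    assume "v \<noteq> 0"
    then obtain m where m: "lookup v m \<noteq> 0" by (metis lookup_zero poly_mapping_eqI)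
    have vM: "v \<in> supported M" using v(1) \<kappa>M \<rho>M by (auto simp: V_def)
    have inM: "m \<in> M" if "lookup v m \<noteq> 0" for m using vM that by (auto simp: supported_def in_keys_iff)
    have vR: "perm_act h v = v" if "h \<in> label_stab n r" for h
      using v(1) perm_act_row_sum[OF that] by (auto simp: V_def)
    \<comment> \<open>No cancellation is possible at \<open>m\<close>: if a translate by
      \<open>g\<close> has a nonzero coefficient there, the exponents of \<open>m\<close> at
      \<open>g n\<close> and \<open>n\<close> are both 0. Then the transposition of these letters
      fixes \<open>m\<close> and corrects \<open>g\<close> to an element of the smaller stabilizer,
      under which \<open>v\<close> is invariant.\<close>
    have entry: "lookup (perm_act g v) m = lookup v m \<or> lookup (perm_act g v) m = 0"
      if g: "g \<in> label_stab (Suc n) r'" for g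
    proof (cases "lookup (perm_act g v) m = 0")
      case False
      have b: "bij g" by (rule label_stab_bij[OF g])
      have pg: "g permutes {..<Suc n}" using g by (simp add: label_stab_def)
      define m' where "m' = perm_mono (inv_into UNIV g) m"
      have mm: "perm_mono g m' = m" using perm_mono_inv(2)[OF b] by (simp add: m'_def)
      have vm': "lookup (perm_act g v) m = lookup v m'" unfolding m'_def by (rule lookup_perm_act_inv[OF b])
      have z: "lookup m n = 0" "lookup m' n = 0" using inM[OF m] inM[of m'] vm' False by (auto simp: M)
      define \<tau> where "\<tau> = Transposition.transpose (g n) n"
      have gn: "g n < Suc n" using permutes_in_image[OF pg, of n] by simp
      have p\<tau>: "\<tau> permutes {..<Suc n}" unfolding \<tau>_def using gn by (intro permutes_swap_id) auto
      have "r' (g n) = r' n" using g by (simp add: label_stab_def)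
      then have \<tau>R: "\<tau> \<in> label_stab (Suc n) r'" using p\<tau> by (auto simp: label_stab_def \<tau>_def Transposition.transpose_def)
      have "\<tau> \<circ> g \<in> label_stab (Suc n) r'"
        using perm_subgroup_label_stab[of "Suc n" r'] \<tau>R g unfolding perm_subgroup_def by blast
      moreover have "(\<tau> \<circ> g) n = n" by (simp add: \<tau>_def)
      ultimately have h: "\<tau> \<circ> g \<in> label_stab n r" by (rule R')
      have "lookup m (g n) = lookup m' n" using lookup_perm_mono_image[OF b, of m' n] mm by simp
      then have "perm_mono \<tau> m = m"
        using z by (intro perm_mono_eqI permutes_bij[OF p\<tau>]) (auto simp: \<tau>_def Transposition.transpose_def)
      then have "perm_mono (\<tau> \<circ> g) m' = m"
        using perm_mono_comp[OF permutes_bij[OF p\<tau>] b, of m'] mm by simp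
      then have "lookup v m = lookup v m'"
        using lookup_perm_act[OF label_stab_bij[OF h], of v m'] vR[OF h] by simp
      then show ?thesis using vm' by simp
    qed simp
    let ?R = "label_stab (Suc n) r'"
    define S where "S = {g \<in> ?R. lookup (perm_act g v) m = lookup v m}"
    have "0 = lookup (\<rho>' v) m" using v(2) by simp
    also have "\<dots> = (\<Sum>g\<in>?R. lookup (perm_act g v) m)" by (simp add: \<rho>'_def row_sum_def lookup_sum)
    also have "\<dots> = (\<Sum>g\<in>?R. if g \<in> S then lookup v m else 0)"
      using entry by (intro sum.cong refl) (auto simp: S_def)
    also have "\<dots> = real (card S) * lookup v m"
    proof -
      have "S \<subseteq> ?R" by (auto simp: S_def)
      then show ?thesis using finite_label_stab[of "Suc n" r'] by (simp add: sum.inter_restrict[symmetric] Int_absorb1)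
    qed
    finally have "card S = 0" using m by simp
    moreover have "id \<in> S" by (simp add: S_def label_stab_def permutes_id)
    moreover have "finite S" using finite_label_stab[of "Suc n" r'] by (simp add: S_def)
    ultimately show False by auto
  qed
  have "inj_on \<rho>' V"
  proof (rule inj_onI)
    fix x y assume xy: "x \<in> V" "y \<in> V" "\<rho>' x = \<rho>' y"
    then have "x - y = 0" using ker[of "x - y"] subspace_diff[OF sV] linear_diff[OF lin(2)] by simp
    then show "x = y" by simp
  qed
  then have "dim (\<rho>' ` V) = dim V" by (rule dim_image_inj[OF lin(2) sV])
  then show ?thesis unfolding img by (simp add: V_def \<kappa>' \<kappa>_def \<rho>'_def)
qed

text \<open>Conjugation by \<iota> carries the stabilizers of \<open>r \<circ> \<iota>\<close> and
  \<open>c \<circ> \<iota>\<close> to those of \<open>r\<close> and \<open>c\<close>, so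
  \<open>perm_act \<iota>\<close> intertwines the symmetrizers and is injective.\<close>

lemma dim_symmetrized_relabel:
  fixes r c :: "nat \<Rightarrow> 'l"
  assumes \<iota>: "\<iota> permutes {..<n}" and M: "perm_mono \<iota> ` M = M'"
  shows "dim ((\<lambda>p. row_sum n (r \<circ> \<iota>) (col_sum n (c \<circ> \<iota>) p)) ` supported M) =
    dim ((\<lambda>p. row_sum n r (col_sum n c p)) ` supported M')"
proof -
  have b: "bij \<iota>" by (rule permutes_bij[OF \<iota>])
  note inv = permutes_inverses[OF \<iota>]
  have lt: "\<iota> a < n" "inv_into UNIV \<iota> a < n" if "a < n" for a
    using permutes_in_image[OF \<iota>, of a] permutes_in_image[OF permutes_inv[OF \<iota>], of a] that by simp_all
  have bij: "bij_betw (\<lambda>\<tau>. \<iota> \<circ> \<tau> \<circ> inv_into UNIV \<iota>) (label_stab n (f \<circ> \<iota>)) (label_stab n f)" for f :: "nat \<Rightarrow> 'l"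
  proof (rule bij_betw_byWitness[where f' = "\<lambda>\<tau>. inv_into UNIV \<iota> \<circ> \<tau> \<circ> \<iota>"])
    show "(\<lambda>\<tau>. \<iota> \<circ> \<tau> \<circ> inv_into UNIV \<iota>) ` label_stab n (f \<circ> \<iota>) \<subseteq> label_stab n f"
    proof clarify
      fix \<tau> assume \<tau>: "\<tau> \<in> label_stab n (f \<circ> \<iota>)"
      then have "f (\<iota> (\<tau> (inv_into UNIV \<iota> a))) = f a" if "a < n" for a
        using lt(2)[OF that] inv by (simp add: label_stab_def)
      then show "\<iota> \<circ> \<tau> \<circ> inv_into UNIV \<iota> \<in> label_stab n f"
        using \<tau> \<iota> by (auto simp: label_stab_def intro!: permutes_compose permutes_inv)
    qed
    show "(\<lambda>\<tau>. inv_into UNIV \<iota> \<circ> \<tau> \<circ> \<iota>) ` label_stab n f \<subseteq> label_stab n (f \<circ> \<iota>)"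
    proof clarify
      fix \<tau> assume \<tau>: "\<tau> \<in> label_stab n f"
      then have "f (\<iota> (inv_into UNIV \<iota> (\<tau> (\<iota> a)))) = f (\<iota> a)" if "a < n" for a
        using lt(1)[OF that] inv by (simp add: label_stab_def)
      then show "inv_into UNIV \<iota> \<circ> \<tau> \<circ> \<iota> \<in> label_stab n (f \<circ> \<iota>)"
        using \<tau> \<iota> by (auto simp: label_stab_def intro!: permutes_compose permutes_inv)
    qed
  qed (auto simp: fun_eq_iff inv)
  have conj: "perm_act (\<iota> \<circ> \<tau> \<circ> inv_into UNIV \<iota>) (perm_act \<iota> p) = perm_act \<iota> (perm_act \<tau> p)"
    if "bij \<tau>" for \<tau> p
  proof -
    have "\<iota> \<circ> \<tau> \<circ> inv_into UNIV \<iota> \<circ> \<iota> = \<iota> \<circ> \<tau>" by (auto simp: fun_eq_iff inv)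
    then show ?thesis using b that by (simp add: perm_act_comp bij_comp bij_imp_bij_inv)
  qed
  have row: "row_sum n r (perm_act \<iota> p) = perm_act \<iota> (row_sum n (r \<circ> \<iota>) p)" for p
  proof -
    have "row_sum n r (perm_act \<iota> p) = (\<Sum>\<tau>\<in>label_stab n (r \<circ> \<iota>). perm_act (\<iota> \<circ> \<tau> \<circ> inv_into UNIV \<iota>) (perm_act \<iota> p))"
      unfolding row_sum_def by (rule sum.reindex_bij_betw[OF bij, symmetric])
    also have "\<dots> = perm_act \<iota> (row_sum n (r \<circ> \<iota>) p)"
      unfolding row_sum_def linear_sum[OF linear_perm_act] by (intro sum.cong refl conj label_stab_bij)
    finally show ?thesis .
  qed
  have col: "col_sum n c (perm_act \<iota> p) = perm_act \<iota> (col_sum n (c \<circ> \<iota>) p)" for p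
  proof -
    have "col_sum n c (perm_act \<iota> p) = (\<Sum>\<tau>\<in>label_stab n (c \<circ> \<iota>). of_int (sign (\<iota> \<circ> \<tau> \<circ> inv_into UNIV \<iota>)) *\<^sub>R
        perm_act (\<iota> \<circ> \<tau> \<circ> inv_into UNIV \<iota>) (perm_act \<iota> p))"
      unfolding col_sum_def by (rule sum.reindex_bij_betw[OF bij, symmetric])
    also have "\<dots> = perm_act \<iota> (col_sum n (c \<circ> \<iota>) p)"
      unfolding col_sum_def linear_sum[OF linear_perm_act] linear_cmul[OF linear_perm_act]
    proof (intro sum.cong refl)
      fix \<tau> assume \<tau>: "\<tau> \<in> label_stab n (c \<circ> \<iota>)"
      then have "permutation \<tau>" "permutation \<iota>" "permutation (inv_into UNIV \<iota>)"
        using \<iota> permutes_inv[OF \<iota>] by (auto simp: label_stab_def intro: permutes_imp_permutation[rotated])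
      then have "sign (\<iota> \<circ> \<tau> \<circ> inv_into UNIV \<iota>) = sign \<tau>"
        by (simp add: sign_compose permutation_compose sign_inverse)
      then show "of_int (sign (\<iota> \<circ> \<tau> \<circ> inv_into UNIV \<iota>)) *\<^sub>R perm_act (\<iota> \<circ> \<tau> \<circ> inv_into UNIV \<iota>) (perm_act \<iota> p) =
          of_int (sign \<tau>) *\<^sub>R perm_act \<iota> (perm_act \<tau> p)"
        using conj[OF label_stab_bij[OF \<tau>]] by simp
    qed
    finally show ?thesis .
  qed
  have supp: "perm_act \<iota> ` supported M = supported M'"
  proof -
    have "perm_act \<iota> ` supported M = span (perm_act \<iota> ` (\<lambda>m. single m 1) ` M)"
      unfolding supported_eq_span by (rule linear_span_image[OF linear_perm_act, symmetric])
    also have "perm_act \<iota> ` (\<lambda>m. single m 1) ` M = (\<lambda>m. single m 1) ` M'"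
      unfolding M[symmetric] image_image by (simp add: perm_act_single)
    finally show ?thesis by (simp add: supported_eq_span)
  qed
  let ?E = "\<lambda>p. row_sum n (r \<circ> \<iota>) (col_sum n (c \<circ> \<iota>) p)"
  have "(\<lambda>p. row_sum n r (col_sum n c p)) ` supported M' = perm_act \<iota> ` ?E ` supported M"
    unfolding supp[symmetric] image_image by (simp add: row col)
  moreover have "subspace (?E ` supported M)"
    using linear_subspace_image[OF linear_compose[OF linear_col_sum[of n "c \<circ> \<iota>"] linear_row_sum[of n "r \<circ> \<iota>"]] subspace_supported[of M]]
    by (simp add: o_def)
  moreover have "inj_on (perm_act \<iota>) (?E ` supported M)"
  proof (rule inj_onI)
    fix x y assume "perm_act \<iota> x = perm_act \<iota> y"
    then have "perm_act (inv_into UNIV \<iota>) (perm_act \<iota> x) = perm_act (inv_into UNIV \<iota>) (perm_act \<iota> y)" by simp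
    then show "x = y" using b by (simp add: perm_act_comp bij_imp_bij_inv bij_is_inj)
  qed
  ultimately show ?thesis using dim_image_inj[OF linear_perm_act] by metis
qed

text \<open>The monomials that survive the projection by the sign changes; the flag \<open>q\<close>
  is false in type A, where there are none.\<close>

definition parity_monomials :: "bool \<Rightarrow> nat \<Rightarrow> nat \<Rightarrow> nat \<Rightarrow> (nat \<Rightarrow>\<^sub>0 nat) set" where
  "parity_monomials q k n d = {m \<in> monomials n d. q \<longrightarrow> (\<forall>i<n. odd (lookup m i) \<longleftrightarrow> k \<le> i)}"

definition symm_dim :: "bool \<Rightarrow> nat \<Rightarrow> nat \<Rightarrow> nat \<Rightarrow> (nat \<Rightarrow> cell) \<Rightarrow> nat" where
  "symm_dim q k n d f = dim ((\<lambda>p. row_sum n (row_of \<circ> f) (col_sum n (col_of \<circ> f) p)) ` supported (parity_monomials q k n d))"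

lemma diagram_add_to_first_part:
  assumes "0 \<notin> set \<alpha>"
  shows "diagram (add_to_first_part \<alpha>) = insert (0, if \<alpha> = [] then 0 else hd \<alpha>) (diagram \<alpha>)"
    and "(0, if \<alpha> = [] then 0 else hd \<alpha>) \<notin> diagram \<alpha>"
proof -
  show "diagram (add_to_first_part \<alpha>) = insert (0, if \<alpha> = [] then 0 else hd \<alpha>) (diagram \<alpha>)"
  proof (cases \<alpha>)
    case (Cons a as)
    then show ?thesis by (auto simp: diagram_def nth_Cons less_Suc_eq split: nat.splits)
  qed (auto simp: diagram_def)
  show "(0, if \<alpha> = [] then 0 else hd \<alpha>) \<notin> diagram \<alpha>"
    by (cases \<alpha>) (auto simp: diagram_def)
qed

lemma add_to_first_part_partitions:
  assumes "\<alpha> \<in> partitions k" shows "add_to_first_part \<alpha> \<in> partitions (Suc k)"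
  using assms by (cases \<alpha>) (auto simp: partitions_def intro: le_SucI)

text \<open>
  The letters \<open>0, \<dots>, k - 1\<close> and \<open>n\<close> fill the first tableau of the larger pair. If each of its columns
  with a zero exponent contained a second letter, at least half of these letters had nonzero exponent.
\<close>

lemma symm_dim_stable:
  assumes kn: "k \<le> n" and \<alpha>: "\<alpha> \<in> partitions k" and \<beta>: "\<beta> \<in> partitions (n - k)"
    and t: "tableau {..<k} \<alpha> t" and s: "tableau {k..<n} \<beta> s"
    and large: "if q then d \<le> n else k = n \<and> 2 * d \<le> n"
  obtains t' s' where "tableau {..<Suc k} (add_to_first_part \<alpha>) t'" "tableau {Suc k..<Suc n} \<beta> s'"
    "symm_dim q k n d (bitableau_cell k \<alpha> \<beta> t s) =
      symm_dim q (Suc k) (Suc n) d (bitableau_cell (Suc k) (add_to_first_part \<alpha>) \<beta> t' s')"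
proof -
  define x0 where "x0 = (0::nat, if \<alpha> = [] then 0 else hd \<alpha>)"
  define \<alpha>' where "\<alpha>' = add_to_first_part \<alpha>"
  have z\<alpha>: "0 \<notin> set \<alpha>" and sorted: "sorted_wrt (\<ge>) \<alpha>" using \<alpha> by (auto simp: partitions_def)
  have D: "diagram \<alpha>' = insert x0 (diagram \<alpha>)" "x0 \<notin> diagram \<alpha>"
    using diagram_add_to_first_part[OF z\<alpha>] by (simp_all add: x0_def \<alpha>'_def)
  \<comment> \<open>The extension lemma adds the letter \<open>n\<close>, but the enlarged first
    tableau must carry the letters \<open>0, ..., k\<close>. The cycle \<iota> sends
    \<open>n\<close> to \<open>k\<close> and shifts the letters of the second tableau up by
    one.\<close>
  define \<iota> where "\<iota> i = (if i < k then i else if i < n then Suc i else if i = n then k else i)" for i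
  have inj\<iota>: "inj_on \<iota> {..<Suc n}" by (auto simp: inj_on_def \<iota>_def kn split: if_splits)
  have "\<iota> ` {..<Suc n} = {..<Suc n}" by (rule endo_inj_surj[OF _ _ inj\<iota>]) (use kn in \<open>auto simp: \<iota>_def\<close>)
  then have "bij_betw \<iota> {..<Suc n} {..<Suc n}" using inj\<iota> by (simp add: bij_betw_def)
  then have p\<iota>: "\<iota> permutes {..<Suc n}" by (rule bij_imp_permutes) (use kn in \<open>auto simp: \<iota>_def\<close>)
  note b\<iota> = permutes_bij[OF p\<iota>]
  define t'' where "t'' = t(x0 := n)"
  define t' where "t' = \<iota> \<circ> t''"
  define s' where "s' = \<iota> \<circ> s"
  have bt: "bij_betw t (diagram \<alpha>) {..<k}" and bs: "bij_betw s (diagram \<beta>) {k..<n}"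
    using t s by (auto simp: tableau_def)
  have bt'': "bij_betw t'' (diagram \<alpha>') (insert n {..<k})"
  proof -
    have "bij_betw t'' (diagram \<alpha>) {..<k}"
      using bt by (rule bij_betw_cong[THEN iffD1, rotated]) (use D(2) in \<open>auto simp: t''_def\<close>)
    moreover have "t'' x0 = n" by (simp add: t''_def)
    ultimately show ?thesis using notIn_Un_bij_betw[OF D(2), of t'' "{..<k}"] kn by (simp add: D(1))
  qed
  have "\<iota> ` insert n {..<k} = {..<Suc k}" using kn by (auto simp: \<iota>_def image_iff split: if_splits)
  moreover have "insert n {..<k} \<subseteq> {..<Suc n}" using kn by auto
  ultimately have bi1: "bij_betw \<iota> (insert n {..<k}) {..<Suc k}"
    by (intro bij_betw_imageI inj_on_subset[OF inj\<iota>])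
  have "\<iota> ` {k..<n} = Suc ` {k..<n}" by (intro image_cong) (auto simp: \<iota>_def)
  then have "\<iota> ` {k..<n} = {Suc k..<Suc n}" by (simp add: image_Suc_atLeastLessThan)
  moreover have "{k..<n} \<subseteq> {..<Suc n}" by auto
  ultimately have bi2: "bij_betw \<iota> {k..<n} {Suc k..<Suc n}"
    by (intro bij_betw_imageI inj_on_subset[OF inj\<iota>])
  have tab: "tableau {..<Suc k} \<alpha>' t'" "tableau {Suc k..<Suc n} \<beta> s'"
    unfolding tableau_def t'_def s'_def using bij_betw_trans[OF bt'' bi1] bij_betw_trans[OF bs bi2] by simp_all
  define f where "f = bitableau_cell k \<alpha> \<beta> t s"
  define f' where "f' = bitableau_cell (Suc k) \<alpha>' \<beta> t' s'"
  have cf: "cell_map n k \<alpha> \<beta> f" unfolding f_def by (rule cell_map_bitableau_cell[OF kn t s])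
  have cf': "cell_map (Suc n) (Suc k) \<alpha>' \<beta> f'" unfolding f'_def by (rule cell_map_bitableau_cell[OF _ tab]) (use kn in simp)
  have inv': "inv_into (diagram \<alpha>') t' (t' x) = x" if "x \<in> diagram \<alpha>'" for x
    using that tab(1) by (simp add: tableau_def bij_betw_def)
  have invs': "inv_into (diagram \<beta>) s' (s' x) = x" if "x \<in> diagram \<beta>" for x
    using that tab(2) by (simp add: tableau_def bij_betw_def)
  have f'n: "f' (\<iota> n) = (True, x0)"
  proof -
    have "t' x0 = k" using kn by (simp add: t'_def t''_def \<iota>_def)
    moreover have "\<iota> n = k" using kn by (simp add: \<iota>_def)
    ultimately show ?thesis using inv'[of x0] D(1) by (simp add: f'_def bitableau_cell_def)
  qed
  have f'a: "f' (\<iota> a) = f a" if a: "a < n" for a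
  proof (cases "a < k")
    case True
    then have "a \<in> t ` diagram \<alpha>" using bt by (simp add: bij_betw_def)
    then obtain x where x: "x \<in> diagram \<alpha>" "t x = a" by auto
    have "x \<noteq> x0" using x D(2) by auto
    then have "t' x = \<iota> a" using x by (simp add: t'_def t''_def)
    then have "inv_into (diagram \<alpha>') t' (\<iota> a) = x" using inv'[of x] D(1) x by simp
    moreover have "inv_into (diagram \<alpha>) t a = x" using x bt by (auto simp: bij_betw_def)
    moreover have "\<iota> a < Suc k" using True by (simp add: \<iota>_def)
    ultimately show ?thesis using True by (simp add: f_def f'_def bitableau_cell_def)
  next
    case False
    then have "a \<in> s ` diagram \<beta>" using bs a by (simp add: bij_betw_def)
    then obtain x where x: "x \<in> diagram \<beta>" "s x = a" by auto
    then have "inv_into (diagram \<beta>) s' (\<iota> a) = x" using invs'[of x] by (simp add: s'_def)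
    moreover have "inv_into (diagram \<beta>) s a = x" using x bs by (auto simp: bij_betw_def)
    moreover have "\<not> \<iota> a < Suc k" using False a by (simp add: \<iota>_def)
    ultimately show ?thesis using False by (simp add: f_def f'_def bitableau_cell_def)
  qed
  define r where "r = row_of \<circ> f" define c where "c = col_of \<circ> f"
  define r' where "r' = (row_of \<circ> f') \<circ> \<iota>" define c' where "c' = (col_of \<circ> f') \<circ> \<iota>"
  have rn: "r' n = (True, 0)" and cn: "c' n = (True, snd x0)"
    using f'n by (simp_all add: r'_def c'_def x0_def)
  have inC: "f a \<in> cells \<alpha> \<beta>" if "a < n" for a using cf that by (auto simp: cell_map_def bij_betw_def)
  have fsta: "fst (f a) \<longleftrightarrow> a < k" if "a < n" for a using cf that by (simp add: cell_map_def)
  \<comment> \<open>The added cell lies just beyond the first row, the longest one, so its column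
    was empty.\<close>
  have new: "c a \<noteq> c' n" if "a < n" for a
  proof
    assume eq: "c a = c' n"
    obtain b i j where fa: "f a = (b, i, j)" by (metis prod.exhaust)
    have "b" "j = snd x0" using eq fa by (auto simp: c_def cn)
    then have "(i, snd x0) \<in> diagram \<alpha>" using inC[OF that] fa by (auto simp: cells_def)
    then have "i < length \<alpha>" "snd x0 < \<alpha> ! i" by (auto simp: diagram_def)
    moreover have "\<alpha> ! i \<le> \<alpha> ! 0" using sorted \<open>i < length \<alpha>\<close> by (cases i) (auto simp: sorted_wrt_iff_nth_less)
    ultimately have "x0 \<in> diagram \<alpha>" by (cases \<alpha>) (auto simp: diagram_def x0_def)
    then show False using D(2) by simp
  qed
  define M where "M = parity_monomials q k n d"
  \<comment> \<open>The monomials before renumbering: the new letter \<open>n\<close> belongs to the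
    first tableau, so under \<open>q\<close> its exponent is even.\<close>
  define M' where "M' = {m \<in> monomials (Suc n) d. q \<longrightarrow> (\<forall>i\<le>n. odd (lookup m i) \<longleftrightarrow> k \<le> i \<and> i < n)}"
  have MM': "M = {m \<in> M'. lookup m n = 0}"
  proof (intro equalityI subsetI)
    fix m assume m: "m \<in> M"
    then have "lookup m n = 0" by (auto simp: M_def parity_monomials_def monomials_def in_keys_iff)
    moreover have "m \<in> monomials (Suc n) d" using m by (fastforce simp: M_def parity_monomials_def monomials_def)
    ultimately show "m \<in> {m \<in> M'. lookup m n = 0}" using m by (auto simp: M_def M'_def parity_monomials_def le_less)
  next
    fix m assume m: "m \<in> {m \<in> M'. lookup m n = 0}"
    have "x < n" if "x \<in> keys m" for x
    proof -
      have "x \<noteq> n" using that m by (auto simp: in_keys_iff)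
      moreover have "x < Suc n" using that m by (auto simp: M'_def monomials_def)
      ultimately show ?thesis by simp
    qed
    then have "keys m \<subseteq> {..<n}" by blast
    then show "m \<in> M" using m by (auto simp: M_def M'_def parity_monomials_def monomials_def)
  qed
  have fstrc: "fst (r' a) \<longleftrightarrow> a < k \<or> a = n" "fst (c' a) \<longleftrightarrow> a < k \<or> a = n" if "a \<le> n" for a
    using f'n f'a[of a] fsta[of a] that kn by (cases "a = n"; simp add: r'_def c'_def)+
  have Mstab: "perm_mono \<sigma> m \<in> M'"
    if \<sigma>: "\<sigma> permutes {..<Suc n}" "\<And>a. a \<le> n \<Longrightarrow> (\<sigma> a < k \<or> \<sigma> a = n) \<longleftrightarrow> (a < k \<or> a = n)" and m: "m \<in> M'" for \<sigma> m
  proof -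
    have mm: "perm_mono \<sigma> m \<in> monomials (Suc n) d"
      using perm_mono_in_monomials[OF \<sigma>(1)] m by (simp add: M'_def)
    have "odd (lookup (perm_mono \<sigma> m) i) \<longleftrightarrow> k \<le> i \<and> i < n" if "i \<le> n" q for i
    proof -
      define a where "a = inv_into UNIV \<sigma> i"
      have i: "i = \<sigma> a" unfolding a_def by (simp add: permutes_inverses[OF \<sigma>(1)])
      have a: "a \<le> n" using permutes_in_image[OF permutes_inv[OF \<sigma>(1)], of i] that(1) by (simp add: a_def less_Suc_eq_le)
      have "lookup (perm_mono \<sigma> m) i = lookup m a" unfolding i by (rule lookup_perm_mono_image[OF permutes_bij[OF \<sigma>(1)]])
      then show ?thesis using m a that \<sigma>(2)[OF a] by (auto simp: M'_def i)
    qed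
    then show ?thesis using mm by (simp add: M'_def)
  qed
  have Mr: "perm_mono \<sigma> m \<in> M'" if \<sigma>: "\<sigma> \<in> label_stab (Suc n) r'" and m: "m \<in> M'" for \<sigma> m
  proof (rule Mstab[OF _ _ m])
    show p: "\<sigma> permutes {..<Suc n}" using \<sigma> by (simp add: label_stab_def)
    fix a assume a: "a \<le> n"
    have "\<sigma> a \<le> n" using permutes_in_image[OF p, of a] a by (simp add: less_Suc_eq_le)
    then show "(\<sigma> a < k \<or> \<sigma> a = n) \<longleftrightarrow> (a < k \<or> a = n)"
      using fstrc(1)[OF a] fstrc(1)[of "\<sigma> a"] \<sigma> a by (simp add: label_stab_def less_Suc_eq_le)
  qed
  have Mc: "perm_mono \<sigma> m \<in> M'" if \<sigma>: "\<sigma> \<in> label_stab (Suc n) c'" and m: "m \<in> M'" for \<sigma> m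
  proof (rule Mstab[OF _ _ m])
    show p: "\<sigma> permutes {..<Suc n}" using \<sigma> by (simp add: label_stab_def)
    fix a assume a: "a \<le> n"
    have "\<sigma> a \<le> n" using permutes_in_image[OF p, of a] a by (simp add: less_Suc_eq_le)
    then show "(\<sigma> a < k \<or> \<sigma> a = n) \<longleftrightarrow> (a < k \<or> a = n)"
      using fstrc(2)[OF a] fstrc(2)[of "\<sigma> a"] \<sigma> a by (simp add: label_stab_def less_Suc_eq_le)
  qed
  \<comment> \<open>Under \<open>q\<close> the letters counted have even nonzero exponents, at least
    2, and the other \<open>n - k\<close> letters have odd ones, so twice their number plus
    \<open>n - k\<close> is at most \<open>d \<le> n\<close>. Otherwise each counts only 1 in the
    degree, and \<open>2 * d \<le> n\<close> compensates for this.\<close>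
  have few: "2 * card {a \<in> insert n {..<k}. lookup m a \<noteq> 0} \<le> k" if m: "m \<in> M'" for m
  proof -
    let ?A = "{a \<in> insert n {..<k}. lookup m a \<noteq> 0}"
    have keys: "keys m \<subseteq> {..<Suc n}" and deg: "(\<Sum>i\<in>keys m. lookup m i) = d"
      using m by (auto simp: M'_def monomials_def)
    have Asub: "?A \<subseteq> keys m" by (auto simp: in_keys_iff)
    have finA: "finite ?A" by simp
    show ?thesis
    proof (cases q)
      case False
      have "card ?A \<le> (\<Sum>i\<in>?A. lookup m i)" using sum_mono[of ?A "\<lambda>_. 1" "lookup m"] by auto
      also have "\<dots> \<le> d" unfolding deg[symmetric] by (rule sum_mono2) (use Asub in auto)
      finally show ?thesis using large False by simp
    next
      case True
      have ev: "even (lookup m i) \<longleftrightarrow> \<not> (k \<le> i \<and> i < n)" if "i \<le> n" for i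
        using m True that by (auto simp: M'_def)
      have 2: "2 \<le> lookup m i" if "i \<in> ?A" for i
      proof -
        have "even (lookup m i)" using ev[of i] that kn by auto
        then show ?thesis using that by (auto elim!: evenE)
      qed
      have 1: "1 \<le> lookup m i" if "i \<in> {k..<n}" for i
      proof -
        have "odd (lookup m i)" using ev[of i] that by auto
        then show ?thesis by (auto elim!: oddE)
      qed
      have "2 * card ?A = (\<Sum>i\<in>?A. 2)" by simp
      also have "\<dots> \<le> (\<Sum>i\<in>?A. lookup m i)" using 2 by (rule sum_mono)
      finally have A: "2 * card ?A \<le> (\<Sum>i\<in>?A. lookup m i)" .
      have "n - k = (\<Sum>i\<in>{k..<n}. 1)" by simp
      also have "\<dots> \<le> (\<Sum>i\<in>{k..<n}. lookup m i)" using 1 by (rule sum_mono)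
      finally have "2 * card ?A + (n - k) \<le> (\<Sum>i\<in>?A. lookup m i) + (\<Sum>i\<in>{k..<n}. lookup m i)" using A by simp
      also have "\<dots> = (\<Sum>i\<in>?A \<union> {k..<n}. lookup m i)"
        by (rule sum.union_disjoint[symmetric]) (use kn in auto)
      also have "\<dots> \<le> d" unfolding deg[symmetric]
      proof (rule sum_mono2)
        show "?A \<union> {k..<n} \<subseteq> keys m" using Asub 1 by (force simp: in_keys_iff)
      qed auto
      finally show ?thesis using large True by simp
    qed
  qed
  have zero: "\<exists>z\<le>n. lookup m z = 0 \<and> r' z = r' n \<and> (\<forall>a\<le>n. a \<noteq> z \<longrightarrow> c' a \<noteq> c' z)"
    if m: "m \<in> M'" and dist: "\<And>a b. a < n \<Longrightarrow> b < n \<Longrightarrow> a \<noteq> b \<Longrightarrow> c a = c b \<Longrightarrow> lookup m a \<noteq> lookup m b" for m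
  proof (rule ccontr)
    assume none: "\<not> ?thesis"
    let ?A = "insert n {..<k}"
    let ?Z = "{a \<in> ?A. lookup m a = 0}" and ?Y = "{a \<in> ?A. lookup m a \<noteq> 0}"
    \<comment> \<open>A letter with exponent 0 that is alone in its column lies in the first row and
      would serve as \<open>z\<close>. So its column has a second letter, whose exponent is nonzero
      by \<open>dist\<close>.\<close>
    have ex: "\<exists>b. b \<in> ?Y \<and> c' b = c' a" if a: "a \<in> ?Z" for a
    proof -
      have an: "a \<le> n" using a kn by auto
      have c'c: "c' b = c b" if "b < n" for b using f'a[OF that] by (simp add: c'_def c_def)
      have "\<exists>b\<le>n. b \<noteq> a \<and> c' b = c' a"
      proof (rule ccontr)
        assume no: "\<not> (\<exists>b\<le>n. b \<noteq> a \<and> c' b = c' a)"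
        have "r' a = r' n"
        proof (cases "a = n")
          case False
          then have ak: "a < k" "a < n" using a kn by auto
          obtain i j where fa: "f a = (True, i, j)" using fsta[OF ak(2)] ak(1) by (metis prod.collapse)
          have "i = 0"
          proof (rule ccontr)
            assume "i \<noteq> 0"
            have ij: "i < length \<alpha>" "j < \<alpha> ! i" using inC[OF ak(2)] fa by (auto simp: cells_def diagram_def)
            moreover have "\<alpha> ! i \<le> \<alpha> ! 0" using sorted ij(1) \<open>i \<noteq> 0\<close> by (auto simp: sorted_wrt_iff_nth_less)
            ultimately have "(True, 0, j) \<in> cells \<alpha> \<beta>" by (auto simp: cells_def diagram_def)
            then have "(True, 0, j) \<in> f ` {..<n}" using cf by (simp add: cell_map_def bij_betw_def)
            then obtain b where b: "b < n" "f b = (True, 0, j)" by auto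
            have "c b = c a" using b fa by (simp add: c_def)
            moreover have "b \<noteq> a" using b fa \<open>i \<noteq> 0\<close> by auto
            moreover have "c' b = c b" "c' a = c a" using c'c b(1) ak(2) by auto
            moreover have "b \<le> n" using b(1) by simp
            ultimately show False using no by metis
          qed
          then show ?thesis using f'a[OF ak(2)] fa rn by (simp add: r'_def)
        qed simp
        then show False using none no a an by blast
      qed
      then obtain b where b: "b \<le> n" "b \<noteq> a" "c' b = c' a" by blast
      have "a \<noteq> n"
      proof
        assume "a = n"
        then have "b < n" using b by simp
        then show False using new[of b] c'c b \<open>a = n\<close> by simp
      qed
      moreover have "b \<noteq> n"
      proof
        assume "b = n"
        then have "a < n" using b an by simp
        then show False using new[of a] c'c b \<open>b = n\<close> by simp
      qed
      ultimately have lt: "a < n" "b < n" using an b by auto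
      then have "lookup m b \<noteq> 0" using dist[of a b] b c'c a by auto
      moreover have "b < k" using fstrc(2)[of b] fstrc(2)[of a] b lt a by auto
      ultimately show ?thesis using b(3) by auto
    qed
    define g where "g a = (SOME b. b \<in> ?Y \<and> c' b = c' a)" for a
    have g: "g a \<in> ?Y" "c' (g a) = c' a" if "a \<in> ?Z" for a
      using someI_ex[OF ex[OF that]] unfolding g_def by blast+
    \<comment> \<open>By \<open>dist\<close> a column contains at most one exponent 0. So at least
      half of the \<open>Suc k\<close> letters have nonzero exponent, against
      \<open>few\<close>.\<close>
    have "inj_on g ?Z"
    proof (rule inj_onI)
      fix x y assume xy: "x \<in> ?Z" "y \<in> ?Z" "g x = g y"
      then have eq: "c' x = c' y" using g(2) by metis
      show "x = y"
      proof (rule ccontr)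
        assume ne: "x \<noteq> y"
        have le: "x \<le> n" "y \<le> n" using xy kn by auto
        have c'c: "c' b = c b" if "b < n" for b using f'a[OF that] by (simp add: c'_def c_def)
        have "x < n" "y < n" using eq ne le new[of x] new[of y] c'c by (metis le_neq_implies_less)+
        then show False using dist[of x y] ne eq c'c xy by auto
      qed
    qed
    moreover have "g ` ?Z \<subseteq> ?Y" using g(1) by blast
    ultimately have "card ?Z \<le> card ?Y" by (rule card_inj_on_le) simp
    moreover have "card ?Z + card ?Y = card ?A"
      by (subst card_Un_disjoint[symmetric]) (auto intro!: arg_cong[where f = card])
    moreover have "card ?A = Suc k" using kn by simp
    ultimately show False using few[OF m] by simp
  qed
  have "symm_dim q k n d f = dim ((\<lambda>p. row_sum (Suc n) r' (col_sum (Suc n) c' p)) ` supported M')"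
    unfolding symm_dim_def M_def[symmetric] r_def[symmetric] c_def[symmetric]
  proof (rule dim_symmetrized_extend[OF _ _ new MM' Mr Mc zero])
    show "r' a = r a" "c' a = c a" if "a < n" for a using f'a[OF that] by (simp_all add: r'_def r_def c'_def c_def)
  qed
  also have "\<dots> = symm_dim q (Suc k) (Suc n) d f'"
    unfolding symm_dim_def r'_def c'_def
  proof (rule dim_symmetrized_relabel[OF p\<iota>])
    have odd_iff: "(q \<longrightarrow> (\<forall>i<Suc n. odd (lookup (perm_mono \<iota> m) i) \<longleftrightarrow> Suc k \<le> i)) \<longleftrightarrow>
        (q \<longrightarrow> (\<forall>i\<le>n. odd (lookup m i) \<longleftrightarrow> k \<le> i \<and> i < n))" for m
    proof -
      have "(\<forall>i<Suc n. odd (lookup (perm_mono \<iota> m) i) \<longleftrightarrow> Suc k \<le> i) \<longleftrightarrow>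
          (\<forall>i\<in>\<iota> ` {..<Suc n}. odd (lookup (perm_mono \<iota> m) i) \<longleftrightarrow> Suc k \<le> i)"
        using \<open>\<iota> ` {..<Suc n} = {..<Suc n}\<close> by auto
      also have "\<dots> \<longleftrightarrow> (\<forall>i\<in>{..<Suc n}. odd (lookup m i) \<longleftrightarrow> Suc k \<le> \<iota> i)"
        by (simp add: b\<iota>)
      also have "\<dots> \<longleftrightarrow> (\<forall>i\<le>n. odd (lookup m i) \<longleftrightarrow> k \<le> i \<and> i < n)"
      proof -
        have "Suc k \<le> \<iota> i \<longleftrightarrow> k \<le> i \<and> i < n" if "i \<le> n" for i using kn that by (auto simp: \<iota>_def)
        moreover have "i \<in> {..<Suc n} \<longleftrightarrow> i \<le> n" for i by auto
        ultimately show ?thesis by metis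
      qed
      finally show ?thesis by simp
    qed
    show "perm_mono \<iota> ` M' = parity_monomials q (Suc k) (Suc n) d"
    proof (intro equalityI subsetI)
      fix m assume "m \<in> perm_mono \<iota> ` M'"
      then obtain x where x: "m = perm_mono \<iota> x" "x \<in> monomials (Suc n) d"
        "q \<longrightarrow> (\<forall>i\<le>n. odd (lookup x i) \<longleftrightarrow> k \<le> i \<and> i < n)" by (auto simp: M'_def)
      show "m \<in> parity_monomials q (Suc k) (Suc n) d"
        unfolding parity_monomials_def mem_Collect_eq x(1) odd_iff
        using perm_mono_in_monomials[OF p\<iota> x(2)] x(3) by blast
    next
      fix m assume m: "m \<in> parity_monomials q (Suc k) (Suc n) d"
      define m' where "m' = perm_mono (inv_into UNIV \<iota>) m"
      have mm: "m = perm_mono \<iota> m'" using perm_mono_inv(2)[OF b\<iota>] by (simp add: m'_def)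
      have "m' \<in> monomials (Suc n) d"
        using perm_mono_in_monomials[OF permutes_inv[OF p\<iota>]] m by (simp add: m'_def parity_monomials_def)
      moreover have "q \<longrightarrow> (\<forall>i\<le>n. odd (lookup m' i) \<longleftrightarrow> k \<le> i \<and> i < n)"
        using m unfolding parity_monomials_def mem_Collect_eq mm odd_iff by blast
      ultimately have "m' \<in> M'" by (simp add: M'_def)
      then show "m \<in> perm_mono \<iota> ` M'" using mm by blast
    qed
  qed
  finally show ?thesis using that[OF tab[unfolded \<alpha>'_def]] by (simp add: f_def f'_def \<alpha>'_def)
qed

section \<open>Projecting away the sign changes\<close>

lemma chi_pair: "chi k n (\<sigma>, \<epsilon>) = chi k n (id, \<epsilon>)"
  by (simp add: chi_def)

lemma perm_mono_parity_monomials: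
  assumes \<sigma>: "\<sigma> \<in> block_perms k n" and m: "m \<in> parity_monomials q k n d"
  shows "perm_mono \<sigma> m \<in> parity_monomials q k n d"
proof -
  have p: "\<sigma> permutes {..<n}" and b: "\<And>a. a < n \<Longrightarrow> \<sigma> a < k \<longleftrightarrow> a < k" using \<sigma> by (auto simp: label_stab_def)
  have "odd (lookup (perm_mono \<sigma> m) i) \<longleftrightarrow> k \<le> i" if i: "i < n" q for i
  proof -
    define a where "a = inv_into UNIV \<sigma> i"
    have ia: "i = \<sigma> a" unfolding a_def by (simp add: permutes_inverses[OF p])
    have a: "a < n" using permutes_in_image[OF permutes_inv[OF p], of i] i(1) by (simp add: a_def)
    show ?thesis using m b[OF a] a i(2) permutes_bij[OF p] by (simp add: ia parity_monomials_def not_less[symmetric])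
  qed
  then show ?thesis using m perm_mono_in_monomials[OF p] by (simp add: parity_monomials_def)
qed

context bitableau
begin

definition sign_part :: "nat \<Rightarrow> real_mpoly \<Rightarrow> real_mpoly" where
  "sign_part d p = gsum (forms n d) ({id} \<times> N) (chi k n) p"

text \<open>Orthogonality of characters of \<open>N\<close> on each monomial: the product of
  \<open>chi\<close> with the eigenvalue is trivial on parity monomials, and on all others it takes
  the value -1, so that its sum over \<open>N\<close> vanishes.\<close>

definition orthogonal_signs :: "bool \<Rightarrow> nat \<Rightarrow> bool" where
  "orthogonal_signs q d \<longleftrightarrow> (\<forall>m\<in>monomials n d. if m \<in> parity_monomials q k n d
     then \<forall>\<epsilon>\<in>N. chi k n (id, \<epsilon>) * mono_sign \<epsilon> m = 1
     else \<exists>\<delta>\<in>N. chi k n (id, \<delta>) * mono_sign \<delta> m = -1)"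

lemma sign_part_eq: "sign_part d p = (\<Sum>\<epsilon>\<in>N. chi k n (id, \<epsilon>) *\<^sub>R rep_act (forms n d) (id, \<epsilon>) p)"
proof -
  have "{id} \<times> N = Pair (id :: nat \<Rightarrow> nat) ` N" by auto
  then show ?thesis by (simp add: sign_part_def gsum_def sum.reindex inj_on_def)
qed

lemma lookup_sign_part:
  assumes orth: "orthogonal_signs q d" and p: "p \<in> rep_space (forms n d)"
  shows "lookup (sign_part d p) m = (if m \<in> parity_monomials q k n d then real (card N) * lookup p m else 0)"
proof -
  define \<theta> where "\<theta> \<epsilon> = chi k n (id, \<epsilon>) * mono_sign \<epsilon> m" for \<epsilon>
  have "lookup (sign_part d p) m = (\<Sum>\<epsilon>\<in>N. \<theta> \<epsilon>) * lookup p m"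
    using lookup_forms_act[of id n d _ p m] by (simp add: sign_part_eq lookup_sum \<theta>_def sum_distrib_right mult.assoc)
  also have "\<dots> = (if m \<in> parity_monomials q k n d then real (card N) * lookup p m else 0)"
  proof (cases "m \<in> monomials n d")
    case False
    then have "lookup p m = 0" using p by (auto simp: rep_space_forms supported_def in_keys_iff)
    then show ?thesis by simp
  next
    case True
    show ?thesis
    proof (cases "m \<in> parity_monomials q k n d")
      case in_q: True
      then have "\<theta> \<epsilon> = 1" if "\<epsilon> \<in> N" for \<epsilon> using orth True that by (simp add: orthogonal_signs_def \<theta>_def)
      then show ?thesis using in_q by simp
    next
      case out_q: False
      then obtain \<delta> where \<delta>: "\<delta> \<in> N" "\<theta> \<delta> = -1" using orth[unfolded orthogonal_signs_def, rule_format, OF True] by (auto simp: \<theta>_def)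
      have inv: "(\<lambda>i. \<epsilon> i * \<delta> i * \<delta> i) = \<epsilon>" for \<epsilon>
        using N_square[OF \<delta>(1)] by (simp add: mult.assoc)
      \<comment> \<open>Translating the summation by \<delta> negates the sum, which is therefore
        0.\<close>
      have bij: "bij_betw (\<lambda>\<epsilon> i. \<epsilon> i * \<delta> i) N N"
        by (rule bij_betw_byWitness[where f' = "\<lambda>\<epsilon> i. \<epsilon> i * \<delta> i"]) (auto simp: inv N_mult \<delta>)
      have "\<theta> (\<lambda>i. \<epsilon> i * \<delta> i) = \<theta> \<epsilon> * \<theta> \<delta>" for \<epsilon>
        by (simp add: \<theta>_def chi_def mono_sign_mult prod.distrib)
      then have "(\<Sum>\<epsilon>\<in>N. \<theta> \<epsilon>) = (\<Sum>\<epsilon>\<in>N. \<theta> \<epsilon> * \<theta> \<delta>)"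
        using sum.reindex_bij_betw[OF bij, of \<theta>] by simp
      then have "(\<Sum>\<epsilon>\<in>N. \<theta> \<epsilon>) = 0" using \<delta>(2) by (simp add: sum_negf)
      then show ?thesis using out_q by simp
    qed
  qed
  finally show ?thesis .
qed

lemma forms_act_split:
  assumes "\<sigma> permutes {..<n}"
  shows "rep_act (forms n d) (\<sigma>, \<epsilon>) p = perm_act \<sigma> (rep_act (forms n d) (id, \<epsilon>) p)"
  using permutes_bij[OF assms] lookup_forms_act[of id n d \<epsilon> p]
  by (intro forms_act_eqI) (simp_all add: lookup_perm_act)

lemma gsum_col_group_forms: "gsum (forms n d) col_group (sgn_chi k n) p = col_sum n (col_of \<circ> cell) (sign_part d p)"
proof -
  have "gsum (forms n d) col_group (sgn_chi k n) p =
    (\<Sum>\<sigma>\<in>label_stab n (col_of \<circ> cell). \<Sum>\<epsilon>\<in>N. sgn_chi k n (\<sigma>, \<epsilon>) *\<^sub>R rep_act (forms n d) (\<sigma>, \<epsilon>) p)"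
    by (simp add: gsum_def col_group_def sum.cartesian_product case_prod_unfold)
  also have "\<dots> = col_sum n (col_of \<circ> cell) (sign_part d p)"
    unfolding col_sum_def sign_part_eq linear_sum[OF linear_perm_act] scaleR_sum_right
  proof (intro sum.cong refl)
    fix \<sigma> \<epsilon> assume "\<sigma> \<in> label_stab n (col_of \<circ> cell)"
    then have p: "\<sigma> permutes {..<n}" by (simp add: label_stab_def)
    show "sgn_chi k n (\<sigma>, \<epsilon>) *\<^sub>R rep_act (forms n d) (\<sigma>, \<epsilon>) p =
        of_int (sign \<sigma>) *\<^sub>R perm_act \<sigma> (chi k n (id, \<epsilon>) *\<^sub>R rep_act (forms n d) (id, \<epsilon>) p)"
      by (simp add: forms_act_split[OF p] sgn_chi_def chi_pair[of k n \<sigma>] linear_cmul[OF linear_perm_act])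
  qed
  finally show ?thesis .
qed

lemma gsum_row_group_forms: "gsum (forms n d) row_group (chi k n) p = row_sum n (row_of \<circ> cell) (sign_part d p)"
proof -
  have "gsum (forms n d) row_group (chi k n) p =
    (\<Sum>\<sigma>\<in>label_stab n (row_of \<circ> cell). \<Sum>\<epsilon>\<in>N. chi k n (\<sigma>, \<epsilon>) *\<^sub>R rep_act (forms n d) (\<sigma>, \<epsilon>) p)"
    by (simp add: gsum_def row_group_def sum.cartesian_product case_prod_unfold)
  also have "\<dots> = row_sum n (row_of \<circ> cell) (sign_part d p)"
    unfolding row_sum_def sign_part_eq linear_sum[OF linear_perm_act]
  proof (intro sum.cong refl)
    fix \<sigma> \<epsilon> assume "\<sigma> \<in> label_stab n (row_of \<circ> cell)"
    then have p: "\<sigma> permutes {..<n}" by (simp add: label_stab_def)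
    show "chi k n (\<sigma>, \<epsilon>) *\<^sub>R rep_act (forms n d) (\<sigma>, \<epsilon>) p =
        perm_act \<sigma> (chi k n (id, \<epsilon>) *\<^sub>R rep_act (forms n d) (id, \<epsilon>) p)"
      by (simp add: forms_act_split[OF p] chi_pair[of k n \<sigma>] linear_cmul[OF linear_perm_act])
  qed
  finally show ?thesis .
qed

text \<open>The projection by sign changes occurs in both symmetrizers, but after the column sum it
  acts as the scalar \<open>card N\<close>, because column permutations preserve the parity
  monomials.\<close>

lemma dim_symm:
  assumes orth: "orthogonal_signs q d"
  shows "dim (symm d ` rep_space (forms n d)) = symm_dim q k n d cell"
proof -
  let ?X = "supported (parity_monomials q k n d)"
  let ?C = "col_sum n (col_of \<circ> cell)" and ?R = "row_sum n (row_of \<circ> cell)"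
  let ?c = "real (card N)"
  have c: "?c \<noteq> 0" using card_N by simp
  have XH: "?X \<subseteq> rep_space (forms n d)" by (auto simp: supported_def rep_space_forms parity_monomials_def)
  have spX: "sign_part d p \<in> ?X" if "p \<in> rep_space (forms n d)" for p
    using lookup_sign_part[OF orth that] by (auto simp: supported_def in_keys_iff split: if_splits)
  have spid: "sign_part d p = ?c *\<^sub>R p" if p: "p \<in> ?X" for p
  proof (rule poly_mapping_eqI)
    fix m
    have "m \<notin> parity_monomials q k n d \<Longrightarrow> lookup p m = 0" using p by (auto simp: supported_def in_keys_iff)
    then show "lookup (sign_part d p) m = lookup (?c *\<^sub>R p) m"
      using lookup_sign_part[OF orth subsetD[OF XH p]] by simp
  qed
  have CX: "?C p \<in> ?X" if "p \<in> ?X" for p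
    by (rule label_stab_supported(1)[OF _ that], rule perm_mono_parity_monomials) (use stab_block(1) in auto)
  have eq: "symm d p = ?c *\<^sub>R ?R (?C (sign_part d p))" if p: "p \<in> rep_space (forms n d)" for p
    using spid[OF CX[OF spX[OF p]]]
    by (simp add: symm_def gsum_col_group_forms gsum_row_group_forms linear_cmul[OF linear_row_sum])
  have "symm d ` rep_space (forms n d) = (\<lambda>p. ?R (?C p)) ` ?X"
  proof (intro equalityI subsetI)
    fix y assume "y \<in> symm d ` rep_space (forms n d)"
    then obtain p where p: "p \<in> rep_space (forms n d)" "y = symm d p" by blast
    have "y = ?R (?C (?c *\<^sub>R sign_part d p))"
      using p eq by (simp add: linear_cmul[OF linear_row_sum] linear_cmul[OF linear_col_sum])
    then show "y \<in> (\<lambda>p. ?R (?C p)) ` ?X" using subspace_scale[OF subspace_supported spX[OF p(1)]] by blast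
  next
    fix y assume "y \<in> (\<lambda>p. ?R (?C p)) ` ?X"
    then obtain p where p: "p \<in> ?X" "y = ?R (?C p)" by blast
    define p' where "p' = (1 / (?c * ?c)) *\<^sub>R p"
    have p': "p' \<in> ?X" unfolding p'_def by (rule subspace_scale[OF subspace_supported p(1)])
    have "symm d p' = ?c *\<^sub>R ?R (?C (?c *\<^sub>R p'))" using eq[OF subsetD[OF XH p']] spid[OF p'] by simp
    also have "\<dots> = y" using c p(2) by (simp add: p'_def linear_cmul[OF linear_row_sum] linear_cmul[OF linear_col_sum])
    finally show "y \<in> symm d ` rep_space (forms n d)" using XH p' by blast
  qed
  then show ?thesis by (simp add: symm_dim_def)
qed

end

section \<open>The three families\<close>

text \<open>In type D the parity of the number of sign changes is expressed by a product, which is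
  multiplicative and invariant under permutations of the letters.\<close>

fun family_signs :: "family \<Rightarrow> nat \<Rightarrow> (nat \<Rightarrow> real) set" where
  "family_signs Type_A n = {\<lambda>_. 1}"
| "family_signs Type_B n = all_signs n"
| "family_signs Type_D n = {\<epsilon> \<in> all_signs n. (\<Prod>i<n. \<epsilon> i) = 1}"

lemma prod_signs:
  assumes "\<epsilon> \<in> all_signs n"
  shows "(\<Prod>i<n. \<epsilon> i) = (-1) ^ card {i. i < n \<and> \<epsilon> i = -1}"
proof -
  have "(\<Prod>i<n. \<epsilon> i) = (\<Prod>i<n. if \<epsilon> i = -1 then -1 else 1)"
    using assms by (intro prod.cong) (auto simp: all_signs_def)
  also have "\<dots> = (\<Prod>i\<in>{i. i < n \<and> \<epsilon> i = -1}. -1)"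
    by (subst prod.inter_filter[symmetric]) (auto intro!: prod.cong)
  finally show ?thesis by simp
qed

lemma family_group_eq: "family_group Z n = {\<sigma>. \<sigma> permutes {..<n}} \<times> family_signs Z n"
proof (cases Z)
  case Type_D
  have "even (card {i. i < n \<and> \<epsilon> i = -1}) \<longleftrightarrow> (\<Prod>i<n. \<epsilon> i) = 1" if "\<epsilon> \<in> all_signs n" for \<epsilon>
    unfolding prod_signs[OF that] by (simp add: minus_one_power_iff)
  then show ?thesis by (auto simp: Type_D carrier_hyperoctahedral_eq)
qed (auto simp: carrier_hyperoctahedral_eq)

lemma family_signs_subset: "family_signs Z n \<subseteq> all_signs n"
  by (cases Z) (auto simp: all_signs_def)

lemma signed_family_family: "signed_family n (family_signs Z n)"
proof -
  interpret A: signed_family n "all_signs n" by (rule signed_family_all)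
  show ?thesis
  proof
    fix \<epsilon> i assume "\<epsilon> \<in> family_signs Z n"
    then show "\<epsilon> i = 1 \<or> \<epsilon> i = -1" using family_signs_subset A.N_sign by blast
  next
    fix \<epsilon> i assume "\<epsilon> \<in> family_signs Z n" "n \<le> i"
    then show "\<epsilon> i = 1" using family_signs_subset A.N_beyond by blast
  next
    show "(\<lambda>_. 1) \<in> family_signs Z n" using A.N_one by (cases Z) auto
  next
    fix \<epsilon> \<delta> assume "\<epsilon> \<in> family_signs Z n" "\<delta> \<in> family_signs Z n"
    then show "(\<lambda>i. \<epsilon> i * \<delta> i) \<in> family_signs Z n"
      using A.N_mult by (cases Z) (auto simp: prod.distrib)
  next
    fix \<epsilon> \<sigma> assume e: "\<epsilon> \<in> family_signs Z n" and s: "\<sigma> permutes {..<n}"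
    have "(\<Prod>i<n. \<epsilon> (\<sigma> i)) = (\<Prod>i<n. \<epsilon> i)" using prod.permute[OF s, of \<epsilon>] by (simp add: o_def)
    then show "(\<lambda>i. \<epsilon> (\<sigma> i)) \<in> family_signs Z n"
      using e A.N_perm[OF _ s] by (cases Z) auto
  qed
qed

text \<open>The weights \<open>w\<close> describe a character of the sign changes. Flipping the
  letter \<open>i\<close> alone gives the value -1; in type D a letter \<open>l\<close> of even
  weight is flipped too, which restores the product 1 without changing the value.\<close>

lemma ex_family_sign_flip:
  assumes "Z \<noteq> Type_A" "i < n" "odd (w i)" "Z = Type_D \<Longrightarrow> \<exists>l<n. even (w l)"
  shows "\<exists>\<delta>\<in>family_signs Z n. (\<Prod>j<n. \<delta> j ^ w j) = -1"
proof -
  define flip where "flip S j = (if j \<in> S then -1 else 1 :: real)" for S :: "nat set" and j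
  have flip_prod: "(\<Prod>j<n. flip S j ^ v j) = (\<Prod>j\<in>S. (-1) ^ v j)" if "S \<subseteq> {..<n}" for S v
  proof -
    have "(\<Prod>j<n. flip S j ^ v j) = (\<Prod>j\<in>S. flip S j ^ v j)"
      by (rule prod.mono_neutral_right[OF _ that]) (auto simp: flip_def)
    then show ?thesis by (simp add: flip_def)
  qed
  have flip_all: "flip S \<in> all_signs n" if "S \<subseteq> {..<n}" for S
    using that by (auto simp: flip_def all_signs_def)
  show ?thesis
  proof (cases Z)
    case Type_B
    then show ?thesis using flip_all[of "{i}"] flip_prod[of "{i}" w] assms(2,3) by (intro bexI[of _ "flip {i}"]) auto
  next
    case Type_D
    then obtain l where l: "l < n" "even (w l)" using assms(4) by blast
    have il: "i \<noteq> l" using assms(3) l by auto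
    have "(\<Prod>j<n. flip {i, l} j) = 1" using flip_prod[of "{i, l}" "\<lambda>_. 1"] assms(2) l il by simp
    then show ?thesis using Type_D flip_all[of "{i, l}"] flip_prod[of "{i, l}" w] assms(2,3) l il
      by (intro bexI[of _ "flip {i, l}"]) auto
  qed (use assms in auto)
qed

lemma card_odd_exponents_le:
  assumes "m \<in> monomials n d" "finite A" "\<And>i. i \<in> A \<Longrightarrow> odd (lookup m i)"
  shows "card A \<le> d"
proof -
  have 1: "1 \<le> lookup m i" if "i \<in> A" for i using assms(3)[OF that] by (auto elim!: oddE)
  have "card A = (\<Sum>i\<in>A. 1)" by simp
  also have "\<dots> \<le> (\<Sum>i\<in>A. lookup m i)" using 1 by (rule sum_mono)
  also have "\<dots> \<le> (\<Sum>i\<in>keys m. lookup m i)"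
    by (rule sum_mono2) (use 1 in \<open>force simp: in_keys_iff\<close>)+
  also have "\<dots> = d" using assms(1) by (simp add: monomials_def)
  finally show ?thesis .
qed

lemma chi_mono_sign:
  assumes "k \<le> n" "m \<in> monomials n d"
  shows "chi k n (id, \<epsilon>) * mono_sign \<epsilon> m = (\<Prod>i<n. \<epsilon> i ^ ((if k \<le> i then 1 else 0) + lookup m i))"
proof -
  have "chi k n (id, \<epsilon>) = (\<Prod>i\<in>{k..<n}. \<epsilon> i ^ (if k \<le> i then 1 else 0))" by (simp add: chi_def)
  also have "\<dots> = (\<Prod>i<n. \<epsilon> i ^ (if k \<le> i then 1 else 0))"
    by (rule prod.mono_neutral_left) (auto split: if_splits)
  finally have 1: "chi k n (id, \<epsilon>) = (\<Prod>i<n. \<epsilon> i ^ (if k \<le> i then 1 else 0))" .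
  have "mono_sign \<epsilon> m = (\<Prod>i<n. \<epsilon> i ^ lookup m i)"
    unfolding mono_sign_def using assms(2)
    by (intro prod.mono_neutral_left) (auto simp: monomials_def in_keys_iff)
  then show ?thesis using 1 by (simp add: power_add prod.distrib)
qed

lemma card_diagram: "finite (diagram \<alpha>)" "card (diagram \<alpha>) = sum_list \<alpha>"
proof -
  have "diagram \<alpha> = Sigma {..<length \<alpha>} (\<lambda>i. {..<\<alpha> ! i})" by (auto simp: diagram_def)
  then show "finite (diagram \<alpha>)" "card (diagram \<alpha>) = sum_list \<alpha>"
    by (simp_all add: card_SigmaI sum_list_sum_nth lessThan_atLeast0)
qed

lemma ex_tableau:
  assumes "\<alpha> \<in> partitions m" "finite A" "card A = m"
  shows "\<exists>t. tableau A \<alpha> t"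
  using finite_same_card_bij[OF card_diagram(1) assms(2)] assms card_diagram(2)[of \<alpha>]
  by (simp add: tableau_def partitions_def)

lemma bitableau_family:
  assumes "k \<le> n" "\<alpha> \<in> partitions k" "\<beta> \<in> partitions (n - k)" "tableau {..<k} \<alpha> t" "tableau {k..<n} \<beta> s"
  shows "bitableau n (family_signs Z n) k \<alpha> \<beta> t s"
  using assms by (intro bitableau.intro bitableau_axioms.intro signed_family_family)

text \<open>In type D a monomial with the wrong parities could go undetected only if its odd
  exponents were exactly those of the first \<open>k\<close> letters, since this pattern gives the
  same character of the even sign changes. Its degree would be at least \<open>k\<close>, against
  \<open>d < k\<close>.\<close>

lemma orthogonal_signs_family:
  assumes bt: "bitableau n (family_signs Z n) k \<alpha> \<beta> t s" and D: "Z = Type_D \<Longrightarrow> d < k"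
  shows "bitableau.orthogonal_signs n (family_signs Z n) k (Z \<noteq> Type_A) d"
proof -
  interpret bitableau n "family_signs Z n" k \<alpha> \<beta> t s by (rule bt)
  show ?thesis
    unfolding orthogonal_signs_def
  proof
    fix m assume m: "m \<in> monomials n d"
    let ?w = "\<lambda>i. (if k \<le> i then 1 else 0) + lookup m i"
    show "if m \<in> parity_monomials (Z \<noteq> Type_A) k n d
      then \<forall>\<epsilon>\<in>family_signs Z n. chi k n (id, \<epsilon>) * mono_sign \<epsilon> m = 1
      else \<exists>\<delta>\<in>family_signs Z n. chi k n (id, \<delta>) * mono_sign \<delta> m = -1"
    proof (cases "m \<in> parity_monomials (Z \<noteq> Type_A) k n d")
      case True
      have "chi k n (id, \<epsilon>) * mono_sign \<epsilon> m = 1" if \<epsilon>: "\<epsilon> \<in> family_signs Z n" for \<epsilon>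
      proof (cases "Z = Type_A")
        case True
        then show ?thesis using \<epsilon> by (simp add: chi_def)
      next
        case False
        have "\<epsilon> i ^ ?w i = 1" if "i < n" for i
        proof -
          have "odd (lookup m i) \<longleftrightarrow> k \<le> i" using True False that by (simp add: parity_monomials_def)
          then have "even (?w i)" by (cases "k \<le> i") simp_all
          then obtain j where "?w i = 2 * j" by (rule evenE)
          then show ?thesis using N_square[OF \<epsilon>, of i] by (simp add: power_mult power2_eq_square)
        qed
        then show ?thesis unfolding chi_mono_sign[OF kn m] by simp
      qed
      then show ?thesis using True by simp
    next
      case False
      then have Z: "Z \<noteq> Type_A" using m by (auto simp: parity_monomials_def)
      obtain i where i: "i < n" "\<not> (odd (lookup m i) \<longleftrightarrow> k \<le> i)"
        using False m by (auto simp: parity_monomials_def)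
      have "\<exists>\<delta>\<in>family_signs Z n. (\<Prod>j<n. \<delta> j ^ ?w j) = -1"
      proof (rule ex_family_sign_flip[OF Z i(1)])
        show "odd (?w i)" using i(2) by auto
        assume "Z = Type_D"
        show "\<exists>l<n. even (?w l)"
        proof (rule ccontr)
          assume "\<not> ?thesis"
          then have odd_w: "odd (?w i)" if "i < n" for i using that by blast
          have "odd (lookup m i)" if "i \<in> {..<k}" for i using odd_w[of i] that kn by simp
          then have "k \<le> d" using card_odd_exponents_le[OF m, of "{..<k}"] by simp
          then show False using D[OF \<open>Z = Type_D\<close>] by simp
        qed
      qed
      then show ?thesis using False by (simp add: chi_mono_sign[OF kn m])
    qed
  qed
qed

text \<open>\<open>block_B\<close> contains single sign changes, and one of them corrects the parity
  in type D; this takes at least one letter.\<close>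

lemma covering_family:
  assumes bt: "bitableau n (family_signs Z n) k \<alpha> \<beta> t s" and "Z \<noteq> Type_A" "Z = Type_D \<Longrightarrow> 0 < n"
  shows "bitableau.covering n (family_signs Z n) k"
proof -
  interpret bitableau n "family_signs Z n" k \<alpha> \<beta> t s by (rule bt)
  interpret group \<Gamma> by (rule group_Gamma)
  show ?thesis
    unfolding covering_def
  proof
    fix x assume x: "x \<in> carrier \<Gamma>"
    obtain \<sigma> \<epsilon> where xe: "x = (\<sigma>, \<epsilon>)" by (cases x)
    have p: "\<sigma> permutes {..<n}" and e: "\<epsilon> \<in> all_signs n" using x by (auto simp: xe carrier_hyperoctahedral_eq)
    show "\<exists>h\<in>block_B. h \<otimes>\<^bsub>\<Gamma>\<^esub> x \<in> full"
    proof (cases "\<epsilon> \<in> family_signs Z n")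
      case True
      then have "\<one>\<^bsub>\<Gamma>\<^esub> \<otimes>\<^bsub>\<Gamma>\<^esub> x \<in> full" using x p by (simp add: xe)
      then show ?thesis using block_B_subset(3) by (rule bexI)
    next
      case False
      then have Z: "Z = Type_D" using e assms(2) by (cases Z) auto
      then have n: "0 < n" using assms(3) by simp
      have neg: "(\<Prod>i<n. \<epsilon> i) = -1"
        using False e Z prod_signs[OF e] by (auto simp: minus_one_power_iff split: if_splits)
      define \<delta> where "\<delta> i = (if i = 0 then -1 else 1 :: real)" for i :: nat
      have d: "\<delta> \<in> all_signs n" using n by (auto simp: all_signs_def \<delta>_def)
      have "(id, \<delta>) \<in> block_B" using d by (simp add: block_B_def label_stab_def permutes_id)
      moreover have "(id, \<delta>) \<otimes>\<^bsub>\<Gamma>\<^esub> x \<in> full"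
      proof -
        have "(\<lambda>i. \<delta> (\<sigma> i) * \<epsilon> i) \<in> all_signs n"
          using signed_family.N_mult[OF signed_family_all signed_family.N_perm[OF signed_family_all d p] e] .
        moreover have "(\<Prod>i<n. \<delta> (\<sigma> i)) = (\<Prod>i<n. \<delta> i)" using prod.permute[OF p, of \<delta>] by (simp add: o_def)
        moreover have "(\<Prod>i<n. \<delta> i) = -1" using n by (simp add: \<delta>_def)
        ultimately show ?thesis using p neg Z by (simp add: xe mult_hyperoctahedral prod.distrib)
      qed
      ultimately show ?thesis by (rule bexI[rotated])
    qed
  qed
qed

text \<open>On the even sign changes the two characters can agree only if \<sigma> interchanges the
  blocks, which forces \<open>k = n - k\<close>.\<close>

lemma separating_family:
  assumes bt: "bitableau n (family_signs Z n) k \<alpha> \<beta> t s" and Z: "Z \<noteq> Type_A" and D: "Z = Type_D \<Longrightarrow> k \<noteq> n - k"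
  shows "bitableau.separating n (family_signs Z n) k"
proof -
  interpret bitableau n "family_signs Z n" k \<alpha> \<beta> t s by (rule bt)
  show ?thesis
    unfolding separating_def
  proof (intro allI impI)
    fix \<sigma> assume p: "\<sigma> permutes {..<n}" and nb: "\<sigma> \<notin> block_perms k n"
    let ?w = "\<lambda>i. (if k \<le> i then 1 else 0) + (if k \<le> \<sigma> i then 1 else 0 :: nat)"
    have lt: "\<sigma> i < n" if "i < n" for i using permutes_in_image[OF p, of i] that by simp
    obtain i where i: "i < n" "\<not> (\<sigma> i < k \<longleftrightarrow> i < k)" using nb p by (auto simp: label_stab_def)
    have "\<exists>\<delta>\<in>family_signs Z n. (\<Prod>j<n. \<delta> j ^ ?w j) = -1"
    proof (rule ex_family_sign_flip[OF Z i(1)])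
      show "odd (?w i)" using i(2) by auto
      assume "Z = Type_D"
      show "\<exists>l<n. even (?w l)"
      proof (rule ccontr)
        assume "\<not> ?thesis"
        then have sw: "k \<le> \<sigma> l \<longleftrightarrow> l < k" if "l < n" for l using that by (auto split: if_splits)
        have "\<sigma> ` {..<k} \<subseteq> {k..<n}" using sw lt kn by auto
        then have "k \<le> n - k" using card_inj_on_le[OF permutes_inj_on[OF p], of "{..<k}" "{k..<n}"] by simp
        moreover have "\<sigma> ` {k..<n} \<subseteq> {..<k}" using sw by (auto simp: not_le[symmetric])
        then have "n - k \<le> k" using card_inj_on_le[OF permutes_inj_on[OF p], of "{k..<n}" "{..<k}"] by simp
        ultimately show False using D[OF \<open>Z = Type_D\<close>] by simp
      qed
    qed
    then obtain \<delta> where \<delta>: "\<delta> \<in> family_signs Z n" "(\<Prod>j<n. \<delta> j ^ ?w j) = -1" by blast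
    have shift: "(\<Prod>i\<in>{k..<n}. f i) = (\<Prod>i<n. f i ^ (if k \<le> i then 1 else 0))" for f :: "nat \<Rightarrow> real"
    proof -
      have "(\<Prod>i\<in>{k..<n}. f i) = (\<Prod>i\<in>{k..<n}. f i ^ (if k \<le> i then 1 else 0))" by simp
      also have "\<dots> = (\<Prod>i<n. f i ^ (if k \<le> i then 1 else 0))"
        by (rule prod.mono_neutral_left) (auto split: if_splits)
      finally show ?thesis .
    qed
    have "(\<Prod>i\<in>{k..<n}. \<delta> (inv_into UNIV \<sigma> i)) = (\<Prod>i<n. \<delta> (inv_into UNIV \<sigma> i) ^ (if k \<le> i then 1 else 0))"
      by (rule shift)
    also have "\<dots> = (\<Prod>i<n. \<delta> i ^ (if k \<le> \<sigma> i then 1 else 0))"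
      using prod.permute[OF p, of "\<lambda>i. \<delta> (inv_into UNIV \<sigma> i) ^ (if k \<le> i then 1 else 0)"]
      by (simp add: o_def permutes_inverses[OF p])
    finally have "(\<Prod>i\<in>{k..<n}. \<delta> i) * (\<Prod>i\<in>{k..<n}. \<delta> (inv_into UNIV \<sigma> i)) = (\<Prod>j<n. \<delta> j ^ ?w j)"
      by (simp add: shift[of \<delta>] power_add prod.distrib)
    then show "\<exists>\<delta>\<in>family_signs Z n. (\<Prod>i\<in>{k..<n}. \<delta> i) * (\<Prod>i\<in>{k..<n}. \<delta> (inv_into UNIV \<sigma> i)) = -1"
      using \<delta> by auto
  qed
qed

section \<open>Multiplicities in the three families as explicit ranks\<close>

lemma has_multiplicity_family_B:
  assumes kn: "k \<le> n" and \<alpha>: "\<alpha> \<in> partitions k" and \<beta>: "\<beta> \<in> partitions (n - k)"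
    and t: "tableau {..<k} \<alpha> t" and s: "tableau {k..<n} \<beta> s"
    and Z: "Z \<noteq> Type_A" and D: "Z = Type_D \<Longrightarrow> d < k \<and> k \<noteq> n - k"
  shows "has_multiplicity (family_group Z n) (forms n d) (specht_B \<alpha> \<beta>) (symm_dim True k n d (bitableau_cell k \<alpha> \<beta> t s))"
proof -
  have bt: "bitableau n (family_signs Z n) k \<alpha> \<beta> t s" by (rule bitableau_family[OF kn \<alpha> \<beta> t s])
  interpret bitableau n "family_signs Z n" k \<alpha> \<beta> t s by (rule bt)
  have "covering" using covering_family[OF bt Z] D kn by force
  moreover have "separating" using separating_family[OF bt Z] D by blast
  moreover have "orthogonal_signs True d" using orthogonal_signs_family[OF bt, of d] D Z by simp
  ultimately show ?thesis
    using has_multiplicity_specht_B[of d] dim_symm[of True d] by (simp add: family_group_eq cell_def)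
qed

lemma linear_eq_on_singles:
  fixes f g :: "('a \<Rightarrow>\<^sub>0 real) \<Rightarrow> 'v::real_vector"
  assumes "linear f" "linear g" "\<And>x. f (single x 1) = g (single x 1)"
  shows "f u = g u"
proof -
  have "f u = (\<Sum>x\<in>keys u. lookup u x *\<^sub>R f (single x 1))"
    by (subst (1) poly_mapping_sum_singles[of u]) (simp add: linear_sum[OF assms(1)] linear_cmul[OF assms(1)])
  also have "\<dots> = g u"
    unfolding assms(3)
    by (subst (3) poly_mapping_sum_singles[of u]) (simp add: linear_sum[OF assms(2)] linear_cmul[OF assms(2)])
  finally show ?thesis .
qed

lemma specht_space_empty: "specht_space {} [] = span {single (\<lambda>_. {}) 1}"
proof -
  have "tableau {} [] t" for t by (simp add: tableau_def diagram_def bij_betw_def)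
  moreover have "polytabloid {} [] t = single (\<lambda>_. {}) 1" for t
  proof -
    have "column_stabilizer {} [] t = {id}" by (auto simp: column_stabilizer_def diagram_def)
    then show ?thesis by (simp add: polytabloid_def tabloid_of_def diagram_def permute_tabloid_def)
  qed
  ultimately show ?thesis by (simp add: specht_space_def)
qed

text \<open>Tensoring with the tabloid of empty shape identifies \<open>specht_A\<close> with
  \<open>block_rep\<close> for the empty second partition, so the result for \<open>k = n\<close>
  carries over.\<close>

lemma has_multiplicity_family_A:
  assumes \<alpha>: "\<alpha> \<in> partitions n" and t: "tableau {..<n} \<alpha> t" and s: "tableau {n..<n} [] s"
  shows "has_multiplicity (family_group Type_A n) (forms n d) (specht_A \<alpha>)
    (symm_dim False n n d (bitableau_cell n \<alpha> [] t s))"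
proof -
  have bt: "bitableau n (family_signs Type_A n) n \<alpha> [] t s"
    using \<alpha> t s by (intro bitableau_family) (auto simp: partitions_def)
  interpret bitableau n "family_signs Type_A n" n \<alpha> "[]" t s by (rule bt)
  let ?G = "family_group Type_A n"
  have orth: "orthogonal_signs False d" using orthogonal_signs_family[OF bt, of d] by simp
  have mult: "has_multiplicity ?G (forms n d) (block_rep \<alpha> []) (symm_dim False n n d (bitableau_cell n \<alpha> [] t s))"
    using has_multiplicity_block[OF refl, of d] dim_symm[OF orth] by (simp add: family_group_eq cell_def)
  have sn: "sum_list \<alpha> = n" using part_sums by simp
  define e where "e = (\<lambda>_ :: nat. {} :: nat set)"
  define f where "f u = tensor u (single e 1)" for u :: "tabloid \<Rightarrow>\<^sub>0 real"
  have lf: "linear f" unfolding f_def by (rule linear_tensor)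
  have f_single: "f (single x c) = single (x, e) c" for x c
    by (simp add: f_def tensor_single)
  have f_look: "lookup (f u) (x, e) = lookup u x" for u x
  proof -
    have "f u = linear_extension (\<lambda>x. single (x, e) 1) u"
      by (simp add: f_def tensor_def)
    then show ?thesis using lookup_monomial_map[of "\<lambda>x. (x, e)" "\<lambda>_. 1" u x] by (simp add: inj_on_def)
  qed
  have injf: "inj f"
  proof (rule injI)
    fix u v assume "f u = f v"
    then show "u = v" using f_look by (intro poly_mapping_eqI) metis
  qed
  let ?P = "{polytabloid {..<n} \<alpha> t | t. tableau {..<n} \<alpha> t}"
  have SA: "rep_space (specht_A \<alpha>) = span ?P" by (simp add: specht_A_def specht_space_def sn)
  have "rep_space (block_rep \<alpha> []) = span {tensor u v | u v. u \<in> span ?P \<and> v \<in> span {single e 1}}"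
    by (simp add: block_rep_def Let_def sn specht_space_empty e_def) (simp add: specht_space_def)
  also have "\<dots> = span (f ` ?P)"
    unfolding span_tensor f_def by (rule arg_cong[where f = span]) blast
  also have "\<dots> = f ` rep_space (specht_A \<alpha>)" unfolding SA by (rule linear_span_image[OF lf])
  finally have img: "f ` rep_space (specht_A \<alpha>) = rep_space (block_rep \<alpha> [])" by simp
  have eq: "f (rep_act (specht_A \<alpha>) g u) = rep_act (block_rep \<alpha> []) g (f u)" if g: "g \<in> ?G" for g u
  proof (rule linear_eq_on_singles[of "\<lambda>u. f (rep_act (specht_A \<alpha>) g u)" "\<lambda>u. rep_act (block_rep \<alpha> []) g (f u)"])
    obtain \<sigma> where ge: "g = (\<sigma>, \<lambda>_. 1)" using g by auto
    have "linear (rep_act (specht_A \<alpha>) g)" by (simp add: ge specht_A_def linear_linear_extension)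
    from linear_compose[OF this lf] show "linear (\<lambda>u. f (rep_act (specht_A \<alpha>) g u))" by (simp add: o_def)
    from linear_compose[OF lf linear_pair_act[of n n g]] show "linear (\<lambda>u. rep_act (block_rep \<alpha> []) g (f u))"
      by (simp add: o_def block_act)
    show "f (rep_act (specht_A \<alpha>) g (single x 1)) = rep_act (block_rep \<alpha> []) g (f (single x 1))" for x
      by (simp add: ge specht_A_def f_single block_act pair_act_single permute_pair_def chi_def)
        (simp add: permute_tabloid_def e_def)
  qed
  have full: "?G = full" by (simp add: family_group_eq)
  have block_G_full: "block_G = full" using permutes_in_image unfolding block_G_def label_stab_def by fastforce
  show ?thesis
  proof (rule has_multiplicity_cong[OF _ _ _ mult])
    show "subspace (rep_space (specht_A \<alpha>))" unfolding SA by simp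
    show "\<forall>g\<in>?G. \<forall>v\<in>rep_space (specht_A \<alpha>). rep_act (specht_A \<alpha>) g v \<in> rep_space (specht_A \<alpha>)"
    proof (intro ballI)
      fix g v assume g: "g \<in> ?G" and v: "v \<in> rep_space (specht_A \<alpha>)"
      have "g \<in> block_G" using g by (simp only: full block_G_full)
      then have "rep_act (block_rep \<alpha> []) g (f v) \<in> rep_space (block_rep \<alpha> [])"
        using group_repD(3)[OF group_rep_block] img v by blast
      then obtain v' where "v' \<in> rep_space (specht_A \<alpha>)" "f (rep_act (specht_A \<alpha>) g v) = f v'"
        unfolding eq[OF g] img[symmetric] by blast
      then show "rep_act (specht_A \<alpha>) g v \<in> rep_space (specht_A \<alpha>)" using injD[OF injf] by metis
    qed
    show "isomorphic_reps ?G (specht_A \<alpha>) (block_rep \<alpha> [])"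
      unfolding isomorphic_reps_def
      using lf img eq inj_on_subset[OF injf] by (intro exI[of _ f]) (auto simp: bij_betw_def)
  qed
qed

lemma parity_monomials_empty:
  assumes "d < n - k" shows "parity_monomials True k n d = {}"
proof -
  have False if m: "m \<in> parity_monomials True k n d" for m
  proof -
    have "card {k..<n} \<le> d" using m by (intro card_odd_exponents_le[of m n d]) (auto simp: parity_monomials_def)
    then show False using assms by simp
  qed
  then show ?thesis by blast
qed

lemma symm_dim_zero:
  assumes "d < n - k" shows "symm_dim True k n d f = 0"
proof -
  let ?E = "\<lambda>p. row_sum n (row_of \<circ> f) (col_sum n (col_of \<circ> f) p)"
  have "supported ({} :: (nat \<Rightarrow>\<^sub>0 nat) set) = {0}" by (auto simp: supported_def)
  then have "?E ` supported (parity_monomials True k n d) \<subseteq> span {}"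
    by (simp add: parity_monomials_empty[OF assms] linear_0[OF linear_row_sum] linear_0[OF linear_col_sum])
  then have "dim (?E ` supported (parity_monomials True k n d)) \<le> card ({} :: real_mpoly set)"
    by (rule dim_le_card) simp
  then show ?thesis by (simp add: symm_dim_def)
qed

text \<open>No monomial of degree \<open>d\<close> has odd exponents on the whole second block or on
  the whole first block, so the part of the forms on which the sign changes act through
  \<open>chi\<close> vanishes. As \<open>W\<close> is arbitrary, both constituents for equal
  partitions are covered.\<close>

lemma has_multiplicity_family_D_zero:
  assumes kn: "k \<le> n" and \<alpha>: "\<alpha> \<in> partitions k" and \<beta>: "\<beta> \<in> partitions (n - k)"
    and d: "d < k" "d < n - k"
    and W: "submodule (family_group Type_D n) (specht_B \<alpha> \<beta>) W" "W \<noteq> {0}"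
  shows "has_multiplicity (family_group Type_D n) (forms n d) (subrep (specht_B \<alpha> \<beta>) W) 0"
proof -
  obtain t where t: "tableau {..<k} \<alpha> t" using ex_tableau[OF \<alpha>, of "{..<k}"] by auto
  obtain s where s: "tableau {k..<n} \<beta> s" using ex_tableau[OF \<beta>, of "{k..<n}"] by auto
  have bt: "bitableau n (family_signs Type_D n) k \<alpha> \<beta> t s" by (rule bitableau_family[OF kn \<alpha> \<beta> t s])
  interpret bitableau n "family_signs Type_D n" k \<alpha> \<beta> t s by (rule bt)
  have cov: "covering" using covering_family[OF bt] d kn by simp
  have orth: "orthogonal_signs True d" using orthogonal_signs_family[OF bt, of d] d by simp
  have "gsum (forms n d) ({id} \<times> family_signs Type_D n) (chi k n) p = 0" if "p \<in> rep_space (forms n d)" for p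
    using lookup_sign_part[OF orth that] unfolding sign_part_def parity_monomials_empty[OF d(2)]
    by (intro poly_mapping_eqI) simp
  then show ?thesis using has_multiplicity_zero[OF cov, of W d] W by (simp add: family_group_eq)
qed

lemma specht_B_submodule:
  assumes kn: "k \<le> n" and \<alpha>: "\<alpha> \<in> partitions k" and \<beta>: "\<beta> \<in> partitions (n - k)"
  shows "submodule (family_group Z n) (specht_B \<alpha> \<beta>) (rep_space (specht_B \<alpha> \<beta>))"
    and "rep_space (specht_B \<alpha> \<beta>) \<noteq> {0}"
proof -
  obtain t where t: "tableau {..<k} \<alpha> t" using ex_tableau[OF \<alpha>, of "{..<k}"] by auto
  obtain s where s: "tableau {k..<n} \<beta> s" using ex_tableau[OF \<beta>, of "{k..<n}"] by auto
  interpret bitableau n "family_signs Z n" k \<alpha> \<beta> t s by (rule bitableau_family[OF kn \<alpha> \<beta> t s])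
  show "submodule (family_group Z n) (specht_B \<alpha> \<beta>) (rep_space (specht_B \<alpha> \<beta>))"
    using group_rep_ind_full unfolding family_group_eq ind_def group_rep_def submodule_def by blast
  have "poly0 \<noteq> 0" using gsum_row_group_poly0 linear_0[OF linear_gsum_pair] by metis
  then have "ext poly0 \<noteq> 0" using lookup_ext_one[of poly0] by auto
  then show "rep_space (specht_B \<alpha> \<beta>) \<noteq> {0}" using ext_in_ind[OF poly0_in_block] by (auto simp: ind_def)
qed

section \<open>Stability in each family\<close>

lemma stable_at_A:
  assumes "2 * d \<le> n" shows "stable_at Type_A d n"
  unfolding stable_at_def
proof (clarify, goal_cases)
  case (1 \<alpha> \<beta>)
  then have \<alpha>: "\<alpha> \<in> partitions n" and \<beta>: "\<beta> = []" by auto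
  have nil: "[] \<in> partitions (n - n)" by (simp add: partitions_def)
  obtain t where t: "tableau {..<n} \<alpha> t" using ex_tableau[OF \<alpha>, of "{..<n}"] by auto
  obtain s where s: "tableau {n..<n} [] s" using ex_tableau[OF nil, of "{n..<n}"] by auto
  obtain t' s' where ts': "tableau {..<Suc n} (add_to_first_part \<alpha>) t'" "tableau {Suc n..<Suc n} [] s'"
    "symm_dim False n n d (bitableau_cell n \<alpha> [] t s) =
      symm_dim False (Suc n) (Suc n) d (bitableau_cell (Suc n) (add_to_first_part \<alpha>) [] t' s')"
    using symm_dim_stable[OF le_refl \<alpha> nil t s, of False d] assms by auto
  show ?case
    using has_multiplicity_family_A[OF \<alpha> t s, of d]
      has_multiplicity_family_A[OF add_to_first_part_partitions[OF \<alpha>] ts'(1,2), of d] ts'(3) \<beta> by auto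
qed

lemma specht_B_stable:
  assumes Z: "Z \<noteq> Type_A" and kn: "k \<le> n" and \<alpha>: "\<alpha> \<in> partitions k" and \<beta>: "\<beta> \<in> partitions (n - k)"
    and d: "d \<le> n" and D: "Z = Type_D \<Longrightarrow> d < k \<and> n - k < k"
  shows "\<exists>m. has_multiplicity (family_group Z n) (forms n d) (specht_B \<alpha> \<beta>) m \<and>
    has_multiplicity (family_group Z (Suc n)) (forms (Suc n) d) (specht_B (add_to_first_part \<alpha>) \<beta>) m"
proof -
  obtain t where t: "tableau {..<k} \<alpha> t" using ex_tableau[OF \<alpha>, of "{..<k}"] by auto
  obtain s where s: "tableau {k..<n} \<beta> s" using ex_tableau[OF \<beta>, of "{k..<n}"] by auto
  obtain t' s' where ts': "tableau {..<Suc k} (add_to_first_part \<alpha>) t'" "tableau {Suc k..<Suc n} \<beta> s'"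
    "symm_dim True k n d (bitableau_cell k \<alpha> \<beta> t s) =
      symm_dim True (Suc k) (Suc n) d (bitableau_cell (Suc k) (add_to_first_part \<alpha>) \<beta> t' s')"
    using symm_dim_stable[OF kn \<alpha> \<beta> t s, of True d] d by auto
  have "has_multiplicity (family_group Z n) (forms n d) (specht_B \<alpha> \<beta>) (symm_dim True k n d (bitableau_cell k \<alpha> \<beta> t s))"
    using D by (intro has_multiplicity_family_B[OF kn \<alpha> \<beta> t s Z]) auto
  moreover have "has_multiplicity (family_group Z (Suc n)) (forms (Suc n) d) (specht_B (add_to_first_part \<alpha>) \<beta>)
      (symm_dim True (Suc k) (Suc n) d (bitableau_cell (Suc k) (add_to_first_part \<alpha>) \<beta> t' s'))"
  proof (rule has_multiplicity_family_B[OF _ add_to_first_part_partitions[OF \<alpha>] _ ts'(1,2) Z])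
    show "d < Suc k \<and> Suc k \<noteq> Suc n - Suc k" if "Z = Type_D" using D[OF that] by auto
  qed (use kn \<beta> in simp_all)
  ultimately show ?thesis using ts'(3) by auto
qed

lemma stable_at_B:
  assumes "d \<le> n" shows "stable_at Type_B d n"
  unfolding stable_at_def
proof (clarify, goal_cases)
  case (1 \<alpha> \<beta>)
  then obtain k where k: "k \<le> n" "\<alpha> \<in> partitions k" "\<beta> \<in> partitions (n - k)" by auto
  show ?case using specht_B_stable[OF _ k assms, of Type_B] by simp
qed

text \<open>The larger block has more than \<open>d\<close> letters. If the blocks have equal size,
  exchanging them destroys \<open>separating\<close> and with it the rank argument at
  \<open>n\<close>; but then both blocks have more than \<open>d\<close> letters, and the
  multiplicities at \<open>n\<close> and \<open>Suc n\<close> are both 0.\<close>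

lemma stable_at_D:
  assumes n: "2 * d < n" shows "stable_at Type_D d n"
  unfolding stable_at_def
proof (clarify, goal_cases)
  case (1 \<alpha> \<beta>)
  then obtain k where k: "k \<le> n" "\<alpha> \<in> partitions k" "\<beta> \<in> partitions (n - k)" and le: "n - k \<le> k" by auto
  have dk: "d < k" using n le k(1) by linarith
  have \<alpha>': "add_to_first_part \<alpha> \<in> partitions (Suc k)" by (rule add_to_first_part_partitions[OF k(2)])
  \<comment> \<open>The enlarged first partition has a larger sum than \<beta>, so at
    \<open>Suc n\<close> the case of equal partitions in \<open>occurs\<close> cannot arise.\<close>
  have ne': "add_to_first_part \<alpha> \<noteq> \<beta>" using \<alpha>' k(3) le by (auto simp: partitions_def)
  show ?case
  proof (cases "n - k = k")
    case False
    then have "\<alpha> \<noteq> \<beta>" using k by (auto simp: partitions_def)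
    then show ?thesis using specht_B_stable[OF _ k, of Type_D d] dk le False n ne' by simp
  next
    case True
    have \<beta>': "\<beta> \<in> partitions (Suc n - Suc k)" and kn': "Suc k \<le> Suc n" using k by simp_all
    obtain t' where t': "tableau {..<Suc k} (add_to_first_part \<alpha>) t'" using ex_tableau[OF \<alpha>', of "{..<Suc k}"] by auto
    obtain s' where s': "tableau {Suc k..<Suc n} \<beta> s'" using ex_tableau[OF \<beta>', of "{Suc k..<Suc n}"] by auto
    have "has_multiplicity (family_group Type_D (Suc n)) (forms (Suc n) d) (specht_B (add_to_first_part \<alpha>) \<beta>)
        (symm_dim True (Suc k) (Suc n) d (bitableau_cell (Suc k) (add_to_first_part \<alpha>) \<beta> t' s'))"
      using dk True by (intro has_multiplicity_family_B[OF kn' \<alpha>' \<beta>' t' s']) auto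
    moreover have "symm_dim True (Suc k) (Suc n) d (bitableau_cell (Suc k) (add_to_first_part \<alpha>) \<beta> t' s') = 0"
      using dk True by (intro symm_dim_zero) simp
    ultimately have next_zero: "occurs Type_D (n + 1) d (add_to_first_part \<alpha>, \<beta>) 0" using ne' by simp
    have zero: "has_multiplicity (family_group Type_D n) (forms n d) (subrep (specht_B \<alpha> \<beta>) W) 0"
      if "submodule (family_group Type_D n) (specht_B \<alpha> \<beta>) W" "W \<noteq> {0}" for W
      using has_multiplicity_family_D_zero[OF k _ _ that] dk True by simp
    have "occurs Type_D n d (\<alpha>, \<beta>) 0"
    proof (cases "\<alpha> = \<beta>")
      case True
      then show ?thesis using zero by (auto simp: irreducible_submodule_def irreducible_rep_def)
    next
      case False
      then show ?thesis using zero[OF specht_B_submodule(1)[OF k] specht_B_submodule(2)[OF k]]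
        by (simp add: subrep_rep_space)
    qed
    then show ?thesis using next_zero by blast
  qed
qed

theorem theorem3p21:
  fixes Z :: family and d :: nat
  shows "(\<exists>N. \<forall>n\<ge>N. stable_at Z d n) \<and>
    (Z = Type_A \<longrightarrow> (\<forall>n\<ge>2 * d. stable_at Z d n)) \<and>
    (Z = Type_B \<longrightarrow> (\<forall>n\<ge>d. stable_at Z d n)) \<and>
    (Z = Type_D \<longrightarrow> (\<forall>n>2 * d. stable_at Z d n))"
proof -
  \<comment> \<open>The threshold \<open>2 * d + 1\<close> meets the bounds of all three families at
    once.\<close>
  have "stable_at Z d n" if "n \<ge> 2 * d + 1" for n
    using that by (cases Z) (auto intro: stable_at_A stable_at_B stable_at_D)
  then show ?thesis using stable_at_A stable_at_B stable_at_D by blast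
qed

end
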